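(* Let $\alpha>0$ and $\psi\in\mathcal{LK}$, and assume $\mathbb{E}[\xi_1]<0$ and $0<\theta<\alpha$. Then there exists a positive constant $C_\theta$ such that $$\mathcal{I}_{\alpha,\psi}(x^\alpha)\sim C_\theta\,x^\theta\,\mathcal{I}_{\alpha,\psi_\theta}(x^\alpha)\quad\text{as }x\to\infty .$$ Moreover, if there exists $\beta\in[0,1]$ such that $\lim_{u\to\infty}\psi(u)/u^{1+\beta}=l_\beta$, then $$C_\theta=\frac{\Gamma\left(1-\frac{\theta}{\alpha}\right)}{\alpha}\,l_\beta^{-\theta_\alpha}\,e^{M_\gamma\beta\theta_\alpha}\prod_{k=1}^\infty e^{-\frac{\beta\theta_\alpha}{k}}\,\frac{(k+\theta_\alpha)\,\psi(\alpha k)}{k\,\psi(\alpha k+\theta_\alpha)},$$ where $M_\gamma=0.577\ldots$ stands for the Euler–Mascheroni constant and $\theta_\alpha=\frac{\theta}{\alpha}<1$. Next, introduce the function $$\mathcal{N}_{\alpha,\psi,\theta}(x)=\mathcal{I}_{\alpha,\psi}(x)-C_\theta\,x^{\theta/\alpha}\,\mathcal{I}_{\alpha,\psi_\theta}(x),\qquad x\ge0 .$$ Then $\mathcal{N}_{\alpha,\psi,\theta}$ is analytic on the right half-plane and decreasing on $\mathbb{R}^+$. Finally, the positive random variable $\Sigma_\infty=\int_0^\infty e^{\alpha\xi_s}\,ds$ has the Laplace transform $$\mathbb{E}\left[e^{-q\Sigma_\infty}\right]=\mathcal{N}_{\alpha,\psi,\theta}(q),\qquad q\ge0 .$$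
   Context: $\mathcal{LK}$ is the set of functions $\psi(u)=bu+\frac{\sigma}{2}u^2+\int_0^\infty(e^{-ur}-1+ur\,\mathbb{I}_{\{r\le1\}})\,\nu(dr)$, $u\ge0$, with $b\in\mathbb{R}$, $\sigma\ge0$, $\int_0^\infty(1\wedge r^2)\nu(dr)<\infty$, excluding the degenerate (deterministic) case and the case where $\psi$ is the Laplace exponent of the negative of a subordinator. Under $\mathbb{P}$ (expectation $\mathbb{E}$), $\xi=(\xi_t)_{t\ge0}$ is the spectrally negative Lévy process started at $0$ with $\mathbb{E}[e^{u\xi_t}]=e^{t\psi(u)}$, $u\ge0$; $\mathbb{E}[\xi_1]\in[-\infty,\infty)$. If $\mathbb{E}[\xi_1]<0$, $\theta>0$ denotes the unique positive root of $\psi(\theta)=0$. For $\gamma\ge0$, $\psi_\gamma(u)=\psi(u+\gamma)-\psi(\gamma)$, $u\ge0$, and $$\mathcal{I}_{\alpha,\psi_\gamma}(z)=\sum_{n=0}^\infty a_n(\psi_\gamma;\alpha)z^n,\qquad a_n(\psi_\gamma;\alpha)=\Big(\prod_{k=1}^n\psi_\gamma(\alpha k)\Big)^{-1},\quad a_0=1,$$ with $\mathcal{I}_{\alpha,\psi}$ the case $\gamma=0$ and $\mathcal{I}_{\alpha,\psi_\theta}$ the case $\gamma=\theta$.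
   Formalization: The printed formula for C_θ is false (α=1, ψ(u)=u(u−θ) makes it 0); proved instead, with t=θ/α and 0<l_β<∞: C_θ = α^{−(1+β)t} Γ(1+t)^{−1} l_β^{−t} e^{M_γβt} ∏_{k≥1} e^{−βt/k} kψ(αk+θ)/((k+t)ψ(αk)). *)

theory Defs
  imports "HOL-Probability.Probability"
begin

definition levy_measure :: "real measure \<Rightarrow> bool" where
  "levy_measure \<nu> \<longleftrightarrow> sets \<nu> = sets borel \<and> emeasure \<nu> {..0} = 0 \<and>
     (\<integral>\<^sup>+ r. ennreal (min 1 (r\<^sup>2)) \<partial>\<nu>) < \<infinity>"

(* The Laplace exponent is a function on [0,\<infinity>); its values at negative arguments are
   irrelevant everywhere below. *)

definition levy_khintchine_exponent :: "(real \<Rightarrow> real) \<Rightarrow> bool" where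
  "levy_khintchine_exponent \<psi> \<longleftrightarrow>
     (\<exists>b \<sigma> \<nu>. \<sigma> \<ge> 0 \<and> levy_measure \<nu> \<and>
        (\<forall>u\<ge>0. \<psi> u = b * u + \<sigma> / 2 * u\<^sup>2 +
           (\<integral>r. exp (- u * r) - 1 + u * r * indicator {..1} r \<partial>\<nu>)))"

definition deterministic_exponent :: "(real \<Rightarrow> real) \<Rightarrow> bool" where
  "deterministic_exponent \<psi> \<longleftrightarrow> (\<exists>b. \<forall>u\<ge>0. \<psi> u = b * u)"

definition neg_subordinator_exponent :: "(real \<Rightarrow> real) \<Rightarrow> bool" where
  "neg_subordinator_exponent \<psi> \<longleftrightarrow>
     (\<exists>d \<nu>. d \<ge> 0 \<and> sets \<nu> = sets borel \<and> emeasure \<nu> {..0} = 0 \<and>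
        (\<integral>\<^sup>+ r. ennreal (min 1 r) \<partial>\<nu>) < \<infinity> \<and>
        (\<forall>u\<ge>0. \<psi> u = - d * u + (\<integral>r. exp (- u * r) - 1 \<partial>\<nu>)))"

definition LK :: "(real \<Rightarrow> real) set" where
  "LK = {\<psi>. levy_khintchine_exponent \<psi> \<and> \<not> deterministic_exponent \<psi> \<and>
             \<not> neg_subordinator_exponent \<psi>}"

(* Time is {0..}; the values of \<xi> at negative times are irrelevant. *)

definition cadlag :: "(real \<Rightarrow> real) \<Rightarrow> bool" where
  "cadlag x \<longleftrightarrow> (\<forall>t\<ge>0. continuous (at_right t) x) \<and> (\<forall>t>0. \<exists>l. (x \<longlongrightarrow> l) (at_left t))"

definition levy_process :: "'a measure \<Rightarrow> (real \<Rightarrow> 'a \<Rightarrow> real) \<Rightarrow> bool" where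
  "levy_process M \<xi> \<longleftrightarrow>
     prob_space M \<and>
     (\<forall>t\<ge>0. \<xi> t \<in> borel_measurable M) \<and>
     (AE \<omega> in M. \<xi> 0 \<omega> = 0) \<and>
     (\<forall>\<omega>\<in>space M. cadlag (\<lambda>t. \<xi> t \<omega>)) \<and>
     (\<forall>(t :: nat \<Rightarrow> real) n. 0 \<le> t 0 \<longrightarrow> mono t \<longrightarrow>
        prob_space.indep_vars M (\<lambda>_. borel) (\<lambda>i \<omega>. \<xi> (t (Suc i)) \<omega> - \<xi> (t i) \<omega>) {..<n}) \<and>
     (\<forall>s\<ge>0. \<forall>h\<ge>0. distr M borel (\<lambda>\<omega>. \<xi> (s + h) \<omega> - \<xi> s \<omega>) = distr M borel (\<xi> h))"

definition no_positive_jumps :: "'a measure \<Rightarrow> (real \<Rightarrow> 'a \<Rightarrow> real) \<Rightarrow> bool" where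
  "no_positive_jumps M \<xi> \<longleftrightarrow>
     (AE \<omega> in M. \<forall>t>0. \<forall>l. ((\<lambda>s. \<xi> s \<omega>) \<longlongrightarrow> l) (at_left t) \<longrightarrow> \<xi> t \<omega> \<le> l)"

definition spectrally_negative_levy ::
    "'a measure \<Rightarrow> (real \<Rightarrow> 'a \<Rightarrow> real) \<Rightarrow> (real \<Rightarrow> real) \<Rightarrow> bool" where
  "spectrally_negative_levy M \<xi> \<psi> \<longleftrightarrow>
     levy_process M \<xi> \<and> no_positive_jumps M \<xi> \<and>
     (\<forall>t\<ge>0. \<forall>u\<ge>0. has_bochner_integral M (\<lambda>\<omega>. exp (u * \<xi> t \<omega>)) (exp (t * \<psi> u)))"

(* Expectation in [-\<infinity>,\<infinity>), for X whose positive part is integrable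
   (as is the case for a spectrally negative Levy process at a fixed time). *)

definition extended_expectation :: "'a measure \<Rightarrow> ('a \<Rightarrow> real) \<Rightarrow> ereal" where
  "extended_expectation M X =
     enn2ereal (\<integral>\<^sup>+ \<omega>. ennreal (X \<omega>) \<partial>M) - enn2ereal (\<integral>\<^sup>+ \<omega>. ennreal (- X \<omega>) \<partial>M)"

definition shifted_exponent :: "(real \<Rightarrow> real) \<Rightarrow> real \<Rightarrow> real \<Rightarrow> real" where
  "shifted_exponent \<psi> \<gamma> u = \<psi> (u + \<gamma>) - \<psi> \<gamma>"

definition I_coeff :: "real \<Rightarrow> (real \<Rightarrow> real) \<Rightarrow> nat \<Rightarrow> real" where
  "I_coeff \<alpha> \<psi> n = inverse (\<Prod>k=1..n. \<psi> (\<alpha> * real k))"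

definition I_series ::
    "real \<Rightarrow> (real \<Rightarrow> real) \<Rightarrow> 'b \<Rightarrow> 'b::{real_normed_field,banach}" where
  "I_series \<alpha> \<psi> z = (\<Sum>n. of_real (I_coeff \<alpha> \<psi> n) * z ^ n)"

(* Used at type real (monotonicity, Laplace transform) and at type complex (analyticity);
   complex powr is the principal branch. *)

definition N_fun ::
    "real \<Rightarrow> (real \<Rightarrow> real) \<Rightarrow> real \<Rightarrow> real \<Rightarrow> 'b \<Rightarrow> 'b::{real_normed_field,banach,ln}" where
  "N_fun \<alpha> \<psi> \<theta> C z =
     I_series \<alpha> \<psi> z
     - of_real C * z powr of_real (\<theta> / \<alpha>) * I_series \<alpha> (shifted_exponent \<psi> \<theta>) z"

(* With t = \<theta>/\<alpha>, the value is the Weierstrass-type form of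
     lim_n (\<psi>(\<alpha>n)) powr (-t) * (\<Prod>k=1..n. \<psi>(\<alpha>k + \<theta>) / \<psi>(\<alpha>k)),
   that is, of W(1)/W(1+t) for the log-convex solution W of W(s+1) = \<psi>(\<alpha>s) W(s);
   \<psi>(\<alpha>n) is replaced by l (\<alpha>n)^(1+\<beta>), and the powers of n are absorbed through
     \<Prod>k=1..n. (k+t)/k ~ n^t / Gamma(1+t)  and  \<Prod>k=1..n. exp(-\<beta>t/k) ~ n^(-\<beta>t) exp(-M\<beta>t),
   with M the Euler-Mascheroni constant.
   The literature also has a version with prefactor Gamma(1-t)/\<alpha> (without the power of \<alpha>),
   factors exp(-\<beta>t/k) (k+t) \<psi>(\<alpha>k) / (k \<psi>(\<alpha>k+t)).  That version is not correct: for
   \<alpha> = 1 and \<psi>(u) = u(u-\<theta>), so \<beta> = 1 and l = 1, its product diverges to 0, whereas the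
   series are modified Bessel functions and the constant is Gamma(1-\<theta>)/Gamma(1+\<theta>). *)

definition C_value :: "real \<Rightarrow> (real \<Rightarrow> real) \<Rightarrow> real \<Rightarrow> real \<Rightarrow> real \<Rightarrow> real" where
  "C_value \<alpha> \<psi> \<theta> \<beta> l =
     (let t = \<theta> / \<alpha> in
        \<alpha> powr (- (1 + \<beta>) * t) / Gamma (1 + t) * l powr (- t)
        * exp (euler_mascheroni * \<beta> * t)
        * (\<Prod>j. let k = real (Suc j) in
             exp (- \<beta> * t / k) * (k * \<psi> (\<alpha> * k + \<theta>)) / ((k + t) * \<psi> (\<alpha> * k))))"

definition exponential_functional ::
    "real \<Rightarrow> (real \<Rightarrow> 'a \<Rightarrow> real) \<Rightarrow> 'a \<Rightarrow> ennreal" where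
  "exponential_functional \<alpha> \<xi> \<omega> = (\<integral>\<^sup>+ s\<in>{0..}. ennreal (exp (\<alpha> * \<xi> s \<omega>)) \<partial>lborel)"

end

theory Submission
  imports Defs "HOL-Real_Asymp.Real_Asymp"
begin

text \<open>
  The function $F(x) = \mathcal{I}_{\alpha,\psi}(q e^{\alpha x})$ and the function
  $G(x) = e^{\theta x} \mathcal{I}_{\alpha,\psi_\theta}(q e^{\alpha x})$ both solve
  $\mathcal{L} H = q e^{\alpha x} H$, where $\mathcal{L}$ is the generator of $\xi$, because
  $\mathcal{L} e^{\lambda x} = \psi(\lambda) e^{\lambda x}$ and $\psi(0) = \psi(\theta) = 0$. Let
  $A_t = \int_0^t e^{\alpha \xi_s} ds$ and let $T_a$ be the first passage time above the level $a$.
  Then $e^{-q A_t} H(\xi_t)$, stopped at $T_a$, is a bounded martingale. The combination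
  $H = F - (F(a)/G(a)) G$ vanishes at $a$, the value of $\xi$ at $T_a$, and tends to $1$ at $-\infty$,
  the limit of $\xi$ when $T_a = \infty$. Hence
    $$F(0) - \frac{F(a)}{G(a)} G(0) = E[e^{-q \Sigma_\infty}; T_a = \infty]$$
  (lemma \<open>laplace_below_level_eq\<close>). As $a \rightarrow \infty$ the right-hand side tends to
  $E[e^{-q \Sigma_\infty}]$. So $F(a)/G(a)$ converges, which is the asymptotic equivalence, and its
  limit identifies the Laplace transform with $\mathcal{N}_{\alpha,\psi,\theta}$; monotonicity and
  positivity of the constant are read off from the Laplace transform.

  The optional stopping step is carried out in discrete time, on the grid of mesh $T/2^m$, for
  finite linear combinations of exponentials (lemmas \<open>grid_dynkin\<close> and \<open>dynkin\<close>). On the grid the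
  process may jump over the level. Since $\psi(u) = O(u^2)$, an increment over a time step $h$
  exceeds $\epsilon$ with probability at most a constant times $e^{-\epsilon/\sqrt h}$, so this
  overshoot disappears in the limit. The series $F$ and $G$ are not integrable along $\xi_t$ in
  general, so they are truncated first, which perturbs the equation
  $\mathcal{L} H = q e^{\alpha x} H$ by the last term only (lemma \<open>truncated_eigenfunction\<close>).
  Lemma \<open>dynkin\<close> with $q = 0$ and $H(x) = 1 - e^{\theta(x - a)}$ also gives
  $P(\sup \xi > a) \le e^{-\theta a}$, whence $\Sigma_\infty < \infty$ almost surely.

  For the value of the constant put $t = \theta/\alpha$, and let $a_n$, $b_n$ be the coefficients of the
  two series. The function $\psi$ is log-concave on $(\theta,\infty)$, since $\psi(\theta + w)/w$ is concave
  in $w$; so $a_n / (b_n \psi(\alpha(n+1))^t)$ increases to a finite limit $c$ (lemma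
  \<open>ratio_converges\<close>). If $\psi(\alpha(n+1))/\psi(\alpha n) \rightarrow 1$, then $c$ is also the limit of
  $\mathcal{I}_{\alpha,\psi}(z) / (z^t \mathcal{I}_{\alpha,\psi_\theta}(z))$ (lemma
  \<open>quotient_limit_regular\<close>): under the weights $a_n z^n / \mathcal{I}_{\alpha,\psi}(z)$ both
  $z/\psi(\alpha(n+1))$ and its reciprocal have mean tending to $1$, and the tangent-line inequalities
  for $y^t$ and $y^{-t}$ then force the mean of $(z/\psi(\alpha(n+1)))^t$ to tend to $1$.
\<close>

section \<open>Laplace exponents\<close>

text \<open>The integrand of the Levy--Khintchine formula, compared with $1 \wedge r^2$.\<close>
lemma levy_kernel_bounds:
  fixes u r :: real
  assumes "u \<ge> 0" "r \<ge> 0"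
  shows "exp (- u * r) - 1 + u * r * indicator {..1} r \<le> u\<^sup>2 * min 1 (r\<^sup>2)"
    and "\<bar>exp (- u * r) - 1 + u * r * indicator {..1} r\<bar> \<le> (u\<^sup>2 + 1) * min 1 (r\<^sup>2)"
proof -
  have y0: "u * r \<ge> 0" using assms by simp
  have e1: "exp (- u * r) \<le> 1 / (1 + u * r)"
    using exp_ge_add_one_self[of "u * r"] y0
    by (simp add: exp_minus field_simps)
  have e2: "1 / (1 + u * r) - 1 + u * r \<le> (u * r)\<^sup>2"
  proof -
    have "1 / (1 + u * r) - 1 + u * r = (u * r)\<^sup>2 / (1 + u * r)"
      using y0 by (simp add: field_simps power2_eq_square)
    also have "\<dots> \<le> (u * r)\<^sup>2 / 1"
      using y0 by (intro divide_left_mono) auto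
    finally show ?thesis by simp
  qed
  have e3: "exp (- u * r) - 1 + u * r \<ge> 0"
    using exp_ge_add_one_self[of "- u * r"] by simp
  have e4: "exp (- u * r) \<le> 1" "exp (- u * r) > 0" using y0 by auto
  have A: "exp (- u * r) - 1 + u * r * indicator {..1} r \<le> u\<^sup>2 * min 1 (r\<^sup>2) \<and>
        \<bar>exp (- u * r) - 1 + u * r * indicator {..1} r\<bar> \<le> (u\<^sup>2 + 1) * min 1 (r\<^sup>2)"
  proof (cases "r \<le> 1")
    case True
    then have m: "min 1 (r\<^sup>2) = r\<^sup>2" using assms(2) by (simp add: min_absorb2 power_le_one)
    have "exp (- u * r) - 1 + u * r \<le> u\<^sup>2 * r\<^sup>2"
      using e1 e2 by (simp add: power_mult_distrib)
    moreover have "u\<^sup>2 * r\<^sup>2 \<le> (u\<^sup>2 + 1) * r\<^sup>2" by (intro mult_right_mono) auto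
    moreover have i: "u * r * indicator {..1} r = u * r" using True by simp
    ultimately show ?thesis unfolding m i using e3 by (- , (intro conjI; linarith))
  next
    case False
    have m: "min 1 (r\<^sup>2) = 1" using False one_le_power[of r 2] by (simp add: min_def)
    have i: "u * r * indicator {..1} r = 0" using False by simp
    have "exp (- u * r) - 1 \<le> 0" "\<bar>exp (- u * r) - 1\<bar> \<le> 1"
      using e4 by (simp_all add: abs_le_iff del: mult_minus_left)
    then show ?thesis unfolding m i
      by (simp add: order_trans[OF _ zero_le_power2] add_increasing del: mult_minus_left)
  qed
  then show "exp (- u * r) - 1 + u * r * indicator {..1} r \<le> u\<^sup>2 * min 1 (r\<^sup>2)"
    and "\<bar>exp (- u * r) - 1 + u * r * indicator {..1} r\<bar> \<le> (u\<^sup>2 + 1) * min 1 (r\<^sup>2)" by auto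
qed

lemma levy_measure_facts:
  assumes "levy_measure \<nu>"
  shows "AE r in \<nu>. r > 0"
    and "integrable \<nu> (\<lambda>r. min 1 (r\<^sup>2))"
    and "u \<ge> 0 \<Longrightarrow> integrable \<nu> (\<lambda>r. exp (- u * r) - 1 + u * r * indicator {..1} r)"
proof -
  have s[measurable_cong]: "sets \<nu> = sets borel"
    and z: "emeasure \<nu> {..0} = 0" and f: "(\<integral>\<^sup>+ r. ennreal (min 1 (r\<^sup>2)) \<partial>\<nu>) < \<infinity>"
    using assms by (auto simp: levy_measure_def)
  show ae: "AE r in \<nu>. r > 0"
  proof (rule AE_I)
    show "{x \<in> space \<nu>. \<not> 0 < x} \<subseteq> {..0}" by auto
  qed (use z s in auto)
  show i: "integrable \<nu> (\<lambda>r. min 1 (r\<^sup>2))"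
    by (rule integrableI_nonneg) (use f in auto)
  show "integrable \<nu> (\<lambda>r. exp (- u * r) - 1 + u * r * indicator {..1} r)" if "u \<ge> 0"
  proof (rule Bochner_Integration.integrable_bound)
    show "integrable \<nu> (\<lambda>r. (u\<^sup>2 + 1) * min 1 (r\<^sup>2))" using i by simp
    show "AE r in \<nu>. norm (exp (- u * r) - 1 + u * r * indicator {..1} r)
        \<le> norm ((u\<^sup>2 + 1) * min 1 (r\<^sup>2))"
      using ae
    proof eventually_elim
      case (elim r)
      have "0 \<le> (u\<^sup>2 + 1) * min 1 (r\<^sup>2)" by simp
      then show ?case
        using levy_kernel_bounds(2)[OF that, of r] elim by (simp del: mult_minus_left)
    qed
  qed measurable
qed

lemma levy_khintchine_zero: "levy_khintchine_exponent \<psi> \<Longrightarrow> \<psi> 0 = 0"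
  by (auto simp: levy_khintchine_exponent_def)

lemma levy_khintchine_quadratic_bound:
  assumes "levy_khintchine_exponent \<psi>"
  obtains c where "c \<ge> 0" "\<And>u. u \<ge> 0 \<Longrightarrow> \<psi> u \<le> c * (1 + u\<^sup>2)"
proof -
  obtain b \<sigma> \<nu> where s: "\<sigma> \<ge> 0" and \<nu>: "levy_measure \<nu>"
    and \<psi>: "\<And>u. u \<ge> 0 \<Longrightarrow> \<psi> u = b * u + \<sigma> / 2 * u\<^sup>2 +
           (\<integral>r. exp (- u * r) - 1 + u * r * indicator {..1} r \<partial>\<nu>)"
    using assms unfolding levy_khintchine_exponent_def by blast
  define m where "m = (\<integral>r. min 1 (r\<^sup>2) \<partial>\<nu>)"
  have m0: "m \<ge> 0" unfolding m_def by (intro Bochner_Integration.integral_nonneg) auto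
  define c where "c = \<bar>b\<bar> + \<sigma> / 2 + m"
  show thesis
  proof
    show "c \<ge> 0" using s m0 by (simp add: c_def)
    fix u :: real assume u: "u \<ge> 0"
    have "(\<integral>r. exp (- u * r) - 1 + u * r * indicator {..1} r \<partial>\<nu>) \<le> (\<integral>r. u\<^sup>2 * min 1 (r\<^sup>2) \<partial>\<nu>)"
    proof (rule integral_mono_AE)
      show "AE r in \<nu>. exp (- u * r) - 1 + u * r * indicator {..1} r \<le> u\<^sup>2 * min 1 (r\<^sup>2)"
        using levy_measure_facts(1)[OF \<nu>]
        by eventually_elim (intro levy_kernel_bounds(1), use u in auto)
    qed (use levy_measure_facts[OF \<nu>] u in auto)
    also have "\<dots> = u\<^sup>2 * m" by (simp add: m_def)
    finally have 1: "(\<integral>r. exp (- u * r) - 1 + u * r * indicator {..1} r \<partial>\<nu>) \<le> m * (1 + u\<^sup>2)"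
      using m0 by (simp add: algebra_simps)
    have "u \<le> 1 + u\<^sup>2" using sum_power2_ge_zero[of "u - 1/2" 0]
      by (simp add: power2_eq_square algebra_simps)
    then have 2: "b * u \<le> \<bar>b\<bar> * (1 + u\<^sup>2)"
      using u by (intro mult_mono) auto
    have "\<sigma> / 2 * u\<^sup>2 \<le> \<sigma> / 2 * (1 + u\<^sup>2)" using s by (intro mult_left_mono) auto
    with 1 2 show "\<psi> u \<le> c * (1 + u\<^sup>2)"
      using u by (simp add: \<psi> c_def algebra_simps)
  qed
qed

lemma has_integral_exp_neg:
  fixes w r :: real
  assumes "w > 0" "r \<ge> 0"
  shows "((\<lambda>s. exp (- (w * s))) has_integral (1 - exp (- (w * r))) / w) {0..r}"
proof -
  have "((\<lambda>s. exp (- (w * s))) has_integral (- exp (- (w * r)) / w) - (- exp (- (w * 0)) / w)) {0..r}"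
    by (rule fundamental_theorem_of_calculus)
       (use assms in \<open>auto intro!: derivative_eq_intros simp flip: has_real_derivative_iff_has_vector_derivative\<close>)
  then show ?thesis by (simp add: diff_divide_distrib)
qed

text \<open>The quotient equals $\int_0^r e^{-ws}\,ds$, an integral of functions convex in $w$.\<close>
lemma convex_exp_quotient:
  fixes r :: real
  assumes "r \<ge> 0"
  shows "convex_on {0<..} (\<lambda>w. (1 - exp (- (w * r))) / w)"
proof (rule convex_onI)
  fix t x y :: real assume t: "0 < t" "t < 1" and xy: "x \<in> {0<..}" "y \<in> {0<..}"
  let ?z = "(1 - t) * x + t * y"
  have z: "?z > 0" using t xy by (simp add: add_pos_pos)
  show "(1 - exp (- (((1 - t) *\<^sub>R x + t *\<^sub>R y) * r))) / ((1 - t) *\<^sub>R x + t *\<^sub>R y)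
     \<le> (1 - t) * ((1 - exp (- (x * r))) / x) + t * ((1 - exp (- (y * r))) / y)"
    unfolding real_scaleR_def
  proof (rule has_integral_le)
    show "((\<lambda>s. exp (- (?z * s))) has_integral (1 - exp (- (?z * r))) / ?z) {0..r}"
      by (rule has_integral_exp_neg) (use z assms in auto)
    show "((\<lambda>s. (1 - t) * exp (- (x * s)) + t * exp (- (y * s))) has_integral
        (1 - t) * ((1 - exp (- (x * r))) / x) + t * ((1 - exp (- (y * r))) / y)) {0..r}"
      by (intro has_integral_add has_integral_mult_right has_integral_exp_neg) (use xy assms in auto)
    fix s assume "s \<in> {0..r}"
    have "exp ((1 - t) *\<^sub>R (- (x * s)) + t *\<^sub>R (- (y * s)))
        \<le> (1 - t) * exp (- (x * s)) + t * exp (- (y * s))"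
      by (rule convex_onD[OF exp_convex]) (use t in auto)
    then show "exp (- (?z * s)) \<le> (1 - t) * exp (- (x * s)) + t * exp (- (y * s))"
      by (simp add: algebra_simps)
  qed
qed auto

text \<open>Since $\psi(\theta) = 0$, the quotient is $(\psi(\theta + w) - \psi(\theta))/w$. In the
  Levy--Khintchine formula its drift and Gaussian parts are affine in $w$, and its jump part is the
  integral of $r 1_{r \le 1} - e^{-\theta r} (1 - e^{-wr})/w$, which is concave in $w$.\<close>
lemma concave_on_exponent_quotient:
  assumes "levy_khintchine_exponent \<psi>" "\<theta> > 0" "\<psi> \<theta> = 0"
  shows "concave_on {0<..} (\<lambda>w. \<psi> (\<theta> + w) / w)"
proof -
  obtain b \<sigma> \<nu> where s: "\<sigma> \<ge> 0" and \<nu>: "levy_measure \<nu>"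
    and \<psi>: "\<And>u. u \<ge> 0 \<Longrightarrow> \<psi> u = b * u + \<sigma> / 2 * u\<^sup>2 +
           (\<integral>r. exp (- u * r) - 1 + u * r * indicator {..1} r \<partial>\<nu>)"
    using assms unfolding levy_khintchine_exponent_def by blast
  define k where "k u r = exp (- u * r) - 1 + u * r * indicator {..1} r" for u r :: real
  have k: "integrable \<nu> (k u)" if "u \<ge> 0" for u
    using levy_measure_facts(3)[OF \<nu> that] by (simp add: k_def[abs_def])
  define g where "g w r = (k (\<theta> + w) r - k \<theta> r) / w" for w r
  have g: "integrable \<nu> (g w)" if "w > 0" for w
    unfolding g_def using k[of "\<theta> + w"] k[of \<theta>] that assms(2) by auto
  have g_eq: "g w r = r * indicator {..1} r - exp (- \<theta> * r) * ((1 - exp (- (w * r))) / w)"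
    if "w > 0" for w r
    using that by (simp add: g_def k_def field_simps flip: exp_add)
  have eq: "\<psi> (\<theta> + w) / w = b + \<sigma> / 2 * (2 * \<theta> + w) + (\<integral>r. g w r \<partial>\<nu>)" if "w > 0" for w
  proof -
    have "\<psi> (\<theta> + w) / w = (\<psi> (\<theta> + w) - \<psi> \<theta>) / w" using assms(3) by simp
    also have "\<dots> = b + \<sigma> / 2 * (2 * \<theta> + w) + ((\<integral>r. k (\<theta> + w) r \<partial>\<nu>) - (\<integral>r. k \<theta> r \<partial>\<nu>)) / w"
      using that assms(2) unfolding k_def
      by (subst (1 2) \<psi>) (auto simp: field_simps power2_eq_square)
    also have "((\<integral>r. k (\<theta> + w) r \<partial>\<nu>) - (\<integral>r. k \<theta> r \<partial>\<nu>)) / w = (\<integral>r. g w r \<partial>\<nu>)"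
      unfolding g_def using that assms(2) k[of "\<theta> + w"] k[of \<theta>] by simp
    finally show ?thesis .
  qed
  show ?thesis
    unfolding concave_on_iff
  proof (intro conjI ballI allI impI)
    show "convex {0::real<..}" by simp
    fix x y u v :: real assume xy: "x \<in> {0<..}" "y \<in> {0<..}" and uv: "0 \<le> u" "0 \<le> v" "u + v = 1"
    let ?z = "u *\<^sub>R x + v *\<^sub>R y"
    have "?z \<in> {0<..}" using convexD[of "{0::real<..}" x y u v] xy uv by simp
    then have z: "?z > 0" by simp
    have "u * (\<integral>r. g x r \<partial>\<nu>) + v * (\<integral>r. g y r \<partial>\<nu>) = (\<integral>r. u * g x r + v * g y r \<partial>\<nu>)"
      using g[of x] g[of y] xy by simp
    also have "\<dots> \<le> (\<integral>r. g ?z r \<partial>\<nu>)"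
    proof (rule integral_mono_AE)
      show "AE r in \<nu>. u * g x r + v * g y r \<le> g ?z r"
        using levy_measure_facts(1)[OF \<nu>]
      proof eventually_elim
        case (elim r)
        have "(1 - exp (- (?z * r))) / ?z
          \<le> u * ((1 - exp (- (x * r))) / x) + v * ((1 - exp (- (y * r))) / y)"
          using convex_exp_quotient[of r] elim xy uv unfolding convex_on_def by auto
        then have "exp (- \<theta> * r) * ((1 - exp (- (?z * r))) / ?z)
          \<le> exp (- \<theta> * r) * (u * ((1 - exp (- (x * r))) / x) + v * ((1 - exp (- (y * r))) / y))"
          by (intro mult_left_mono) auto
        moreover have "u * (r * indicator {..1} r) + v * (r * indicator {..1} r) = r * indicator {..1} r"
          using uv by (metis distrib_right mult_1)
        ultimately show ?case
          unfolding g_eq[OF z] using g_eq[of x r] g_eq[of y r] xy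
          by (simp only: greaterThan_iff simp_thms) (simp add: algebra_simps)
      qed
    qed (use g[OF z] g[of x] g[of y] xy in auto)
    finally have 1: "u * (\<integral>r. g x r \<partial>\<nu>) + v * (\<integral>r. g y r \<partial>\<nu>) \<le> (\<integral>r. g ?z r \<partial>\<nu>)" .
    have "u * (b + \<sigma> / 2 * (2 * \<theta> + x)) + v * (b + \<sigma> / 2 * (2 * \<theta> + y)) = 
       (u + v) * (b + \<sigma> * \<theta>) + \<sigma> / 2 * ?z"
      by (simp add: algebra_simps)
    also have "\<dots> = b + \<sigma> / 2 * (2 * \<theta> + ?z)" using uv by (simp add: algebra_simps)
    finally have 2: "u * (b + \<sigma> / 2 * (2 * \<theta> + x)) + v * (b + \<sigma> / 2 * (2 * \<theta> + y)) = b + \<sigma> / 2 * (2 * \<theta> + ?z)" .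
    show "u * (\<psi> (\<theta> + x) / x) + v * (\<psi> (\<theta> + y) / y) \<le> \<psi> (\<theta> + ?z) / ?z"
      using 1 2 xy by (simp only: eq[OF z] eq greaterThan_iff) (simp add: algebra_simps)
  qed
qed

text \<open>The sum of $\ln(u - \theta)$ and the logarithm of the concave function $\psi(u)/(u - \theta)$.\<close>
lemma concave_on_ln_exponent:
  assumes "levy_khintchine_exponent \<psi>" "\<theta> > 0" "\<psi> \<theta> = 0" and pos: "\<And>u. u > \<theta> \<Longrightarrow> \<psi> u > 0"
  shows "concave_on {\<theta><..} (\<lambda>u. ln (\<psi> u))"
  unfolding concave_on_iff
proof (intro conjI ballI allI impI)
  show "convex {\<theta><..}" by simp
  define \<phi> where "\<phi> w = \<psi> (\<theta> + w) / w" for w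
  have cc: "concave_on {0<..} \<phi>"
    using concave_on_exponent_quotient[OF assms(1-3)] by (simp add: \<phi>_def[abs_def])
  have pp: "\<phi> w > 0" if "w > 0" for w using that pos[of "\<theta> + w"] by (simp add: \<phi>_def)
  have eq: "ln (\<psi> u) = ln (u - \<theta>) + ln (\<phi> (u - \<theta>))" if "u > \<theta>" for u
    using that pp[of "u - \<theta>"] pos[OF that]
    by (subst ln_mult_pos[symmetric]) (auto simp: \<phi>_def)
  fix x y u v :: real assume xy: "x \<in> {\<theta><..}" "y \<in> {\<theta><..}" and uv: "0 \<le> u" "0 \<le> v" "u + v = 1"
  let ?z = "u *\<^sub>R x + v *\<^sub>R y"
  have "?z \<in> {\<theta><..}" using convexD[of "{\<theta><..}" x y u v] xy uv by simp
  then have z: "?z > \<theta>" by simp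
  have zz: "?z - \<theta> = u * (x - \<theta>) + v * (y - \<theta>)"
  proof -
    have "u * \<theta> + v * \<theta> = \<theta>" using uv by (metis distrib_right mult_1)
    then show ?thesis by (simp add: algebra_simps)
  qed
  have lc: "u * ln p + v * ln q \<le> ln (u * p + v * q)" if "p > 0" "q > 0" for p q :: real
    using ln_concave that uv unfolding concave_on_iff by auto
  have 1: "u * ln (x - \<theta>) + v * ln (y - \<theta>) \<le> ln (?z - \<theta>)"
    unfolding zz by (rule lc) (use xy in auto)
  have "u * ln (\<phi> (x - \<theta>)) + v * ln (\<phi> (y - \<theta>)) \<le> ln (u * \<phi> (x - \<theta>) + v * \<phi> (y - \<theta>))"
    by (rule lc) (use xy pp in auto)
  also have "\<dots> \<le> ln (\<phi> (?z - \<theta>))"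
  proof (rule ln_mono)
    show "0 < u * \<phi> (x - \<theta>) + v * \<phi> (y - \<theta>)"
    proof (cases "u = 0")
      case True then show ?thesis using uv xy pp[of "y - \<theta>"] by auto
    next
      case False then show ?thesis using uv xy pp[of "y - \<theta>"] pp[of "x - \<theta>"]
        by (intro add_pos_nonneg) auto
    qed
    show "u * \<phi> (x - \<theta>) + v * \<phi> (y - \<theta>) \<le> \<phi> (?z - \<theta>)"
      unfolding zz using cc xy uv unfolding concave_on_iff by auto
  qed
  finally have 2: "u * ln (\<phi> (x - \<theta>)) + v * ln (\<phi> (y - \<theta>)) \<le> ln (\<phi> (?z - \<theta>))" .
  show "u * ln (\<psi> x) + v * ln (\<psi> y) \<le> ln (\<psi> ?z)"
    using 1 2 xy by (simp only: eq[OF z] eq greaterThan_iff) (simp add: algebra_simps)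
qed

section \<open>Exponential moments and independent increments\<close>

text \<open>Weighted arithmetic--geometric mean inequality for $1$ and $e^x$, with its case of equality.\<close>
lemma exp_mult_le_strict:
  fixes p x :: real
  assumes "0 < p" "p < 1"
  shows "exp (p * x) \<le> (1 - p) + p * exp x"
    and "x \<noteq> 0 \<Longrightarrow> exp (p * x) < (1 - p) + p * exp x"
proof -
  have e: "(1 - p) + p * exp x - exp (p * x) =
      exp (p * x) * ((1 - p) * (exp (- (p * x)) - (1 - p * x)) + p * (exp ((1 - p) * x) - (1 + (1 - p) * x)))"
    by (simp add: algebra_simps flip: exp_add)
  have 1: "exp (- (p * x)) - (1 - p * x) \<ge> 0" "exp ((1 - p) * x) - (1 + (1 - p) * x) \<ge> 0"
    using exp_ge_add_one_self[of "- (p * x)"] exp_ge_add_one_self[of "(1 - p) * x"] by simp_all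
  have "(1 - p) + p * exp x - exp (p * x) \<ge> 0"
    unfolding e using 1 assms by (intro mult_nonneg_nonneg add_nonneg_nonneg) auto
  then show "exp (p * x) \<le> (1 - p) + p * exp x" by simp
  assume "x \<noteq> 0"
  then have "exp ((1 - p) * x) - (1 + (1 - p) * x) > 0"
    using exp_ge_add_one_self[of "(1 - p) * x"] exp_eq_one_iff assms
      exp_minus_greater[of "- ((1 - p) * x)"] by simp
  then have "(1 - p) + p * exp x - exp (p * x) > 0"
    unfolding e using 1 assms by (intro mult_pos_pos add_nonneg_pos) auto
  then show "exp (p * x) < (1 - p) + p * exp x" by simp
qed

text \<open>A spectrally negative Levy process whose exponent is in $\mathcal{LK}$. Its paths enter only through
  right-continuity; what replaces the absence of positive jumps is the finiteness of the
  exponential moments with the quadratic bound on $\psi$.\<close>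
locale spectrally_negative = prob_space M for M :: "'a measure" +
  fixes \<xi> :: "real \<Rightarrow> 'a \<Rightarrow> real" and \<psi> :: "real \<Rightarrow> real"
  assumes spectrally_negative_levy: "spectrally_negative_levy M \<xi> \<psi>"
    and exponent_in_LK: "\<psi> \<in> LK"
begin

lemma xi_measurable: "t \<ge> 0 \<Longrightarrow> \<xi> t \<in> borel_measurable M"
  using spectrally_negative_levy by (auto simp: spectrally_negative_levy_def levy_process_def)

lemma xi_zero: "AE \<omega> in M. \<xi> 0 \<omega> = 0"
  using spectrally_negative_levy by (auto simp: spectrally_negative_levy_def levy_process_def)

lemma xi_right_continuous:
  "\<omega> \<in> space M \<Longrightarrow> t \<ge> 0 \<Longrightarrow> ((\<lambda>s. \<xi> s \<omega>) \<longlongrightarrow> \<xi> t \<omega>) (at_right t)"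
  using spectrally_negative_levy
  by (auto simp: spectrally_negative_levy_def levy_process_def cadlag_def continuous_within)

lemma exponential_moment:
  assumes "t \<ge> 0" "u \<ge> 0"
  shows "integrable M (\<lambda>\<omega>. exp (u * \<xi> t \<omega>))" "(\<integral>\<omega>. exp (u * \<xi> t \<omega>) \<partial>M) = exp (t * \<psi> u)"
  using spectrally_negative_levy assms
  by (auto simp: spectrally_negative_levy_def has_bochner_integral_iff)

lemma levy_khintchine: "levy_khintchine_exponent \<psi>"
  using exponent_in_LK by (simp add: LK_def)

lemma psi_zero [simp]: "\<psi> 0 = 0"
  using levy_khintchine by (rule levy_khintchine_zero)

text \<open>Jensen's inequality for $e^{v \xi_1}$, strict because equality would make $\xi_1$ constant and
  $\psi$ linear.\<close>
lemma psi_slope_strict: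
  assumes "0 < u" "u < v"
  shows "\<psi> u / u < \<psi> v / v"
proof -
  define p where "p = u / v"
  define d where "d = \<psi> v / v"
  have p: "0 < p" "p < 1" using assms by (auto simp: p_def)
  have v: "v > 0" using assms by simp
  have int: "integrable M (\<lambda>\<omega>. exp (v * (\<xi> 1 \<omega> - d)))" "integrable M (\<lambda>\<omega>. exp (p * (v * (\<xi> 1 \<omega> - d))))"
    "(\<integral>\<omega>. exp (v * (\<xi> 1 \<omega> - d)) \<partial>M) = 1"
    "(\<integral>\<omega>. exp (p * (v * (\<xi> 1 \<omega> - d))) \<partial>M) = exp (\<psi> u - u * d)"
    using exponential_moment[of 1 v] exponential_moment[of 1 u] assms
    by (simp_all add: p_def d_def right_diff_distrib exp_diff)
  let ?g = "\<lambda>\<omega>. (1 - p) + p * exp (v * (\<xi> 1 \<omega> - d)) - exp (p * (v * (\<xi> 1 \<omega> - d)))"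
  have ig: "integrable M ?g" using int by simp
  have Eg: "(\<integral>\<omega>. ?g \<omega> \<partial>M) = 1 - exp (\<psi> u - u * d)"
    using int by (simp add: prob_space)
  have g0: "?g \<omega> \<ge> 0" for \<omega> using exp_mult_le_strict(1)[OF p, of "v * (\<xi> 1 \<omega> - d)"] by simp
  have ne: "(\<integral>\<omega>. ?g \<omega> \<partial>M) \<noteq> 0"
  proof
    assume "(\<integral>\<omega>. ?g \<omega> \<partial>M) = 0"
    then have "AE \<omega> in M. ?g \<omega> = 0"
      using integral_nonneg_eq_0_iff_AE[OF ig] g0 by simp
    then have ae: "AE \<omega> in M. \<xi> 1 \<omega> = d"
    proof eventually_elim
      case (elim \<omega>)
      have "\<not> v * (\<xi> 1 \<omega> - d) \<noteq> 0"
        using exp_mult_le_strict(2)[OF p, of "v * (\<xi> 1 \<omega> - d)"] elim by linarith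
      then show ?case using v by simp
    qed
    have "\<psi> w = d * w" if "w \<ge> 0" for w
    proof -
      have "exp (\<psi> w) = (\<integral>\<omega>. exp (w * \<xi> 1 \<omega>) \<partial>M)" using exponential_moment(2)[of 1 w] that by simp
      also have "\<dots> = (\<integral>\<omega>. exp (w * d) \<partial>M)"
        using ae xi_measurable[of 1] by (intro integral_cong_AE) auto
      finally show ?thesis by (simp add: prob_space mult.commute)
    qed
    then have "deterministic_exponent \<psi>" by (auto simp: deterministic_exponent_def)
    then show False using exponent_in_LK by (simp add: LK_def)
  qed
  moreover have "(\<integral>\<omega>. ?g \<omega> \<partial>M) \<ge> 0" using g0 by (intro Bochner_Integration.integral_nonneg) auto
  ultimately have "exp (\<psi> u - u * d) < 1" unfolding Eg by simp
  then have "\<psi> u < u * d" by simp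
  then show ?thesis using assms by (simp add: d_def field_simps)
qed

text \<open>The path sampled at the multiples of the mesh \<open>h\<close>.\<close>
definition grid :: "real \<Rightarrow> 'a \<Rightarrow> nat \<Rightarrow> real" where
  "grid h \<omega> j = \<xi> (real j * h) \<omega>"

lemma grid_measurable [measurable]: "h \<ge> 0 \<Longrightarrow> (\<lambda>\<omega>. grid h \<omega> j) \<in> borel_measurable M"
  unfolding grid_def by (rule xi_measurable) simp

lemma grid_increment_moment:
  assumes "h \<ge> 0" "u \<ge> 0"
  shows "integrable M (\<lambda>\<omega>. exp (u * (grid h \<omega> (Suc k) - grid h \<omega> k)))"
    "(\<integral>\<omega>. exp (u * (grid h \<omega> (Suc k) - grid h \<omega> k)) \<partial>M) = exp (h * \<psi> u)"
proof -
  have [measurable]: "\<xi> h \<in> borel_measurable M" using assms xi_measurable by auto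
  have [measurable]: "(\<lambda>\<omega>. grid h \<omega> j) \<in> borel_measurable M" for j
    using assms by measurable
  have "distr M borel (\<lambda>\<omega>. \<xi> (real k * h + h) \<omega> - \<xi> (real k * h) \<omega>) = distr M borel (\<xi> h)"
    using spectrally_negative_levy assms
    by (auto simp: spectrally_negative_levy_def levy_process_def)
  moreover have "(\<lambda>\<omega>. \<xi> (real k * h + h) \<omega> - \<xi> (real k * h) \<omega>) = (\<lambda>\<omega>. grid h \<omega> (Suc k) - grid h \<omega> k)"
    by (simp add: grid_def algebra_simps)
  ultimately have d: "distr M borel (\<lambda>\<omega>. grid h \<omega> (Suc k) - grid h \<omega> k) = distr M borel (\<xi> h)" by simp
  have "integrable (distr M borel (\<xi> h)) (\<lambda>x. exp (u * x))"
    using exponential_moment(1)[OF assms] by (subst integrable_distr_eq) auto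
  then show "integrable M (\<lambda>\<omega>. exp (u * (grid h \<omega> (Suc k) - grid h \<omega> k)))"
    unfolding d[symmetric] by (subst (asm) integrable_distr_eq) auto
  have "(\<integral>\<omega>. exp (u * (grid h \<omega> (Suc k) - grid h \<omega> k)) \<partial>M)
    = integral\<^sup>L (distr M borel (\<lambda>\<omega>. grid h \<omega> (Suc k) - grid h \<omega> k)) (\<lambda>x. exp (u * x))"
    by (subst integral_distr) auto
  also have "\<dots> = (\<integral>\<omega>. exp (u * \<xi> h \<omega>) \<partial>M)" unfolding d by (subst integral_distr) auto
  finally show "(\<integral>\<omega>. exp (u * (grid h \<omega> (Suc k) - grid h \<omega> k)) \<partial>M) = exp (h * \<psi> u)"
    using exponential_moment(2)[OF assms] by simp
qed

lemma grid_sum_increments: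
  "(\<Sum>i<j. grid h \<omega> (Suc i) - grid h \<omega> i) = grid h \<omega> j - grid h \<omega> 0"
  by (induction j) auto

text \<open>The increment after step \<open>k\<close> is independent of every bounded functional \<open>Y\<close> of the
  sampled values up to step \<open>k\<close>. Since \<open>\<xi> 0 = 0\<close> holds only almost surely, \<open>Y\<close> is compared with its evaluation at the
  partial sums of the increments.\<close>
lemma grid_independence:
  fixes Y :: "(nat \<Rightarrow> real) \<Rightarrow> real"
  assumes h: "h \<ge> 0" and u: "u \<ge> 0"
    and local: "\<And>s s'. (\<And>j. j \<le> k \<Longrightarrow> s j = s' j) \<Longrightarrow> Y s = Y s'"
    and meas: "(\<lambda>y. Y (\<lambda>j. \<Sum>i<min j k. y i)) \<in> borel_measurable (PiM {..<k} (\<lambda>_. borel))"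
    and meas_grid [measurable]: "(\<lambda>\<omega>. Y (grid h \<omega>)) \<in> borel_measurable M"
    and bound: "\<And>s. \<bar>Y s\<bar> \<le> B"
  shows "integrable M (\<lambda>\<omega>. Y (grid h \<omega>) * exp (u * (grid h \<omega> (Suc k) - grid h \<omega> k)))"
    and "(\<integral>\<omega>. Y (grid h \<omega>) * exp (u * (grid h \<omega> (Suc k) - grid h \<omega> k)) \<partial>M)
        = (\<integral>\<omega>. Y (grid h \<omega>) \<partial>M) * exp (h * \<psi> u)"
proof -
  define X where "X i \<omega> = grid h \<omega> (Suc i) - grid h \<omega> i" for i \<omega>
  define R where "R \<omega> = (\<lambda>i\<in>{..<k}. X i \<omega>)" for \<omega>
  define Z where "Z y = Y (\<lambda>j. \<Sum>i<min j k. y i)" for y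
  have ind: "indep_vars (\<lambda>_. borel) X {..<Suc k}"
  proof -
    have t: "0 \<le> (\<lambda>i. real i * h) 0" "mono (\<lambda>i. real i * h)"
      using h by (auto intro!: monoI mult_right_mono)
    have "\<forall>(t :: nat \<Rightarrow> real) n. 0 \<le> t 0 \<longrightarrow> mono t \<longrightarrow>
        indep_vars (\<lambda>_. borel) (\<lambda>i \<omega>. \<xi> (t (Suc i)) \<omega> - \<xi> (t i) \<omega>) {..<n}"
      using spectrally_negative_levy unfolding spectrally_negative_levy_def levy_process_def
      by (elim conjE) assumption
    from this[rule_format, OF t, of "Suc k"]
    show ?thesis by (simp add: X_def[abs_def] grid_def)
  qed
  have "indep_var (PiM {..<k} (\<lambda>_. borel)) (\<lambda>\<omega>. restrict (\<lambda>i. X i \<omega>) {..<k})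
          (PiM {k} (\<lambda>_. borel)) (\<lambda>\<omega>. restrict (\<lambda>i. X i \<omega>) {k})"
    by (rule indep_var_restrict[OF ind]) auto
  then have "indep_var borel (Z \<circ> (\<lambda>\<omega>. restrict (\<lambda>i. X i \<omega>) {..<k}))
       borel ((\<lambda>y. exp (u * y k)) \<circ> (\<lambda>\<omega>. restrict (\<lambda>i. X i \<omega>) {k}))"
    by (rule indep_var_compose) (use meas in \<open>auto simp: Z_def[abs_def]\<close>)
  then have iv: "indep_var borel (\<lambda>\<omega>. Z (R \<omega>)) borel (\<lambda>\<omega>. exp (u * X k \<omega>))"
    by (simp add: comp_def R_def)
  have mR[measurable]: "(\<lambda>\<omega>. Z (R \<omega>)) \<in> borel_measurable M"
    using indep_var_rv1[OF iv] by simp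
  have iZ: "integrable M (\<lambda>\<omega>. Z (R \<omega>))"
    by (rule integrable_const_bound[where B=B, OF _ mR]) (simp add: Z_def bound)
  have ie: "integrable M (\<lambda>\<omega>. exp (u * X k \<omega>))"
    unfolding X_def by (rule grid_increment_moment[OF h u])
  have eq: "AE \<omega> in M. Y (grid h \<omega>) = Z (R \<omega>)"
    using xi_zero
  proof eventually_elim
    case (elim \<omega>)
    show ?case unfolding Z_def
    proof (rule local)
      fix j assume j: "j \<le> k"
      have "(\<Sum>i<min j k. R \<omega> i) = (\<Sum>i<j. X i \<omega>)"
        using j by (intro sum.cong) (auto simp: R_def min_def)
      also have "\<dots> = grid h \<omega> j - grid h \<omega> 0" by (simp add: X_def grid_sum_increments)
      also have "grid h \<omega> 0 = 0" using elim by (simp add: grid_def)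
      finally show "grid h \<omega> j = (\<Sum>i<min j k. R \<omega> i)" by simp
    qed
  qed
  have eq': "AE \<omega> in M. Y (grid h \<omega>) * exp (u * (grid h \<omega> (Suc k) - grid h \<omega> k)) = Z (R \<omega>) * exp (u * X k \<omega>)"
    using eq by (auto simp: X_def)
  have [measurable]: "(\<lambda>\<omega>. grid h \<omega> j) \<in> borel_measurable M" for j using h by measurable
  have [measurable]: "X k \<in> borel_measurable M" unfolding X_def[abs_def] by measurable
  show "integrable M (\<lambda>\<omega>. Y (grid h \<omega>) * exp (u * (grid h \<omega> (Suc k) - grid h \<omega> k)))"
    by (subst integrable_cong_AE[OF _ _ eq']) (use indep_var_integrable[OF iv iZ ie] in auto)
  have "(\<integral>\<omega>. Y (grid h \<omega>) * exp (u * (grid h \<omega> (Suc k) - grid h \<omega> k)) \<partial>M) =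
      (\<integral>\<omega>. Z (R \<omega>) * exp (u * X k \<omega>) \<partial>M)"
    by (rule integral_cong_AE[OF _ _ eq']) auto
  also have "\<dots> = (\<integral>\<omega>. Z (R \<omega>) \<partial>M) * (\<integral>\<omega>. exp (u * X k \<omega>) \<partial>M)"
    by (rule indep_var_lebesgue_integral[OF iv iZ ie])
  also have "(\<integral>\<omega>. Z (R \<omega>) \<partial>M) = (\<integral>\<omega>. Y (grid h \<omega>) \<partial>M)"
    by (rule integral_cong_AE) (use eq in auto)
  also have "(\<integral>\<omega>. exp (u * X k \<omega>) \<partial>M) = exp (h * \<psi> u)"
    unfolding X_def by (rule grid_increment_moment[OF h u])
  finally show "(\<integral>\<omega>. Y (grid h \<omega>) * exp (u * (grid h \<omega> (Suc k) - grid h \<omega> k)) \<partial>M)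
        = (\<integral>\<omega>. Y (grid h \<omega>) \<partial>M) * exp (h * \<psi> u)" .
qed

end

section \<open>Optional stopping on a time grid\<close>

text \<open>The discrete multiplicative functional: killing at rate $q e^{\alpha x}$ (with \<open>v\<close> the product of \<open>q\<close>
  and the mesh) and, on exceeding the level \<open>a\<close>, annihilation. The left endpoint rule makes the step from \<open>k\<close>
  to \<open>k + 1\<close> depend on the past only.\<close>
definition weight :: "real \<Rightarrow> real \<Rightarrow> real \<Rightarrow> nat \<Rightarrow> (nat \<Rightarrow> real) \<Rightarrow> real" where
  "weight a \<alpha> v k s = (if \<forall>j\<le>k. s j \<le> a then exp (- v * (\<Sum>j<k. exp (\<alpha> * s j))) else 0)"

lemma weight_nonneg: "0 \<le> weight a \<alpha> v k s"
  by (simp add: weight_def)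

lemma weight_le: "v \<ge> 0 \<Longrightarrow> weight a \<alpha> v k s \<le> weight a \<alpha> 0 k s"
  by (simp add: weight_def sum_nonneg)

lemma weight_zero_le_one: "weight a \<alpha> 0 k s \<le> 1"
  by (simp add: weight_def)

lemma weight_le_one: "v \<ge> 0 \<Longrightarrow> weight a \<alpha> v k s \<le> 1"
  using weight_le weight_zero_le_one order_trans by blast

lemma weight_eq_0: "s k > a \<Longrightarrow> weight a \<alpha> v k s = 0"
  by (auto simp: weight_def not_le)

lemma weight_Suc:
  "weight a \<alpha> v (Suc k) s =
     weight a \<alpha> v k s * (if s (Suc k) \<le> a then exp (- v * exp (\<alpha> * s k)) else 0)"
  by (auto simp: weight_def le_Suc_eq algebra_simps simp flip: exp_add)

lemma weight_cong:
  assumes "\<And>j. j \<le> k \<Longrightarrow> s j = s' j"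
  shows "weight a \<alpha> v k s = weight a \<alpha> v k s'"
proof -
  have "(\<Sum>j<k. exp (\<alpha> * s j)) = (\<Sum>j<k. exp (\<alpha> * s' j))" using assms by (intro sum.cong) auto
  then show ?thesis using assms by (simp add: weight_def)
qed

lemma measurable_weight:
  assumes [measurable]: "\<And>j. (\<lambda>x. S x j) \<in> borel_measurable N"
  shows "(\<lambda>x. weight a \<alpha> v k (S x)) \<in> borel_measurable N"
  unfolding weight_def by measurable

lemma weight_mult_bound:
  assumes v: "v \<ge> 0" and B: "\<And>x. x \<le> a \<Longrightarrow> \<bar>g x\<bar> \<le> B"
  shows "\<bar>weight a \<alpha> v k s * g (s k)\<bar> \<le> B"
proof (cases "s k \<le> a")
  case True
  have "\<bar>weight a \<alpha> v k s * g (s k)\<bar> \<le> 1 * B"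
    unfolding abs_mult using weight_nonneg[of a \<alpha> v k s] weight_le_one[OF v, of a \<alpha> k s] B[OF True]
    by (intro mult_mono) auto
  then show ?thesis by simp
next
  case False
  have "\<bar>g a\<bar> \<le> B" by (rule B) simp
  then show ?thesis using False weight_eq_0[of a s k \<alpha> v] by simp
qed

context spectrally_negative
begin

lemma weight_grid_step:
  assumes h: "h \<ge> 0" and u: "u \<ge> 0" and v: "v \<ge> 0"
    and [measurable]: "g \<in> borel_measurable borel"
    and B: "\<And>x. x \<le> a \<Longrightarrow> \<bar>g x\<bar> \<le> B"
  shows "integrable M (\<lambda>\<omega>. weight a \<alpha> v k (grid h \<omega>) * g (grid h \<omega> k))"
    and "integrable M (\<lambda>\<omega>. weight a \<alpha> v k (grid h \<omega>) * g (grid h \<omega> k)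
            * exp (u * (grid h \<omega> (Suc k) - grid h \<omega> k)))"
    and "(\<integral>\<omega>. weight a \<alpha> v k (grid h \<omega>) * g (grid h \<omega> k)
            * exp (u * (grid h \<omega> (Suc k) - grid h \<omega> k)) \<partial>M)
        = (\<integral>\<omega>. weight a \<alpha> v k (grid h \<omega>) * g (grid h \<omega> k) \<partial>M) * exp (h * \<psi> u)"
proof -
  let ?Y = "\<lambda>s. weight a \<alpha> v k s * g (s k)"
  have [measurable]: "(\<lambda>\<omega>. grid h \<omega> j) \<in> borel_measurable M" for j using h by measurable
  have m: "(\<lambda>\<omega>. ?Y (grid h \<omega>)) \<in> borel_measurable M"
    using measurable_weight[of "\<lambda>\<omega>. grid h \<omega>" M a \<alpha> v k] by measurable
  have [measurable]: "(\<lambda>y. \<Sum>i<min j k. y i) \<in> borel_measurable (PiM {..<k} (\<lambda>_. borel :: real measure))" for j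
    by (intro borel_measurable_sum measurable_component_singleton) auto
  have mY: "(\<lambda>y. ?Y (\<lambda>j. \<Sum>i<min j k. y i)) \<in> borel_measurable (PiM {..<k} (\<lambda>_. borel))"
    using measurable_weight[of "\<lambda>y j. \<Sum>i<min j k. y i" "PiM {..<k} (\<lambda>_. borel)" a \<alpha> v k]
    by measurable
  have bd: "\<bar>?Y s\<bar> \<le> B" for s by (rule weight_mult_bound[OF v B])
  have loc: "?Y s = ?Y s'" if "\<And>j. j \<le> k \<Longrightarrow> s j = s' j" for s s'
    using weight_cong[OF that] that[of k] by simp
  show "integrable M (\<lambda>\<omega>. ?Y (grid h \<omega>))"
    by (rule integrable_const_bound[where B=B]) (use bd m in auto)
  show "integrable M (\<lambda>\<omega>. ?Y (grid h \<omega>) * exp (u * (grid h \<omega> (Suc k) - grid h \<omega> k)))"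
    "(\<integral>\<omega>. ?Y (grid h \<omega>) * exp (u * (grid h \<omega> (Suc k) - grid h \<omega> k)) \<partial>M)
        = (\<integral>\<omega>. ?Y (grid h \<omega>) \<partial>M) * exp (h * \<psi> u)"
    using grid_independence[OF h u loc mY m bd] by auto
qed

text \<open>Optional stopping on the grid for a finite sum \<open>H\<close> of exponentials vanishing at the level \<open>a\<close>. The
  bound \<open>G\<close> is the one-step defect of the martingale property below \<open>a\<close>. A step over the level
  contributes at most \<open>\<eta>\<close> times the probability of crossing if the overshoot is at most \<open>\<epsilon>\<close>; larger
  overshoots are estimated with the exponential moment of order \<open>\<mu>\<close>, which gives \<open>\<rho>\<close>.\<close>
lemma grid_dynkin:
  fixes c p :: "'i \<Rightarrow> real"
  assumes fin: "finite J" and p: "\<And>i. i \<in> J \<Longrightarrow> p i \<ge> 0"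
    and h: "h \<ge> 0" and v: "v \<ge> 0" and \<epsilon>: "\<epsilon> \<ge> 0" and \<mu>: "\<mu> \<ge> 0"
    and H: "\<And>x. H x = (\<Sum>i\<in>J. c i * exp (p i * x))" and Ha: "H a = 0"
    and G: "\<And>x. x \<le> a \<Longrightarrow>
      \<bar>\<Sum>i\<in>J. c i * (exp (h * \<psi> (p i) - v * exp (\<alpha> * x)) - 1) * exp (p i * x)\<bar> \<le> G"
  defines "\<eta> \<equiv> \<Sum>i\<in>J. \<bar>c i\<bar> * exp (p i * a) * (exp (p i * \<epsilon>) - 1)"
    and "\<rho> \<equiv> \<Sum>i\<in>J. \<bar>c i\<bar> * exp (p i * a - \<mu> * \<epsilon> + h * \<psi> (p i + \<mu>))"
    and "V \<equiv> \<lambda>k. \<integral>\<omega>. weight a \<alpha> 0 k (grid h \<omega>) \<partial>M"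
    and "U \<equiv> \<lambda>k. \<integral>\<omega>. weight a \<alpha> v k (grid h \<omega>) * H (grid h \<omega> k) \<partial>M"
  shows "\<bar>U k - U 0\<bar> \<le> real k * (G + \<rho>) + \<eta> * (V 0 - V k)"
proof (induction k)
  case 0
  then show ?case by simp
next
  case (Suc k)
  let ?S = "grid h"
  define W where "W \<omega> = weight a \<alpha> v k (?S \<omega>)" for \<omega>
  define W0 where "W0 \<omega> = weight a \<alpha> 0 k (?S \<omega>)" for \<omega>
  define W1 where "W1 \<omega> = weight a \<alpha> 0 (Suc k) (?S \<omega>)" for \<omega>
  define d where "d \<omega> = ?S \<omega> (Suc k) - ?S \<omega> k" for \<omega>
  define e where "e x = exp (- v * exp (\<alpha> * x))" for x :: real
  have Sm[measurable]: "(\<lambda>\<omega>. ?S \<omega> j) \<in> borel_measurable M" for j using h by measurable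
  have [measurable]: "W \<in> borel_measurable M" "W0 \<in> borel_measurable M" "W1 \<in> borel_measurable M"
    unfolding W_def[abs_def] W0_def[abs_def] W1_def[abs_def] by (intro measurable_weight Sm)+
  have [measurable]: "H \<in> borel_measurable borel" unfolding H[abs_def] by measurable
  have [measurable]: "e \<in> borel_measurable borel" unfolding e_def[abs_def] by measurable
  have e01: "0 \<le> e x" "e x \<le> 1" for x using v by (auto simp: e_def)
  have W01: "0 \<le> W \<omega>" "W \<omega> \<le> W0 \<omega>" "W0 \<omega> \<le> 1" "0 \<le> W0 \<omega>" "0 \<le> W1 \<omega>" "W1 \<omega> \<le> 1" for \<omega>
    unfolding W_def W0_def W1_def using v by (auto intro: weight_nonneg weight_le weight_zero_le_one)
  have iW: "integrable M W0" "integrable M W1"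
    by (rule integrable_const_bound[where B=1]; use W01 in auto)+
  have pb: "\<bar>exp (p i * x)\<bar> \<le> exp (p i * a)" if "i \<in> J" "x \<le> a" for i x
    using p[OF that(1)] that by (auto intro: mult_left_mono)
  define B where "B = (\<Sum>i\<in>J. \<bar>c i\<bar> * exp (p i * a))"
  have Hb: "\<bar>H x\<bar> \<le> B" if "x \<le> a" for x
    unfolding H B_def
    by (rule order_trans[OF sum_abs]) (auto intro!: sum_mono mult_left_mono simp: abs_mult p that)
  have iU: "integrable M (\<lambda>\<omega>. W \<omega> * H (?S \<omega> k))"
    unfolding W_def using weight_grid_step(1)[where g=H and a=a and \<alpha>=\<alpha> and k=k, OF h order_refl v _ Hb] by auto
  \<comment> \<open>\<open>A\<close> is the value after the step before the test against the level; its part above the level is \<open>Bf\<close>.\<close>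
  define A where "A \<omega> = W \<omega> * (e (?S \<omega> k) * H (?S \<omega> (Suc k)))" for \<omega>
  have A_eq: "A \<omega> = (\<Sum>i\<in>J. c i * (W \<omega> * (e (?S \<omega> k) * exp (p i * ?S \<omega> k)) * exp (p i * d \<omega>)))" for \<omega>
    unfolding A_def H d_def
    by (simp add: sum_distrib_left algebra_simps flip: exp_add)
  have eb: "\<bar>e x * exp (p i * x)\<bar> \<le> exp (p i * a)" if "i \<in> J" "x \<le> a" for i x
  proof -
    have "\<bar>e x * exp (p i * x)\<bar> \<le> 1 * exp (p i * a)"
      unfolding abs_mult using pb[OF that] e01[of x] by (intro mult_mono) auto
    then show ?thesis by simp
  qed
  have stepA: "integrable M (\<lambda>\<omega>. W \<omega> * (e (?S \<omega> k) * exp (p i * ?S \<omega> k)))"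
    "integrable M (\<lambda>\<omega>. W \<omega> * (e (?S \<omega> k) * exp (p i * ?S \<omega> k)) * exp (p i * d \<omega>))"
    "(\<integral>\<omega>. W \<omega> * (e (?S \<omega> k) * exp (p i * ?S \<omega> k)) * exp (p i * d \<omega>) \<partial>M)
      = (\<integral>\<omega>. W \<omega> * (e (?S \<omega> k) * exp (p i * ?S \<omega> k)) \<partial>M) * exp (h * \<psi> (p i))" if "i \<in> J" for i
    using weight_grid_step[where g="\<lambda>x. e x * exp (p i * x)" and a=a and \<alpha>=\<alpha> and k=k, OF h p[OF that] v _ eb[OF that]]
    unfolding W_def d_def by auto
  have iA: "integrable M A"
    unfolding A_eq[abs_def] by (intro Bochner_Integration.integrable_sum integrable_mult_right stepA(2)) auto
  have EA: "(\<integral>\<omega>. A \<omega> \<partial>M) = (\<integral>\<omega>. W \<omega> * (\<Sum>i\<in>J. c i * exp (h * \<psi> (p i)) * (e (?S \<omega> k) * exp (p i * ?S \<omega> k))) \<partial>M)"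
  proof -
    have "(\<integral>\<omega>. A \<omega> \<partial>M) = (\<Sum>i\<in>J. c i * ((\<integral>\<omega>. W \<omega> * (e (?S \<omega> k) * exp (p i * ?S \<omega> k)) \<partial>M) * exp (h * \<psi> (p i))))"
      unfolding A_eq
      by (subst Bochner_Integration.integral_sum)
         (auto intro!: sum.cong integrable_mult_right stepA(2) simp: stepA(3))
    also have "\<dots> = (\<integral>\<omega>. (\<Sum>i\<in>J. c i * exp (h * \<psi> (p i)) * (W \<omega> * (e (?S \<omega> k) * exp (p i * ?S \<omega> k)))) \<partial>M)"
      by (subst Bochner_Integration.integral_sum)
         (auto intro!: sum.cong integrable_mult_right stepA(1))
    also have "\<dots> = (\<integral>\<omega>. W \<omega> * (\<Sum>i\<in>J. c i * exp (h * \<psi> (p i)) * (e (?S \<omega> k) * exp (p i * ?S \<omega> k))) \<partial>M)"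
      by (simp add: sum_distrib_left mult_ac)
    finally show ?thesis .
  qed
  have Adiff: "\<bar>(\<integral>\<omega>. A \<omega> \<partial>M) - U k\<bar> \<le> G"
  proof -
    let ?D = "\<lambda>x. \<Sum>i\<in>J. c i * (exp (h * \<psi> (p i) - v * exp (\<alpha> * x)) - 1) * exp (p i * x)"
    have i1: "integrable M (\<lambda>\<omega>. W \<omega> * (\<Sum>i\<in>J. c i * exp (h * \<psi> (p i)) * (e (?S \<omega> k) * exp (p i * ?S \<omega> k))))"
    proof -
      have "integrable M (\<lambda>\<omega>. \<Sum>i\<in>J. c i * exp (h * \<psi> (p i)) * (W \<omega> * (e (?S \<omega> k) * exp (p i * ?S \<omega> k))))"
        by (intro Bochner_Integration.integrable_sum integrable_mult_right stepA(1)) auto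
      then show ?thesis by (simp add: sum_distrib_left mult_ac)
    qed
    have "(\<integral>\<omega>. A \<omega> \<partial>M) - U k = (\<integral>\<omega>. W \<omega> * ?D (?S \<omega> k) \<partial>M)"
      unfolding EA U_def W_def[symmetric]
      by (subst Bochner_Integration.integral_diff[symmetric, OF i1 iU])
         (auto intro!: Bochner_Integration.integral_cong
            simp: H e_def exp_diff exp_minus sum_distrib_left sum_subtractf[symmetric] field_simps)
    also have "\<bar>\<dots>\<bar> \<le> (\<integral>\<omega>. G \<partial>M)"
    proof (rule order_trans[OF integral_abs_bound], rule integral_mono)
      show bd: "\<bar>W \<omega> * ?D (?S \<omega> k)\<bar> \<le> G" for \<omega>
        unfolding W_def by (rule weight_mult_bound[OF v G])
      show "integrable M (\<lambda>\<omega>. \<bar>W \<omega> * ?D (?S \<omega> k)\<bar>)"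
        by (rule integrable_const_bound[where B=G]) (use bd in auto)
    qed auto
    finally show ?thesis by (simp add: prob_space)
  qed
  define Bf where "Bf \<omega> = (if ?S \<omega> (Suc k) > a then A \<omega> else 0)" for \<omega>
  define P where "P \<omega> = (\<Sum>i\<in>J. \<bar>c i\<bar> * exp (p i * a - \<mu> * \<epsilon>) * (W0 \<omega> * exp ((p i + \<mu>) * d \<omega>)))" for \<omega>
  have P0: "P \<omega> \<ge> 0" for \<omega> unfolding P_def using W01 by (intro sum_nonneg) auto
  have \<eta>0: "\<eta> \<ge> 0" unfolding \<eta>_def using p \<epsilon> by (intro sum_nonneg) auto
  have Bb: "\<bar>Bf \<omega>\<bar> \<le> \<eta> * (W0 \<omega> - W1 \<omega>) + P \<omega>" for \<omega>
  proof (cases "?S \<omega> (Suc k) > a")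
    case False
    have "W1 \<omega> \<le> W0 \<omega>" unfolding W0_def W1_def weight_Suc by (auto intro: weight_nonneg)
    then show ?thesis using False P0[of \<omega>] \<eta>0 by (simp add: Bf_def)
  next
    case True
    have W1: "W1 \<omega> = 0" using True by (simp add: W1_def weight_eq_0)
    show ?thesis
    proof (cases "W0 \<omega> = 0")
      case True
      then have "W \<omega> = 0" using W01[of \<omega>] by simp
      then show ?thesis using True W1 P0[of \<omega>] by (simp add: Bf_def A_def)
    next
      case False
      then have W0: "W0 \<omega> = 1" and Sk: "?S \<omega> k \<le> a" by (auto simp: W0_def weight_def split: if_splits)
      let ?x = "?S \<omega> (Suc k)"
      have "\<bar>Bf \<omega>\<bar> \<le> 1 * (1 * \<bar>H ?x\<bar>)"
        using True unfolding Bf_def A_def by (simp only: if_True abs_mult)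
          (intro mult_mono; use e01 W01[of \<omega>] in auto)
      moreover have Hx: "\<bar>H ?x\<bar> \<le> (\<Sum>i\<in>J. \<bar>c i\<bar> * (exp (p i * ?x) - exp (p i * a)))"
      proof -
        have "H ?x = H ?x - H a" using Ha by simp
        also have "\<dots> = (\<Sum>i\<in>J. c i * (exp (p i * ?x) - exp (p i * a)))"
          by (simp add: H right_diff_distrib sum_subtractf)
        also have "\<bar>\<dots>\<bar> \<le> (\<Sum>i\<in>J. \<bar>c i * (exp (p i * ?x) - exp (p i * a))\<bar>)" by (rule sum_abs)
        also have "\<dots> = (\<Sum>i\<in>J. \<bar>c i\<bar> * (exp (p i * ?x) - exp (p i * a)))"
        proof (rule sum.cong[OF refl])
          fix i assume "i \<in> J"
          then have "exp (p i * a) \<le> exp (p i * ?x)" using True p by (simp add: mult_left_mono)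
          then show "\<bar>c i * (exp (p i * ?x) - exp (p i * a))\<bar> = \<bar>c i\<bar> * (exp (p i * ?x) - exp (p i * a))"
            by (simp add: abs_mult)
        qed
        finally show ?thesis .
      qed
      moreover have "(\<Sum>i\<in>J. \<bar>c i\<bar> * (exp (p i * ?x) - exp (p i * a))) \<le> \<eta> + P \<omega>"
      proof (cases "?x \<le> a + \<epsilon>")
        case True
        have "(\<Sum>i\<in>J. \<bar>c i\<bar> * (exp (p i * ?x) - exp (p i * a))) \<le> \<eta>"
          unfolding \<eta>_def
        proof (rule sum_mono)
          fix i assume i: "i \<in> J"
          have "exp (p i * ?x) \<le> exp (p i * a) * exp (p i * \<epsilon>)"
            using mult_left_mono[OF True p[OF i]] by (simp add: exp_add[symmetric] algebra_simps)
          then have "\<bar>c i\<bar> * (exp (p i * ?x) - exp (p i * a)) \<le> \<bar>c i\<bar> * (exp (p i * a) * (exp (p i * \<epsilon>) - 1))"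
            by (intro mult_left_mono) (auto simp: algebra_simps)
          then show "\<bar>c i\<bar> * (exp (p i * ?x) - exp (p i * a)) \<le> \<bar>c i\<bar> * exp (p i * a) * (exp (p i * \<epsilon>) - 1)"
            by (simp add: mult.assoc)
        qed
        then show ?thesis using P0[of \<omega>] by simp
      next
        case False
        have "(\<Sum>i\<in>J. \<bar>c i\<bar> * (exp (p i * ?x) - exp (p i * a))) \<le> P \<omega>"
          unfolding P_def
        proof (rule sum_mono)
          fix i assume i: "i \<in> J"
          have d\<epsilon>: "d \<omega> \<ge> \<epsilon>" using False Sk by (simp add: d_def)
          have "p i * ?x = p i * ?S \<omega> k + p i * d \<omega>" by (simp add: d_def algebra_simps)
          also have "\<dots> \<le> p i * a + p i * d \<omega> + \<mu> * (d \<omega> - \<epsilon>)"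
            using mult_left_mono[OF Sk p[OF i]] mult_nonneg_nonneg[OF \<mu>, of "d \<omega> - \<epsilon>"] d\<epsilon> by linarith
          finally have "exp (p i * ?x) \<le> exp (p i * a - \<mu> * \<epsilon>) * exp ((p i + \<mu>) * d \<omega>)"
            by (simp add: exp_add[symmetric] algebra_simps)
          moreover have "exp (p i * a) > 0" by simp
          ultimately have "exp (p i * ?x) - exp (p i * a) \<le> exp (p i * a - \<mu> * \<epsilon>) * exp ((p i + \<mu>) * d \<omega>)"
            by linarith
          then have "\<bar>c i\<bar> * (exp (p i * ?x) - exp (p i * a)) \<le> \<bar>c i\<bar> * (exp (p i * a - \<mu> * \<epsilon>) * exp ((p i + \<mu>) * d \<omega>))"
            by (intro mult_left_mono) auto
          then show "\<bar>c i\<bar> * (exp (p i * ?x) - exp (p i * a)) \<le> \<bar>c i\<bar> * exp (p i * a - \<mu> * \<epsilon>) * (W0 \<omega> * exp ((p i + \<mu>) * d \<omega>))"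
            by (simp add: mult.assoc W0)
        qed
        then show ?thesis using \<eta>0 by simp
      qed
      ultimately show ?thesis using W0 W1 by simp
    qed
  qed
  have one_b: "\<bar>1::real\<bar> \<le> 1" by simp
  have stepP: "integrable M (\<lambda>\<omega>. W0 \<omega> * exp ((p i + \<mu>) * d \<omega>))"
    "(\<integral>\<omega>. W0 \<omega> * exp ((p i + \<mu>) * d \<omega>) \<partial>M) = (\<integral>\<omega>. W0 \<omega> \<partial>M) * exp (h * \<psi> (p i + \<mu>))" if "i \<in> J" for i
    using weight_grid_step(2,3)[where g="\<lambda>_. 1" and a=a and \<alpha>=\<alpha> and k=k and u="p i + \<mu>", OF h _ order_refl _ one_b] p[OF that] \<mu>
    by (auto simp: W0_def d_def)
  have iP: "integrable M P"
    unfolding P_def[abs_def] by (intro Bochner_Integration.integrable_sum integrable_mult_right stepP(1)) auto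
  have EP: "(\<integral>\<omega>. P \<omega> \<partial>M) \<le> \<rho>"
  proof -
    have "(\<integral>\<omega>. P \<omega> \<partial>M) = (\<Sum>i\<in>J. \<bar>c i\<bar> * exp (p i * a - \<mu> * \<epsilon>) * ((\<integral>\<omega>. W0 \<omega> \<partial>M) * exp (h * \<psi> (p i + \<mu>))))"
      unfolding P_def
      by (subst Bochner_Integration.integral_sum)
         (auto intro!: sum.cong integrable_mult_right stepP(1) simp: stepP(2))
    also have "\<dots> \<le> \<rho>" unfolding \<rho>_def
    proof (rule sum_mono)
      fix i assume "i \<in> J"
      have "(\<integral>\<omega>. W0 \<omega> \<partial>M) \<le> (\<integral>\<omega>. 1 \<partial>M)" using iW W01 by (intro integral_mono) auto
      then have "(\<integral>\<omega>. W0 \<omega> \<partial>M) * exp (h * \<psi> (p i + \<mu>)) \<le> 1 * exp (h * \<psi> (p i + \<mu>))"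
        by (intro mult_right_mono) (auto simp: prob_space)
      then have "\<bar>c i\<bar> * exp (p i * a - \<mu> * \<epsilon>) * ((\<integral>\<omega>. W0 \<omega> \<partial>M) * exp (h * \<psi> (p i + \<mu>)))
          \<le> \<bar>c i\<bar> * exp (p i * a - \<mu> * \<epsilon>) * (1 * exp (h * \<psi> (p i + \<mu>)))"
        by (intro mult_left_mono) auto
      then show "\<bar>c i\<bar> * exp (p i * a - \<mu> * \<epsilon>) * ((\<integral>\<omega>. W0 \<omega> \<partial>M) * exp (h * \<psi> (p i + \<mu>)))
          \<le> \<bar>c i\<bar> * exp (p i * a - \<mu> * \<epsilon> + h * \<psi> (p i + \<mu>))"
        by (simp add: exp_add)
    qed
    finally show ?thesis .
  qed
  have [measurable]: "A \<in> borel_measurable M" using iA by auto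
  have [measurable]: "Bf \<in> borel_measurable M" unfolding Bf_def[abs_def] by measurable
  have iBb: "integrable M (\<lambda>\<omega>. \<eta> * (W0 \<omega> - W1 \<omega>) + P \<omega>)" using iW iP by auto
  have iB: "integrable M Bf"
    by (rule Bochner_Integration.integrable_bound[OF iBb])
       (use Bb in \<open>auto intro!: order_trans[OF Bb]\<close>)
  have EB: "\<bar>\<integral>\<omega>. Bf \<omega> \<partial>M\<bar> \<le> \<eta> * (V k - V (Suc k)) + \<rho>"
  proof -
    have "\<bar>\<integral>\<omega>. Bf \<omega> \<partial>M\<bar> \<le> (\<integral>\<omega>. \<eta> * (W0 \<omega> - W1 \<omega>) + P \<omega> \<partial>M)"
      by (rule order_trans[OF integral_abs_bound], rule integral_mono) (use iB iBb Bb in auto)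
    also have "\<dots> = \<eta> * (V k - V (Suc k)) + (\<integral>\<omega>. P \<omega> \<partial>M)"
      using iW iP by (simp add: V_def W0_def[symmetric] W1_def[symmetric])
    finally show ?thesis using EP by simp
  qed
  have "U (Suc k) = (\<integral>\<omega>. A \<omega> - Bf \<omega> \<partial>M)"
    unfolding U_def
    by (intro Bochner_Integration.integral_cong) (auto simp: A_def Bf_def W_def weight_Suc e_def)
  also have "\<dots> = (\<integral>\<omega>. A \<omega> \<partial>M) - (\<integral>\<omega>. Bf \<omega> \<partial>M)" using iA iB by simp
  finally have "\<bar>U (Suc k) - U k\<bar> \<le> G + (\<eta> * (V k - V (Suc k)) + \<rho>)"
    using Adiff EB by linarith
  with Suc.IH show ?case by (simp add: algebra_simps)
qed

end

section \<open>Passage to continuous time\<close>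

text \<open>The step function with value $F(j)$ on the \<open>j\<close>-th grid interval.\<close>
lemma sum_indicator_grid:
  fixes F :: "nat \<Rightarrow> real"
  assumes h: "h > 0" and s: "0 \<le> s" "s < real n * h"
  shows "nat \<lfloor>s / h\<rfloor> < n"
    and "(\<Sum>j<n. F j * indicator {real j * h..<real (Suc j) * h} s) = F (nat \<lfloor>s / h\<rfloor>)"
proof -
  have sh: "0 \<le> s / h" "s / h < real n" using assms by (auto simp: field_simps)
  then show lt: "nat \<lfloor>s / h\<rfloor> < n" by (metis floor_less_iff le_floor_iff of_int_of_nat_eq of_nat_0_le_iff nat_less_iff zero_le_floor)
  have ind: "indicator {real j * h..<real (Suc j) * h} s = (if j = nat \<lfloor>s / h\<rfloor> then 1 else 0 :: real)" for j
  proof -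
    have "s \<in> {real j * h..<real (Suc j) * h} \<longleftrightarrow> real j \<le> s / h \<and> s / h < real j + 1"
      using h by (auto simp: field_simps)
    also have "\<dots> \<longleftrightarrow> \<lfloor>s / h\<rfloor> = int j" by (subst floor_eq_iff) simp
    also have "\<dots> \<longleftrightarrow> j = nat \<lfloor>s / h\<rfloor>" using sh by auto
    finally show ?thesis by (simp add: indicator_def)
  qed
  show "(\<Sum>j<n. F j * indicator {real j * h..<real (Suc j) * h} s) = F (nat \<lfloor>s / h\<rfloor>)"
    unfolding ind using lt by (simp add: sum.delta if_distrib[of "\<lambda>x. _ * x"] cong: if_cong)
qed

text \<open>The first grid point strictly after \<open>s\<close>. Approximating \<open>s\<close> by these points uses
  right-continuity alone.\<close>
lemma grid_point_after:
  fixes s h :: real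
  assumes "h > 0" "s \<ge> 0"
  shows "s < real (Suc (nat \<lfloor>s / h\<rfloor>)) * h" "real (Suc (nat \<lfloor>s / h\<rfloor>)) * h \<le> s + h"
proof -
  have "real (nat \<lfloor>s / h\<rfloor>) = of_int \<lfloor>s / h\<rfloor>" using assms by simp
  moreover note floor_divide_lower[OF assms(1), of s] floor_divide_upper[OF assms(1), of s]
  ultimately show "s < real (Suc (nat \<lfloor>s / h\<rfloor>)) * h" "real (Suc (nat \<lfloor>s / h\<rfloor>)) * h \<le> s + h"
    by (simp_all add: algebra_simps)
qed

lemma grid_point_after_filterlim:
  fixes s :: real and h :: "nat \<Rightarrow> real"
  assumes h: "\<And>m. h m > 0" "h \<longlonglongrightarrow> 0" and s: "s \<ge> 0"
  shows "filterlim (\<lambda>m. real (Suc (nat \<lfloor>s / h m\<rfloor>)) * h m) (at_right s) sequentially"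
proof -
  have "(\<lambda>m. real (Suc (nat \<lfloor>s / h m\<rfloor>)) * h m) \<longlonglongrightarrow> s"
  proof (rule real_tendsto_sandwich[where f="\<lambda>_. s" and h="\<lambda>m. s + h m"])
    show "(\<lambda>m. s + h m) \<longlonglongrightarrow> s" using tendsto_add[OF tendsto_const h(2), of s] by simp
    show "\<forall>\<^sub>F m in sequentially. s \<le> real (Suc (nat \<lfloor>s / h m\<rfloor>)) * h m"
      "\<forall>\<^sub>F m in sequentially. real (Suc (nat \<lfloor>s / h m\<rfloor>)) * h m \<le> s + h m"
      using grid_point_after[OF h(1) s] by (auto intro!: always_eventually less_imp_le)
  qed simp
  moreover have "\<forall>\<^sub>F m in sequentially. real (Suc (nat \<lfloor>s / h m\<rfloor>)) * h m \<in> {s<..}"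
    using grid_point_after(1)[OF h(1) s] by (auto intro!: always_eventually)
  ultimately show ?thesis by (auto simp: filterlim_at elim: eventually_mono)
qed

lemma dyadic_mesh: "T > 0 \<Longrightarrow> T / 2 ^ m > (0::real)" "(\<lambda>m. T / 2 ^ m :: real) \<longlonglongrightarrow> 0"
proof -
  have "(\<lambda>m. T * (1/2) ^ m) \<longlonglongrightarrow> T * 0"
    by (intro tendsto_mult tendsto_const LIMSEQ_power_zero) auto
  then show "(\<lambda>m. T / 2 ^ m :: real) \<longlonglongrightarrow> 0" by (simp add: power_divide)
qed simp

lemma right_continuous_measurable:
  fixes f :: "real \<Rightarrow> real"
  assumes rc: "\<And>t. t \<ge> 0 \<Longrightarrow> (f \<longlongrightarrow> f t) (at_right t)"
  shows "(\<lambda>s. indicator {0..} s * f s) \<in> borel_measurable borel"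
proof (rule borel_measurable_LIMSEQ_real)
  fix m :: nat
  define h where "h = (1::real) / 2 ^ m"
  show "(\<lambda>s. indicator {0..} s * f (real (Suc (nat \<lfloor>s / h\<rfloor>)) * h)) \<in> borel_measurable borel"
    by measurable
next
  fix s :: real
  show "(\<lambda>m. indicator {0..} s * f (real (Suc (nat \<lfloor>s / (1 / 2 ^ m)\<rfloor>)) * (1 / 2 ^ m)))
      \<longlonglongrightarrow> indicator {0..} s * f s"
  proof (cases "s \<ge> 0")
    case True
    have "(\<lambda>m. f (real (Suc (nat \<lfloor>s / (1 / 2 ^ m)\<rfloor>)) * (1 / 2 ^ m))) \<longlonglongrightarrow> f s"
      by (rule filterlim_compose[OF rc[OF True] grid_point_after_filterlim[OF dyadic_mesh(1) dyadic_mesh(2) True]]) simp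
    then show ?thesis using True by simp
  qed simp
qed

text \<open>A bounded right-continuous function is the pointwise limit of its step functions with right
  endpoint values; their integrals differ from the left endpoint sums by $h (f(T) - f(0))$.\<close>
lemma riemann_sum_right_continuous:
  fixes f :: "real \<Rightarrow> real"
  assumes T: "T > 0" and rc: "\<And>t. t \<ge> 0 \<Longrightarrow> (f \<longlongrightarrow> f t) (at_right t)"
    and bd: "\<And>s. 0 \<le> s \<Longrightarrow> s \<le> T \<Longrightarrow> \<bar>f s\<bar> \<le> B"
  shows "(\<lambda>m. T / 2 ^ m * (\<Sum>j<2 ^ m. f (real j * (T / 2 ^ m)))) \<longlonglongrightarrow> (LINT s:{0..<T}|lborel. f s)"
proof -
  define h where "h m = T / 2 ^ m" for m :: nat
  have h: "h m > 0" "h \<longlonglongrightarrow> 0" for m using T dyadic_mesh by (auto simp: h_def[abs_def])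
  have nh: "real (2 ^ m) * h m = T" for m by (simp add: h_def)
  define g where "g m s = (\<Sum>j<2 ^ m. f (real (Suc j) * h m) * indicator {real j * h m..<real (Suc j) * h m} s)" for m s
  have g_in: "g m s = f (real (Suc (nat \<lfloor>s / h m\<rfloor>)) * h m)" "real (Suc (nat \<lfloor>s / h m\<rfloor>)) * h m \<le> T"
    if "0 \<le> s" "s < T" for m s
  proof -
    have s: "s < real (2 ^ m) * h m" using that nh by simp
    show "g m s = f (real (Suc (nat \<lfloor>s / h m\<rfloor>)) * h m)"
      unfolding g_def using sum_indicator_grid(2)[OF h(1) that(1) s] by simp
    have "nat \<lfloor>s / h m\<rfloor> < 2 ^ m" by (rule sum_indicator_grid(1)[OF h(1) that(1) s])
    then have "real (Suc (nat \<lfloor>s / h m\<rfloor>)) \<le> real (2 ^ m)" by linarith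
    then have "real (Suc (nat \<lfloor>s / h m\<rfloor>)) * h m \<le> real (2 ^ m) * h m"
      using h(1)[of m] by (intro mult_right_mono) auto
    then show "real (Suc (nat \<lfloor>s / h m\<rfloor>)) * h m \<le> T" using nh by simp
  qed
  have g_out: "g m s = 0" if "\<not> (0 \<le> s \<and> s < T)" for m s
    unfolding g_def
  proof (rule sum.neutral, safe)
    fix j :: nat assume j: "j < 2 ^ m"
    then have "real (Suc j) \<le> real (2 ^ m)" by (metis Suc_leI of_nat_le_iff)
    then have "real (Suc j) * h m \<le> T" using h(1)[of m] nh[of m]
      by (metis mult_right_mono less_imp_le)
    moreover have "0 \<le> real j * h m" using h(1)[of m] by simp
    ultimately have "s \<notin> {real j * h m..<real (Suc j) * h m}" using that by force
    then show "f (real (Suc j) * h m) * indicator {real j * h m..<real (Suc j) * h m} s = 0" by simp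
  qed
  have fm: "(\<lambda>s. indicator {0..<T} s * f s) \<in> borel_measurable borel"
  proof -
    have "(\<lambda>s. indicator {..<T} s * (indicator {0..} s * f s)) \<in> borel_measurable borel"
      using right_continuous_measurable[OF rc] by measurable
    moreover have "(\<lambda>s. indicator {..<T} s * (indicator {0..} s * f s)) = (\<lambda>s. indicator {0..<T} s * f s)"
      by (auto simp: indicator_def)
    ultimately show ?thesis by simp
  qed
  have "(\<lambda>m. integral\<^sup>L lborel (g m)) \<longlonglongrightarrow> integral\<^sup>L lborel (\<lambda>s. indicator {0..<T} s * f s)"
  proof (rule integral_dominated_convergence[where w="\<lambda>s. B * indicator {0..T} s"])
    show "integrable lborel (\<lambda>s. B * indicator {0..T} s)"
      by (intro integrable_mult_right integrable_real_indicator) (auto simp: emeasure_lborel_Icc_eq)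
    show "g m \<in> borel_measurable lborel" for m unfolding g_def[abs_def] by measurable
    show "(\<lambda>s. indicator {0..<T} s * f s) \<in> borel_measurable lborel" using fm by simp
    show "AE s in lborel. (\<lambda>m. g m s) \<longlonglongrightarrow> indicator {0..<T} s * f s"
    proof (rule AE_I2)
      fix s
      show "(\<lambda>m. g m s) \<longlonglongrightarrow> indicator {0..<T} s * f s"
      proof (cases "0 \<le> s \<and> s < T")
        case True
        have "(\<lambda>m. f (real (Suc (nat \<lfloor>s / h m\<rfloor>)) * h m)) \<longlonglongrightarrow> f s"
          by (rule filterlim_compose[OF rc grid_point_after_filterlim[OF h]]) (use True in auto)
        then show ?thesis using True g_in by simp
      qed (simp add: g_out)
    qed
    show "AE s in lborel. norm (g m s) \<le> B * indicator {0..T} s" for m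
    proof (rule AE_I2)
      fix s
      show "norm (g m s) \<le> B * indicator {0..T} s"
      proof (cases "0 \<le> s \<and> s < T")
        case True
        then have "0 \<le> real (Suc (nat \<lfloor>s / h m\<rfloor>)) * h m" using h(1)[of m] by simp
        then show ?thesis using True g_in[of s m] bd by (simp del: of_nat_Suc)
      next
        case False
        have "B \<ge> 0" using bd[of 0] T by simp
        then show ?thesis using g_out[OF False] by simp
      qed
    qed
  qed
  moreover have "integral\<^sup>L lborel (g m) = h m * (\<Sum>j<2 ^ m. f (real j * h m)) + h m * (f T - f 0)" for m
  proof -
    have "integral\<^sup>L lborel (g m) = (\<Sum>j<2 ^ m. f (real (Suc j) * h m) * h m)"
      unfolding g_def using h(1)[of m]
      by (subst Bochner_Integration.integral_sum)
         (auto simp: algebra_simps mult_less_cancel_left intro!: sum.cong integrable_mult_right integrable_real_indicator)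
    also have "\<dots> = h m * (\<Sum>j<2 ^ m. f (real (Suc j) * h m))"
      by (simp add: sum_distrib_left mult.commute)
    also have "(\<Sum>j<2 ^ m. f (real (Suc j) * h m)) = (\<Sum>j<2 ^ m. f (real j * h m)) + (f T - f 0)"
    proof -
      have "(\<Sum>j<2 ^ m. f (real (Suc j) * h m)) - (\<Sum>j<2 ^ m. f (real j * h m)) =
        (\<Sum>j<2 ^ m. f (real (Suc j) * h m) - f (real j * h m))" by (simp add: sum_subtractf)
      also have "\<dots> = f (real (2 ^ m) * h m) - f (real 0 * h m)" by (rule sum_lessThan_telescope)
      finally show ?thesis using nh by simp
    qed
    finally show ?thesis by (simp add: algebra_simps)
  qed
  ultimately have "(\<lambda>m. h m * (\<Sum>j<2 ^ m. f (real j * h m)) + h m * (f T - f 0))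
     \<longlonglongrightarrow> integral\<^sup>L lborel (\<lambda>s. indicator {0..<T} s * f s)" by simp
  moreover have "(\<lambda>m. h m * (f T - f 0)) \<longlonglongrightarrow> 0 * (f T - f 0)" by (intro tendsto_mult h tendsto_const)
  ultimately have "(\<lambda>m. (h m * (\<Sum>j<2 ^ m. f (real j * h m)) + h m * (f T - f 0)) - h m * (f T - f 0))
     \<longlonglongrightarrow> integral\<^sup>L lborel (\<lambda>s. indicator {0..<T} s * f s) - 0 * (f T - f 0)"
    by (intro tendsto_diff)
  then show ?thesis by (simp add: h_def set_lebesgue_integral_def)
qed

lemma exp_second_order:
  fixes y :: real
  assumes "\<bar>y\<bar> \<le> 1"
  shows "\<bar>exp y - 1 - y\<bar> \<le> y\<^sup>2"
proof (cases "y \<ge> 0")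
  case True
  then show ?thesis using exp_bound[of y] exp_ge_add_one_self[of y] zero_le_power2[of y] assms by linarith
next
  case False
  define z where "z = - y"
  have z: "z > 0" using False by (simp add: z_def)
  have "exp (- z) \<le> 1 / (1 + z)" using exp_ge_add_one_self[of z] z by (simp add: exp_minus field_simps)
  moreover have "1 / (1 + z) - 1 + z \<le> z\<^sup>2" using z by (simp add: field_simps power2_eq_square)
  ultimately have "exp y - 1 - y \<le> y\<^sup>2" by (simp add: z_def)
  then show ?thesis using exp_ge_add_one_self[of y] by linarith
qed

context spectrally_negative
begin

text \<open>The continuous-time limit of \<open>weight\<close> at time \<open>T\<close>.\<close>
definition below_weight :: "real \<Rightarrow> real \<Rightarrow> real \<Rightarrow> real \<Rightarrow> 'a \<Rightarrow> real" where
  "below_weight a \<alpha> q T \<omega> =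
     (if \<forall>s\<in>{0..T}. \<xi> s \<omega> \<le> a then exp (- q * (LINT s:{0..<T}|lborel. exp (\<alpha> * \<xi> s \<omega>))) else 0)"

lemma weight_grid_limit:
  assumes \<omega>: "\<omega> \<in> space M" and T: "T > 0" and \<alpha>: "\<alpha> > 0"
  shows "(\<lambda>m. weight a \<alpha> (q * (T / 2 ^ m)) (2 ^ m) (grid (T / 2 ^ m) \<omega>)) \<longlonglongrightarrow> below_weight a \<alpha> q T \<omega>"
proof (cases "\<forall>s\<in>{0..T}. \<xi> s \<omega> \<le> a")
  case True
  have "(\<lambda>m. T / 2 ^ m * (\<Sum>j<2 ^ m. exp (\<alpha> * \<xi> (real j * (T / 2 ^ m)) \<omega>)))
     \<longlonglongrightarrow> (LINT s:{0..<T}|lborel. exp (\<alpha> * \<xi> s \<omega>))"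
  proof (rule riemann_sum_right_continuous[OF T, where B="exp (\<alpha> * a)"])
    show "((\<lambda>t. exp (\<alpha> * \<xi> t \<omega>)) \<longlongrightarrow> exp (\<alpha> * \<xi> t \<omega>)) (at_right t)" if "t \<ge> 0" for t
      by (intro tendsto_intros xi_right_continuous \<omega> that)
    show "\<bar>exp (\<alpha> * \<xi> s \<omega>)\<bar> \<le> exp (\<alpha> * a)" if "0 \<le> s" "s \<le> T" for s
      using True that \<alpha> by auto
  qed
  then have "(\<lambda>m. exp (- q * (T / 2 ^ m * (\<Sum>j<2 ^ m. exp (\<alpha> * \<xi> (real j * (T / 2 ^ m)) \<omega>)))))
     \<longlonglongrightarrow> exp (- q * (LINT s:{0..<T}|lborel. exp (\<alpha> * \<xi> s \<omega>)))"
    by (intro tendsto_intros)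
  moreover have "weight a \<alpha> (q * (T / 2 ^ m)) (2 ^ m) (grid (T / 2 ^ m) \<omega>)
    = exp (- q * (T / 2 ^ m * (\<Sum>j<2 ^ m. exp (\<alpha> * \<xi> (real j * (T / 2 ^ m)) \<omega>))))" for m
  proof -
    have "real j * (T / 2 ^ m) \<le> T" if "j \<le> 2 ^ m" for j
    proof -
      have "real j \<le> 2 ^ m" using that by (metis of_nat_le_iff of_nat_numeral of_nat_power)
      then show ?thesis using T by (simp add: field_simps)
    qed
    then have "\<forall>j\<le>2 ^ m. grid (T / 2 ^ m) \<omega> j \<le> a"
      using True T unfolding grid_def by simp
    then show ?thesis by (simp add: weight_def grid_def mult.assoc)
  qed
  ultimately show ?thesis using True by (simp add: below_weight_def)
next
  case False
  then obtain s where s: "0 \<le> s" "s \<le> T" "\<xi> s \<omega> > a" by (auto simp: not_le)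
  have "\<forall>\<^sub>F m in sequentially. \<exists>j\<le>2 ^ m. grid (T / 2 ^ m) \<omega> j > a"
  proof (cases "s = T")
    case True
    have "\<exists>j\<le>2 ^ m. grid (T / 2 ^ m) \<omega> j > a" for m
      using s True by (intro exI[of _ "2 ^ m"]) (simp add: grid_def)
    then show ?thesis by (intro always_eventually allI)
  next
    case False
    define r where "r m = real (Suc (nat \<lfloor>s / (T / 2 ^ m)\<rfloor>)) * (T / 2 ^ m)" for m
    have "filterlim r (at_right s) sequentially"
      unfolding r_def[abs_def] by (rule grid_point_after_filterlim[OF dyadic_mesh s(1)]) (rule T)
    then have "(\<lambda>m. \<xi> (r m) \<omega>) \<longlonglongrightarrow> \<xi> s \<omega>"
      by (rule filterlim_compose[OF xi_right_continuous[OF \<omega> s(1)]])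
    then have "\<forall>\<^sub>F m in sequentially. \<xi> (r m) \<omega> > a" using s(3) by (simp add: order_tendstoD(1))
    then show ?thesis
    proof eventually_elim
      case (elim m)
      have "nat \<lfloor>s / (T / 2 ^ m)\<rfloor> < 2 ^ m"
        by (rule sum_indicator_grid(1)[OF _ s(1)]) (use T s False in auto)
      then have "Suc (nat \<lfloor>s / (T / 2 ^ m)\<rfloor>) \<le> 2 ^ m" by (rule Suc_leI)
      moreover have "grid (T / 2 ^ m) \<omega> (Suc (nat \<lfloor>s / (T / 2 ^ m)\<rfloor>)) > a"
        using elim unfolding r_def grid_def .
      ultimately show ?case by blast
    qed
  qed
  then have "\<forall>\<^sub>F m in sequentially. weight a \<alpha> (q * (T / 2 ^ m)) (2 ^ m) (grid (T / 2 ^ m) \<omega>) = 0"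
    by eventually_elim (auto simp: weight_def not_le)
  then have "(\<lambda>m. weight a \<alpha> (q * (T / 2 ^ m)) (2 ^ m) (grid (T / 2 ^ m) \<omega>)) \<longlonglongrightarrow> 0"
    by (rule tendsto_eventually)
  moreover have "below_weight a \<alpha> q T \<omega> = 0" using False by (simp only: below_weight_def if_False)
  ultimately show ?thesis by simp
qed

lemma below_weight_measurable:
  assumes "T > 0" "\<alpha> > 0"
  shows "below_weight a \<alpha> q T \<in> borel_measurable M"
proof (rule borel_measurable_LIMSEQ_real)
  show "(\<lambda>\<omega>. weight a \<alpha> (q * (T / 2 ^ m)) (2 ^ m) (grid (T / 2 ^ m) \<omega>)) \<in> borel_measurable M" for m
    by (rule measurable_weight, rule grid_measurable) (use assms in auto)
qed (use weight_grid_limit assms in auto)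

lemma below_weight_bounds:
  assumes "q \<ge> 0"
  shows "0 \<le> below_weight a \<alpha> q T \<omega>" "below_weight a \<alpha> q T \<omega> \<le> 1"
proof -
  have "(LINT s:{0..<T}|lborel. exp (\<alpha> * \<xi> s \<omega>)) \<ge> 0"
    unfolding set_lebesgue_integral_def by (intro Bochner_Integration.integral_nonneg) auto
  then show "0 \<le> below_weight a \<alpha> q T \<omega>" "below_weight a \<alpha> q T \<omega> \<le> 1"
    using assms by (auto simp: below_weight_def)
qed

lemma below_weight_mult_bound:
  assumes "q \<ge> 0" "T > 0" "\<And>x. x \<le> a \<Longrightarrow> \<bar>g x\<bar> \<le> B"
  shows "\<bar>below_weight a \<alpha> q T \<omega> * g (\<xi> T \<omega>)\<bar> \<le> B"
proof (cases "\<xi> T \<omega> \<le> a")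
  case True
  have "\<bar>below_weight a \<alpha> q T \<omega> * g (\<xi> T \<omega>)\<bar> \<le> 1 * B"
    unfolding abs_mult using below_weight_bounds[OF assms(1), of a \<alpha> T \<omega>] assms(3)[OF True]
    by (intro mult_mono) auto
  then show ?thesis by simp
next
  case False
  then have "below_weight a \<alpha> q T \<omega> = 0" using assms(2) by (auto simp: below_weight_def)
  then show ?thesis using assms(3)[of a] by simp
qed

text \<open>With the moment order $\mu = \sqrt{2^m}$ the term $(T/2^m)\psi(p + \mu)$ stays bounded, by the quadratic
  bound on $\psi$, while $2^m e^{-\mu \epsilon}$ vanishes.\<close>
lemma overshoot_bound_tendsto_0:
  assumes p: "p \<ge> 0" and \<epsilon>: "\<epsilon> > 0" and T: "T > 0"
  shows "(\<lambda>m. 2 ^ m * exp (r - sqrt (2 ^ m) * \<epsilon> + T / 2 ^ m * \<psi> (p + sqrt (2 ^ m)))) \<longlonglongrightarrow> 0"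
proof -
  obtain c where c: "c \<ge> 0" "\<And>u. u \<ge> 0 \<Longrightarrow> \<psi> u \<le> c * (1 + u\<^sup>2)"
    using levy_khintchine_quadratic_bound[OF levy_khintchine] by blast
  define b where "b = r + T * c * (1 + (p + 1)\<^sup>2)"
  have "T / 2 ^ m * \<psi> (p + sqrt (2 ^ m)) \<le> T * c * (1 + (p + 1)\<^sup>2)" for m :: nat
  proof -
    define K where "K = sqrt (2 ^ m :: real)"
    have K: "K \<ge> 1" "K\<^sup>2 = 2 ^ m" by (auto simp: K_def)
    have "p + K \<le> (p + 1) * K" using mult_left_mono[of 1 K p] K p by (simp add: algebra_simps)
    then have "(p + K)\<^sup>2 \<le> ((p + 1) * K)\<^sup>2" using p K by (intro power_mono) auto
    moreover have "1 \<le> K\<^sup>2" using K by simp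
    ultimately have "1 + (p + K)\<^sup>2 \<le> K\<^sup>2 * (1 + (p + 1)\<^sup>2)"
      unfolding power_mult_distrib distrib_left by (simp add: mult.commute)
    moreover have "\<psi> (p + K) \<le> c * (1 + (p + K)\<^sup>2)" using c(2)[of "p + K"] p K by simp
    ultimately have "\<psi> (p + K) \<le> c * (K\<^sup>2 * (1 + (p + 1)\<^sup>2))" using c(1)
      by (meson mult_left_mono order_trans)
    then have "T / K\<^sup>2 * \<psi> (p + K) \<le> T / K\<^sup>2 * (c * (K\<^sup>2 * (1 + (p + 1)\<^sup>2)))"
      using T by (intro mult_left_mono) auto
    also have "\<dots> = T * c * (1 + (p + 1)\<^sup>2)" using K by (simp add: field_simps)
    finally show ?thesis by (simp only: K(2)) (simp add: K_def)
  qed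
  then have ub: "2 ^ m * exp (r - sqrt (2 ^ m) * \<epsilon> + T / 2 ^ m * \<psi> (p + sqrt (2 ^ m)))
       \<le> 2 ^ m * exp (b - sqrt (2 ^ m) * \<epsilon>)" for m :: nat
    unfolding b_def by (intro mult_left_mono) (auto simp: algebra_simps)
  have "((\<lambda>x::real. x * exp (b - sqrt x * \<epsilon>)) \<longlongrightarrow> 0) at_top" using \<epsilon> by real_asymp
  moreover have "filterlim (\<lambda>m. 2 ^ m :: real) at_top sequentially" by real_asymp
  ultimately have lim: "(\<lambda>m. 2 ^ m * exp (b - sqrt (2 ^ m) * \<epsilon>)) \<longlonglongrightarrow> 0"
    by (rule filterlim_compose)
  show ?thesis
    by (rule tendsto_sandwich[OF _ _ tendsto_const lim]) (use ub in \<open>auto intro!: always_eventually\<close>)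
qed

text \<open>The stopped Dynkin formula: up to $T \delta$, where $\delta$ bounds $\mathcal{L} H - q e^{\alpha x} H$ below \<open>a\<close>,
  the killed and stopped process keeps the expectation of \<open>H\<close>. The part stopped at \<open>a\<close> does not
  appear, because \<open>H\<close> vanishes there.\<close>
lemma dynkin:
  fixes c p :: "'i \<Rightarrow> real"
  assumes fin: "finite J" and p: "\<And>i. i \<in> J \<Longrightarrow> p i \<ge> 0"
    and a: "a \<ge> 0" and q: "q \<ge> 0" and \<alpha>: "\<alpha> > 0" and T: "T > 0"
    and H: "\<And>x. H x = (\<Sum>i\<in>J. c i * exp (p i * x))" and Ha: "H a = 0"
    and \<delta>: "\<And>x. x \<le> a \<Longrightarrow> \<bar>\<Sum>i\<in>J. c i * (\<psi> (p i) - q * exp (\<alpha> * x)) * exp (p i * x)\<bar> \<le> \<delta>"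
  shows "\<bar>(\<integral>\<omega>. below_weight a \<alpha> q T \<omega> * H (\<xi> T \<omega>) \<partial>M) - H 0\<bar> \<le> T * \<delta>"
proof -
  define h where "h m = T / 2 ^ m" for m :: nat
  have h: "h m > 0" "h \<longlonglongrightarrow> 0" for m using dyadic_mesh T by (auto simp: h_def[abs_def])
  define U where "U m = (\<integral>\<omega>. weight a \<alpha> (q * h m) (2 ^ m) (grid (h m) \<omega>) * H (grid (h m) \<omega> (2 ^ m)) \<partial>M)" for m
  define L where "L = (\<integral>\<omega>. below_weight a \<alpha> q T \<omega> * H (\<xi> T \<omega>) \<partial>M)"
  define b where "b i = \<bar>\<psi> (p i)\<bar> + q * exp (\<alpha> * a)" for i
  define R where "R = (\<Sum>i\<in>J. \<bar>c i\<bar> * (b i)\<^sup>2 * exp (p i * a))"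
  define \<eta> where "\<eta> \<epsilon> = (\<Sum>i\<in>J. \<bar>c i\<bar> * exp (p i * a) * (exp (p i * \<epsilon>) - 1))" for \<epsilon>
  define \<rho> where "\<rho> \<epsilon> m = (\<Sum>i\<in>J. \<bar>c i\<bar> * exp (p i * a - sqrt (2 ^ m) * \<epsilon> + h m * \<psi> (p i + sqrt (2 ^ m))))" for \<epsilon> m
  have [measurable]: "H \<in> borel_measurable borel" unfolding H[abs_def] by measurable
  define B where "B = (\<Sum>i\<in>J. \<bar>c i\<bar> * exp (p i * a))"
  have Hb: "\<bar>H x\<bar> \<le> B" if "x \<le> a" for x
    unfolding H B_def
    by (rule order_trans[OF sum_abs]) (auto intro!: sum_mono mult_left_mono simp: abs_mult p that)
  have [measurable]: "\<xi> T \<in> borel_measurable M" using T by (intro xi_measurable) simp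
  have [measurable]: "below_weight a \<alpha> q T \<in> borel_measurable M" using T \<alpha> by (rule below_weight_measurable)
  have gm[measurable]: "(\<lambda>\<omega>. grid (h m) \<omega> j) \<in> borel_measurable M" for m j
    using h(1)[of m] by (intro grid_measurable) simp
  have [measurable]: "(\<lambda>\<omega>. weight a \<alpha> v k (grid (h m) \<omega>)) \<in> borel_measurable M" for v k m
    by (intro measurable_weight gm)
  have UL: "U \<longlonglongrightarrow> L"
    unfolding U_def[abs_def] L_def
  proof (rule integral_dominated_convergence[where w="\<lambda>_. B"])
    show "AE \<omega> in M. (\<lambda>m. weight a \<alpha> (q * h m) (2 ^ m) (grid (h m) \<omega>) * H (grid (h m) \<omega> (2 ^ m)))
        \<longlonglongrightarrow> below_weight a \<alpha> q T \<omega> * H (\<xi> T \<omega>)"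
    proof (rule AE_I2)
      fix \<omega> assume "\<omega> \<in> space M"
      then have "(\<lambda>m. weight a \<alpha> (q * h m) (2 ^ m) (grid (h m) \<omega>)) \<longlonglongrightarrow> below_weight a \<alpha> q T \<omega>"
        unfolding h_def using T \<alpha> by (rule weight_grid_limit)
      moreover have "grid (h m) \<omega> (2 ^ m) = \<xi> T \<omega>" for m by (simp add: grid_def h_def)
      ultimately show "(\<lambda>m. weight a \<alpha> (q * h m) (2 ^ m) (grid (h m) \<omega>) * H (grid (h m) \<omega> (2 ^ m)))
        \<longlonglongrightarrow> below_weight a \<alpha> q T \<omega> * H (\<xi> T \<omega>)"
        by (auto intro!: tendsto_mult tendsto_const)
    qed
    show "AE \<omega> in M. norm (weight a \<alpha> (q * h m) (2 ^ m) (grid (h m) \<omega>) * H (grid (h m) \<omega> (2 ^ m))) \<le> B" for m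
      unfolding real_norm_def using q h(1)[of m] by (intro AE_I2 weight_mult_bound Hb) auto
  qed auto
  \<comment> \<open>The admissible overshoot \<open>\<epsilon>\<close> stays fixed while the mesh tends to 0, and tends to 0 afterwards.\<close>
  have bnd: "\<bar>L - H 0\<bar> \<le> T * \<delta> + \<eta> \<epsilon>" if \<epsilon>: "\<epsilon> > 0" for \<epsilon>
  proof -
    have small: "\<forall>\<^sub>F m in sequentially. \<forall>i\<in>J. h m * b i \<le> 1"
    proof (rule eventually_ball_finite[OF fin], safe)
      fix i
      have "(\<lambda>m. h m * b i) \<longlonglongrightarrow> 0 * b i" by (intro tendsto_mult h tendsto_const)
      then have "\<forall>\<^sub>F m in sequentially. h m * b i < 1" by (simp add: order_tendstoD(2))
      then show "\<forall>\<^sub>F m in sequentially. h m * b i \<le> 1" by eventually_elim simp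
    qed
    have \<eta>0: "\<eta> \<epsilon> \<ge> 0" unfolding \<eta>_def using p \<epsilon> by (intro sum_nonneg) auto
    have ev: "\<forall>\<^sub>F m in sequentially. \<bar>U m - H 0\<bar> \<le> T * \<delta> + T * h m * R + 2 ^ m * \<rho> \<epsilon> m + \<eta> \<epsilon>"
      using small
    proof eventually_elim
      case (elim m)
      define G where "G = h m * \<delta> + (h m)\<^sup>2 * R"
      have G: "\<bar>\<Sum>i\<in>J. c i * (exp (h m * \<psi> (p i) - q * h m * exp (\<alpha> * x)) - 1) * exp (p i * x)\<bar> \<le> G"
        if x: "x \<le> a" for x
      proof -
        define y where "y i = h m * (\<psi> (p i) - q * exp (\<alpha> * x))" for i
        have yb: "\<bar>y i\<bar> \<le> h m * b i" for i
        proof -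
          have "\<bar>\<psi> (p i) - q * exp (\<alpha> * x)\<bar> \<le> b i"
          proof -
            have "q * exp (\<alpha> * x) \<le> q * exp (\<alpha> * a)" using q \<alpha> x by (intro mult_left_mono) auto
            moreover have "0 \<le> q * exp (\<alpha> * x)" using q by simp
            ultimately show ?thesis unfolding b_def by linarith
          qed
          then show ?thesis unfolding y_def abs_mult using h(1)[of m] by (simp add: mult_left_mono)
        qed
        have "(\<Sum>i\<in>J. c i * (exp (h m * \<psi> (p i) - q * h m * exp (\<alpha> * x)) - 1) * exp (p i * x))
          = (\<Sum>i\<in>J. c i * y i * exp (p i * x)) + (\<Sum>i\<in>J. c i * (exp (y i) - 1 - y i) * exp (p i * x))"
          by (simp add: y_def sum.distrib[symmetric] algebra_simps)
        also have "(\<Sum>i\<in>J. c i * y i * exp (p i * x)) = h m * (\<Sum>i\<in>J. c i * (\<psi> (p i) - q * exp (\<alpha> * x)) * exp (p i * x))"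
          by (simp add: y_def sum_distrib_left mult_ac)
        finally have e: "(\<Sum>i\<in>J. c i * (exp (h m * \<psi> (p i) - q * h m * exp (\<alpha> * x)) - 1) * exp (p i * x))
          = h m * (\<Sum>i\<in>J. c i * (\<psi> (p i) - q * exp (\<alpha> * x)) * exp (p i * x))
            + (\<Sum>i\<in>J. c i * (exp (y i) - 1 - y i) * exp (p i * x))" .
        have "\<bar>\<Sum>i\<in>J. c i * (exp (y i) - 1 - y i) * exp (p i * x)\<bar>
          \<le> (\<Sum>i\<in>J. \<bar>c i * (exp (y i) - 1 - y i) * exp (p i * x)\<bar>)" by (rule sum_abs)
        also have "\<dots> \<le> (\<Sum>i\<in>J. (h m)\<^sup>2 * (\<bar>c i\<bar> * (b i)\<^sup>2 * exp (p i * a)))"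
        proof (rule sum_mono)
          fix i assume i: "i \<in> J"
          have "h m * b i \<le> 1" using elim i by auto
          then have "\<bar>exp (y i) - 1 - y i\<bar> \<le> (y i)\<^sup>2" using yb[of i] by (intro exp_second_order) simp
          also have "\<dots> \<le> (h m * b i)\<^sup>2" using yb[of i]
            by (metis abs_ge_zero power2_abs power_mono)
          finally have "\<bar>exp (y i) - 1 - y i\<bar> \<le> (h m * b i)\<^sup>2" .
          then have "\<bar>c i\<bar> * \<bar>exp (y i) - 1 - y i\<bar> * exp (p i * x) \<le> \<bar>c i\<bar> * (h m * b i)\<^sup>2 * exp (p i * a)"
            using p[OF i] x by (intro mult_mono) (auto intro: mult_left_mono)
          then show "\<bar>c i * (exp (y i) - 1 - y i) * exp (p i * x)\<bar> \<le> (h m)\<^sup>2 * (\<bar>c i\<bar> * (b i)\<^sup>2 * exp (p i * a))"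
            by (simp add: abs_mult power_mult_distrib mult_ac)
        qed
        also have "\<dots> = (h m)\<^sup>2 * R" by (simp add: R_def sum_distrib_left)
        finally have 2: "\<bar>\<Sum>i\<in>J. c i * (exp (y i) - 1 - y i) * exp (p i * x)\<bar> \<le> (h m)\<^sup>2 * R" .
        have "\<bar>h m * (\<Sum>i\<in>J. c i * (\<psi> (p i) - q * exp (\<alpha> * x)) * exp (p i * x))\<bar> \<le> h m * \<delta>"
          unfolding abs_mult using \<delta>[OF x] h(1)[of m] by (simp add: mult_left_mono)
        with 2 show ?thesis unfolding e G_def by linarith
      qed
      define V where "V k = (\<integral>\<omega>. weight a \<alpha> 0 k (grid (h m) \<omega>) \<partial>M)" for k
      have V: "V 0 \<le> 1" "V k \<ge> 0" for k
      proof -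
        have "V 0 \<le> (\<integral>\<omega>. 1 \<partial>M)" unfolding V_def
          using weight_nonneg[of a \<alpha> 0] weight_zero_le_one[of a \<alpha>]
          by (intro integral_mono integrable_const_bound[where B=1]) auto
        then show "V 0 \<le> 1" by (simp add: prob_space)
        show "V k \<ge> 0" unfolding V_def by (intro Bochner_Integration.integral_nonneg weight_nonneg)
      qed
      have U0: "(\<integral>\<omega>. weight a \<alpha> (q * h m) 0 (grid (h m) \<omega>) * H (grid (h m) \<omega> 0) \<partial>M) = H 0"
      proof -
        have "(\<integral>\<omega>. weight a \<alpha> (q * h m) 0 (grid (h m) \<omega>) * H (grid (h m) \<omega> 0) \<partial>M) = (\<integral>\<omega>. H 0 \<partial>M)"
        proof (rule integral_cong_AE)
          show "AE \<omega> in M. weight a \<alpha> (q * h m) 0 (grid (h m) \<omega>) * H (grid (h m) \<omega> 0) = H 0"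
            using xi_zero by eventually_elim (use a in \<open>simp add: grid_def weight_def\<close>)
        qed auto
        then show ?thesis by (simp add: prob_space)
      qed
      have "\<bar>U m - H 0\<bar> \<le> real (2 ^ m) * (G + \<rho> \<epsilon> m) + \<eta> \<epsilon> * (V 0 - V (2 ^ m))"
        using grid_dynkin[where h="h m" and v="q * h m" and \<epsilon>=\<epsilon> and \<mu>="sqrt (2 ^ m)" and k="2 ^ m",
            OF fin p _ _ _ _ H Ha G] h(1)[of m] q \<epsilon>
        unfolding U0 U_def \<rho>_def \<eta>_def V_def by (simp add: mult.assoc)
      also have "\<eta> \<epsilon> * (V 0 - V (2 ^ m)) \<le> \<eta> \<epsilon> * 1" using V(1) V(2)[of "2 ^ m"] \<eta>0 by (intro mult_left_mono) auto
      also have "real (2 ^ m) * (G + \<rho> \<epsilon> m) + \<eta> \<epsilon> * 1 = T * \<delta> + T * h m * R + 2 ^ m * \<rho> \<epsilon> m + \<eta> \<epsilon>"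
        by (simp add: G_def h_def field_simps power2_eq_square)
      finally show ?case by simp
    qed
    have "(\<lambda>m. 2 ^ m * \<rho> \<epsilon> m) \<longlonglongrightarrow> (\<Sum>i\<in>J. \<bar>c i\<bar> * 0)"
    proof -
      have "(\<lambda>m. \<Sum>i\<in>J. \<bar>c i\<bar> * (2 ^ m * exp (p i * a - sqrt (2 ^ m) * \<epsilon> + T / 2 ^ m * \<psi> (p i + sqrt (2 ^ m)))))
         \<longlonglongrightarrow> (\<Sum>i\<in>J. \<bar>c i\<bar> * 0)"
        by (intro tendsto_sum tendsto_mult tendsto_const overshoot_bound_tendsto_0 p \<epsilon> T)
      then show ?thesis by (simp add: \<rho>_def h_def sum_distrib_left mult_ac)
    qed
    then have "(\<lambda>m. T * \<delta> + T * h m * R + 2 ^ m * \<rho> \<epsilon> m + \<eta> \<epsilon>) \<longlonglongrightarrow> T * \<delta> + T * 0 * R + 0 + \<eta> \<epsilon>"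
      by (intro tendsto_intros h) simp
    moreover have "(\<lambda>m. \<bar>U m - H 0\<bar>) \<longlonglongrightarrow> \<bar>L - H 0\<bar>" by (intro tendsto_intros UL)
    ultimately show ?thesis using tendsto_le[OF _ _ _ ev] by force
  qed
  have "((\<lambda>\<epsilon>. T * \<delta> + \<eta> \<epsilon>) \<longlongrightarrow> T * \<delta> + (\<Sum>i\<in>J. \<bar>c i\<bar> * exp (p i * a) * (exp (p i * 0) - 1))) (at_right 0)"
    unfolding \<eta>_def by (intro tendsto_intros)
  moreover have "\<forall>\<^sub>F \<epsilon> in at_right 0. \<bar>L - H 0\<bar> \<le> T * \<delta> + \<eta> \<epsilon>"
    using bnd by (auto simp: eventually_at_filter)
  ultimately have "\<bar>L - H 0\<bar> \<le> T * \<delta> + (\<Sum>i\<in>J. \<bar>c i\<bar> * exp (p i * a) * (exp (p i * 0) - 1))"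
    by (intro tendsto_lowerbound[where F="at_right (0::real)"]) auto
  then show ?thesis by (simp add: L_def)
qed

end

section \<open>The supremum and the exponential functional\<close>

context spectrally_negative
begin

lemma xi_jointly_measurable:
  "(\<lambda>(\<omega>, s :: real). indicator {0..} s * exp (r * \<xi> s \<omega>)) \<in> borel_measurable (M \<Otimes>\<^sub>M lborel)"
proof (rule borel_measurable_LIMSEQ_real)
  fix m :: nat
  let ?h = "1 / 2 ^ m :: real"
  have meas: "(\<lambda>z. exp (r * \<xi> (real (Suc i) * ?h) (fst z))) \<in> borel_measurable (M \<Otimes>\<^sub>M lborel)" for i :: nat
  proof -
    have [measurable]: "\<xi> (real (Suc i) * ?h) \<in> borel_measurable M" by (rule xi_measurable) simp
    show ?thesis by measurable
  qed
  have ind: "(\<lambda>z. nat \<lfloor>snd z / ?h\<rfloor>) \<in> measurable (M \<Otimes>\<^sub>M lborel) (count_space UNIV)"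
    by measurable
  have [measurable]: "(\<lambda>z. exp (r * \<xi> (real (Suc (nat \<lfloor>snd z / ?h\<rfloor>)) * ?h) (fst z))) \<in> borel_measurable (M \<Otimes>\<^sub>M lborel)"
    by (rule measurable_compose_countable[OF meas ind])
  have "(\<lambda>z. indicator {0..} (snd z) * exp (r * \<xi> (real (Suc (nat \<lfloor>snd z / ?h\<rfloor>)) * ?h) (fst z)))
     \<in> borel_measurable (M \<Otimes>\<^sub>M lborel)"
    by measurable
  then show "(\<lambda>(\<omega>, s). indicator {0..} s * exp (r * \<xi> (real (Suc (nat \<lfloor>s / ?h\<rfloor>)) * ?h) \<omega>))
     \<in> borel_measurable (M \<Otimes>\<^sub>M lborel)"
    by (simp add: case_prod_beta')
next
  fix z :: "'a \<times> real" assume z: "z \<in> space (M \<Otimes>\<^sub>M lborel)"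
  obtain \<omega> s where zz: "z = (\<omega>, s)" by (cases z)
  have \<omega>: "\<omega> \<in> space M" using z by (simp add: zz space_pair_measure)
  show "(\<lambda>m. case z of (\<omega>, s) \<Rightarrow> indicator {0..} s * exp (r * \<xi> (real (Suc (nat \<lfloor>s / (1 / 2 ^ m)\<rfloor>)) * (1 / 2 ^ m)) \<omega>))
      \<longlonglongrightarrow> (case z of (\<omega>, s) \<Rightarrow> indicator {0..} s * exp (r * \<xi> s \<omega>))"
  proof (cases "s \<ge> 0")
    case True
    have "(\<lambda>m. \<xi> (real (Suc (nat \<lfloor>s / (1 / 2 ^ m)\<rfloor>)) * (1 / 2 ^ m)) \<omega>) \<longlonglongrightarrow> \<xi> s \<omega>"
      by (rule filterlim_compose[OF xi_right_continuous[OF \<omega> True] grid_point_after_filterlim[OF dyadic_mesh(1) dyadic_mesh(2) True]]) simp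
    then have "(\<lambda>m. indicator {0..} s * exp (r * \<xi> (real (Suc (nat \<lfloor>s / (1 / 2 ^ m)\<rfloor>)) * (1 / 2 ^ m)) \<omega>))
      \<longlonglongrightarrow> indicator {0..} s * exp (r * \<xi> s \<omega>)"
      by (intro tendsto_intros)
    then show ?thesis by (simp add: zz del: of_nat_Suc)
  qed (simp add: zz)
qed

lemma exponential_functional_eq:
  "exponential_functional r \<xi> \<omega> = (\<integral>\<^sup>+ s. ennreal (indicator {0..} s * exp (r * \<xi> s \<omega>)) \<partial>lborel)"
  unfolding exponential_functional_def
  by (intro nn_integral_cong) (auto simp: indicator_def)

lemma exponential_functional_measurable [measurable]:
  "exponential_functional r \<xi> \<in> borel_measurable M"
proof -
  have "(\<lambda>\<omega>. \<integral>\<^sup>+ s. ennreal (indicator {0..} s * exp (r * \<xi> s \<omega>)) \<partial>lborel) \<in> borel_measurable M"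
    by (rule lborel.borel_measurable_nn_integral)
       (use measurable_compose[OF xi_jointly_measurable measurable_ennreal] in \<open>simp add: case_prod_beta'\<close>)
  then show ?thesis by (simp add: exponential_functional_eq[abs_def])
qed

lemma expectation_exponential_functional:
  assumes u: "u \<ge> 0"
  shows "(\<integral>\<^sup>+ \<omega>. exponential_functional u \<xi> \<omega> \<partial>M) = (\<integral>\<^sup>+ s\<in>{0..}. ennreal (exp (s * \<psi> u)) \<partial>lborel)"
proof -
  interpret pair_sigma_finite M lborel ..
  have "(\<integral>\<^sup>+ \<omega>. exponential_functional u \<xi> \<omega> \<partial>M)
      = (\<integral>\<^sup>+ s. (\<integral>\<^sup>+ \<omega>. ennreal (indicator {0..} s * exp (u * \<xi> s \<omega>)) \<partial>M) \<partial>lborel)"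
    unfolding exponential_functional_eq
    by (rule Fubini'[symmetric])
       (use measurable_compose[OF xi_jointly_measurable measurable_ennreal] in \<open>simp add: case_prod_beta'\<close>)
  also have "\<dots> = (\<integral>\<^sup>+ s\<in>{0..}. ennreal (exp (s * \<psi> u)) \<partial>lborel)"
  proof (rule nn_integral_cong)
    fix s :: real
    show "(\<integral>\<^sup>+ \<omega>. ennreal (indicator {0..} s * exp (u * \<xi> s \<omega>)) \<partial>M) = ennreal (exp (s * \<psi> u)) * indicator {0..} s"
    proof (cases "s \<ge> 0")
      case True
      have "(\<integral>\<^sup>+ \<omega>. ennreal (exp (u * \<xi> s \<omega>)) \<partial>M) = ennreal (\<integral>\<omega>. exp (u * \<xi> s \<omega>) \<partial>M)"
        by (rule nn_integral_eq_integral) (use exponential_moment[OF True u] in auto)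
      then show ?thesis using True exponential_moment[OF True u] by simp
    qed simp
  qed
  finally show ?thesis .
qed

lemma exponential_functional_pos:
  assumes "\<omega> \<in> space M"
  shows "exponential_functional r \<xi> \<omega> > 0"
proof -
  have m: "(\<lambda>s. indicator {0..} s * exp (r * \<xi> s \<omega>)) \<in> borel_measurable borel"
    by (rule right_continuous_measurable[where f="\<lambda>s. exp (r * \<xi> s \<omega>)"])
       (intro tendsto_intros xi_right_continuous assms)
  have "exponential_functional r \<xi> \<omega> \<noteq> 0"
  proof
    assume "exponential_functional r \<xi> \<omega> = 0"
    then have "AE s in lborel. ennreal (indicator {0..} s * exp (r * \<xi> s \<omega>)) = 0"
      unfolding exponential_functional_eq using m by (subst (asm) nn_integral_0_iff_AE) auto
    then have "AE s in lborel. s \<notin> {0..1::real}"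
      by eventually_elim (auto simp: indicator_def ennreal_eq_0_iff)
    then have "emeasure lborel {0..1::real} = 0"
      by (subst (asm) AE_iff_measurable[where N="{0..1}"]) auto
    then show False by simp
  qed
  then show ?thesis by (simp add: zero_less_iff_neq_zero)
qed

lemma integral_tendsto_exponential_functional:
  assumes \<omega>: "\<omega> \<in> space M" and fin: "exponential_functional r \<xi> \<omega> < \<infinity>"
  shows "(\<lambda>n. LINT s:{0..<real n}|lborel. exp (r * \<xi> s \<omega>)) \<longlonglongrightarrow> enn2real (exponential_functional r \<xi> \<omega>)"
proof -
  let ?f = "\<lambda>s. indicator {0..} s * exp (r * \<xi> s \<omega>)"
  have m[measurable]: "?f \<in> borel_measurable borel"
    by (rule right_continuous_measurable[where f="\<lambda>s. exp (r * \<xi> s \<omega>)"])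
       (intro tendsto_intros xi_right_continuous \<omega>)
  have i: "integrable lborel ?f"
    by (rule integrableI_nonneg) (use fin m in \<open>auto simp: exponential_functional_eq\<close>)
  have e: "enn2real (exponential_functional r \<xi> \<omega>) = integral\<^sup>L lborel ?f"
    unfolding exponential_functional_eq by (rule integral_eq_nn_integral[symmetric]) auto
  have eq: "(LINT s:{0..<real n}|lborel. exp (r * \<xi> s \<omega>)) = (\<integral>s. indicator {..<real n} s * ?f s \<partial>lborel)" for n
    unfolding set_lebesgue_integral_def
    by (intro Bochner_Integration.integral_cong) (auto simp: indicator_def)
  show ?thesis unfolding eq e
  proof (rule integral_dominated_convergence[OF _ _ i])
    show "?f \<in> borel_measurable lborel" "(\<lambda>s. indicator {..<real n} s * ?f s) \<in> borel_measurable lborel" for n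
      by measurable
    show "AE s in lborel. norm (indicator {..<real n} s * ?f s) \<le> ?f s" for n
      by (intro AE_I2) (simp add: indicator_def)
    show "AE s in lborel. (\<lambda>n. indicator {..<real n} s * ?f s) \<longlonglongrightarrow> ?f s"
    proof (rule AE_I2)
      fix s :: real
      obtain N :: nat where N: "s < real N" using reals_Archimedean2 by blast
      have "\<forall>\<^sub>F n in sequentially. indicator {..<real n} s * ?f s = ?f s"
        using eventually_ge_at_top[of N] by eventually_elim (use N in auto)
      then show "(\<lambda>n. indicator {..<real n} s * ?f s) \<longlonglongrightarrow> ?f s" by (rule tendsto_eventually)
    qed
  qed
qed

end

text \<open>The root \<open>\<theta>\<close> of \<open>\<psi>\<close> forces \<open>\<psi> < 0\<close> on the interval from 0 to \<open>\<theta>\<close>, so that the process drifts to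
  $-\infty$.\<close>
locale negative_drift = spectrally_negative M \<xi> \<psi>
  for M :: "'a measure" and \<xi> :: "real \<Rightarrow> 'a \<Rightarrow> real" and \<psi> :: "real \<Rightarrow> real" +
  fixes \<alpha> \<theta> :: real
  assumes theta_pos: "0 < \<theta>" and theta_root: "\<psi> \<theta> = 0" and theta_less: "\<theta> < \<alpha>"
begin

lemma alpha_pos: "\<alpha> > 0" using theta_pos theta_less by simp

lemma psi_neg: "0 < u \<Longrightarrow> u < \<theta> \<Longrightarrow> \<psi> u < 0"
  using psi_slope_strict[of u \<theta>] theta_root by (simp add: divide_less_0_iff)

lemma psi_pos: "\<theta> < u \<Longrightarrow> 0 < \<psi> u"
  using psi_slope_strict[of \<theta> u] theta_root theta_pos by (simp add: zero_less_divide_iff)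

lemma psi_strict_mono:
  assumes "\<theta> < u" "u < v" shows "\<psi> u < \<psi> v"
proof -
  have "\<psi> u / u < \<psi> v / v" by (rule psi_slope_strict) (use assms theta_pos in auto)
  then have "\<psi> u < u / v * \<psi> v" using assms theta_pos by (simp add: field_simps)
  also have "\<dots> \<le> 1 * \<psi> v" using assms theta_pos psi_pos[of v] by (intro mult_right_mono) auto
  finally show ?thesis by simp
qed

lemma psi_at_top: "filterlim \<psi> at_top at_top"
proof -
  define c where "c = \<psi> \<alpha> / \<alpha>"
  have c: "c > 0" using psi_pos[OF theta_less] alpha_pos by (simp add: c_def)
  have "filterlim (\<lambda>u. c * u) at_top at_top"
    by (rule filterlim_tendsto_pos_mult_at_top[OF tendsto_const c filterlim_ident])
  then show ?thesis
  proof (rule filterlim_at_top_mono)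
    show "\<forall>\<^sub>F u in at_top. c * u \<le> \<psi> u"
      using eventually_gt_at_top[of \<alpha>]
    proof eventually_elim
      case (elim u)
      then have "c < \<psi> u / u" using psi_slope_strict[of \<alpha> u] alpha_pos by (simp add: c_def)
      then show ?case using elim alpha_pos by (simp add: field_simps)
    qed
  qed
qed

text \<open>The maximal inequality $P(\sup_{s \le T} \xi_s > a) \le e^{-\theta a}$.\<close>
lemma integral_below_weight_lower:
  assumes a: "a \<ge> 0" and T: "T > 0"
  shows "1 - exp (- \<theta> * a) \<le> (\<integral>\<omega>. below_weight a \<alpha> 0 T \<omega> \<partial>M)"
proof -
  define c where "c i = (if i = 0 then 1 else - exp (- \<theta> * a))" for i :: nat
  define p where "p i = (if i = 0 then 0 else \<theta>)" for i :: nat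
  define H where "H x = (\<Sum>i\<in>{0,1::nat}. c i * exp (p i * x))" for x
  have H_eq: "H x = 1 - exp (\<theta> * (x - a))" for x
    by (simp add: H_def c_def p_def right_diff_distrib exp_diff exp_minus field_simps)
  have "\<bar>(\<integral>\<omega>. below_weight a \<alpha> 0 T \<omega> * H (\<xi> T \<omega>) \<partial>M) - H 0\<bar> \<le> T * 0"
  proof (rule dynkin[where J="{0,1::nat}" and c=c and p=p, OF _ _ a order_refl alpha_pos T H_def])
    show "H a = 0" by (simp add: H_eq)
  qed (use theta_pos theta_root in \<open>auto simp: p_def c_def\<close>)
  then have "1 - exp (- \<theta> * a) = (\<integral>\<omega>. below_weight a \<alpha> 0 T \<omega> * H (\<xi> T \<omega>) \<partial>M)"
    by (simp add: H_eq)
  also have "\<dots> \<le> (\<integral>\<omega>. below_weight a \<alpha> 0 T \<omega> \<partial>M)"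
  proof (rule integral_mono)
    have [measurable]: "below_weight a \<alpha> 0 T \<in> borel_measurable M" "\<xi> T \<in> borel_measurable M"
      using T alpha_pos by (auto intro: below_weight_measurable xi_measurable)
    have [measurable]: "H \<in> borel_measurable borel" unfolding H_eq[abs_def] by measurable
    have Hb: "\<bar>H x\<bar> \<le> 1" if "x \<le> a" for x
    proof -
      have "\<theta> * (x - a) \<le> 0" using that theta_pos by (simp add: mult_nonneg_nonpos)
      then have "exp (\<theta> * (x - a)) \<le> 1" by simp
      then show ?thesis by (simp add: H_eq abs_if)
    qed
    show "integrable M (below_weight a \<alpha> 0 T)"
      by (rule integrable_const_bound[where B=1]) (use below_weight_bounds in auto)
    show "integrable M (\<lambda>\<omega>. below_weight a \<alpha> 0 T \<omega> * H (\<xi> T \<omega>))"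
      by (rule integrable_const_bound[where B=1])
         (auto intro!: AE_I2 below_weight_mult_bound Hb T)
    show "below_weight a \<alpha> 0 T \<omega> * H (\<xi> T \<omega>) \<le> below_weight a \<alpha> 0 T \<omega>" for \<omega>
      using below_weight_bounds[of 0 a \<alpha> T \<omega>] by (simp add: H_eq mult_left_le)
  qed
  finally show ?thesis .
qed

lemma below_indicator_limit:
  "(\<lambda>n. below_weight a \<alpha> 0 (real (Suc n)) \<omega>) \<longlonglongrightarrow> (if \<forall>s\<ge>0. \<xi> s \<omega> \<le> a then 1 else 0)"
proof (rule tendsto_eventually, cases "\<forall>s\<ge>0. \<xi> s \<omega> \<le> a")
  case True
  then show "\<forall>\<^sub>F n in sequentially. below_weight a \<alpha> 0 (real (Suc n)) \<omega> = (if \<forall>s\<ge>0. \<xi> s \<omega> \<le> a then 1 else 0)"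
    by (simp add: below_weight_def)
next
  case False
  then obtain s where s: "s \<ge> 0" "\<xi> s \<omega> > a" by (auto simp: not_le)
  obtain N :: nat where N: "s < real N" using reals_Archimedean2 by blast
  show "\<forall>\<^sub>F n in sequentially. below_weight a \<alpha> 0 (real (Suc n)) \<omega> = (if \<forall>s\<ge>0. \<xi> s \<omega> \<le> a then 1 else 0)"
    using eventually_ge_at_top[of N]
  proof eventually_elim
    case (elim n)
    then have "\<not> (\<forall>s\<in>{0..real (Suc n)}. \<xi> s \<omega> \<le> a)"
      using s N by (auto simp: not_le intro!: bexI[of _ s])
    then show ?case using False by (simp only: below_weight_def if_False)
  qed
qed

lemma below_indicator_measurable [measurable]:
  "(\<lambda>\<omega>. if \<forall>s\<ge>0. \<xi> s \<omega> \<le> a then 1 else 0 :: real) \<in> borel_measurable M"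
  by (rule borel_measurable_LIMSEQ_real[OF below_indicator_limit])
     (use alpha_pos in \<open>auto intro!: below_weight_measurable\<close>)

lemma AE_bounded_above: "AE \<omega> in M. \<exists>n::nat. \<forall>s\<ge>0. \<xi> s \<omega> \<le> real n"
proof -
  define g where "g n \<omega> = (if \<forall>s\<ge>0. \<xi> s \<omega> \<le> real n then 1 else 0 :: real)" for n :: nat and \<omega>
  define f where "f \<omega> = (if \<exists>n::nat. \<forall>s\<ge>0. \<xi> s \<omega> \<le> real n then 1 else 0 :: real)" for \<omega>
  have gm[measurable]: "g n \<in> borel_measurable M" for n unfolding g_def[abs_def] by measurable
  have low: "1 - exp (- \<theta> * real n) \<le> (\<integral>\<omega>. g n \<omega> \<partial>M)" for n
  proof (rule tendsto_lowerbound)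
    show "(\<lambda>m. \<integral>\<omega>. below_weight (real n) \<alpha> 0 (real (Suc m)) \<omega> \<partial>M) \<longlonglongrightarrow> (\<integral>\<omega>. g n \<omega> \<partial>M)"
    proof (rule integral_dominated_convergence[where w="\<lambda>_. 1"])
      show "below_weight (real n) \<alpha> 0 (real (Suc m)) \<in> borel_measurable M" for m
        using alpha_pos by (intro below_weight_measurable) auto
      show "AE \<omega> in M. (\<lambda>m. below_weight (real n) \<alpha> 0 (real (Suc m)) \<omega>) \<longlonglongrightarrow> g n \<omega>"
        unfolding g_def by (intro AE_I2 below_indicator_limit)
      show "AE \<omega> in M. norm (below_weight (real n) \<alpha> 0 (real (Suc m)) \<omega>) \<le> 1" for m
        using below_weight_bounds[of 0] by (intro AE_I2) simp
    qed auto
    show "\<forall>\<^sub>F m in sequentially. 1 - exp (- \<theta> * real n) \<le> (\<integral>\<omega>. below_weight (real n) \<alpha> 0 (real (Suc m)) \<omega> \<partial>M)"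
      by (intro always_eventually allI integral_below_weight_lower) auto
  qed simp
  have gf: "(\<lambda>n. g n \<omega>) \<longlonglongrightarrow> f \<omega>" for \<omega>
  proof (rule tendsto_eventually, cases "\<exists>n::nat. \<forall>s\<ge>0. \<xi> s \<omega> \<le> real n")
    case True
    then obtain N :: nat where N: "\<forall>s\<ge>0. \<xi> s \<omega> \<le> real N" by blast
    show "\<forall>\<^sub>F n in sequentially. g n \<omega> = f \<omega>"
      using eventually_ge_at_top[of N]
    proof eventually_elim
      case (elim n)
      then have "\<forall>s\<ge>0. \<xi> s \<omega> \<le> real n" using N by (meson of_nat_le_iff order_trans)
      then show ?case using True by (simp add: g_def f_def)
    qed
  next
    case False
    then show "\<forall>\<^sub>F n in sequentially. g n \<omega> = f \<omega>" by (auto simp: g_def f_def)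
  qed
  have fm[measurable]: "f \<in> borel_measurable M" by (rule borel_measurable_LIMSEQ_real[OF gf gm])
  have "(\<lambda>n. \<integral>\<omega>. g n \<omega> \<partial>M) \<longlonglongrightarrow> (\<integral>\<omega>. f \<omega> \<partial>M)"
    by (rule integral_dominated_convergence[where w="\<lambda>_. 1"]) (use gf in \<open>auto simp: g_def\<close>)
  moreover have "(\<lambda>n. 1 - exp (- \<theta> * real n)) \<longlonglongrightarrow> 1" using theta_pos by real_asymp
  ultimately have "1 \<le> (\<integral>\<omega>. f \<omega> \<partial>M)"
    using low by (intro LIMSEQ_le) auto
  have fi: "integrable M f" by (rule integrable_const_bound[where B=1]) (auto simp: f_def)
  have "(\<integral>\<omega>. 1 - f \<omega> \<partial>M) = 1 - (\<integral>\<omega>. f \<omega> \<partial>M)" using fi by (simp add: prob_space)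
  moreover have "(\<integral>\<omega>. 1 - f \<omega> \<partial>M) \<ge> 0" by (intro Bochner_Integration.integral_nonneg) (auto simp: f_def)
  ultimately have "(\<integral>\<omega>. 1 - f \<omega> \<partial>M) = 0" using \<open>1 \<le> (\<integral>\<omega>. f \<omega> \<partial>M)\<close> by simp
  moreover have "integrable M (\<lambda>\<omega>. 1 - f \<omega>)" using fi by simp
  ultimately have "AE \<omega> in M. 1 - f \<omega> = 0"
    by (subst (asm) integral_nonneg_eq_0_iff_AE) (auto simp: f_def)
  then show ?thesis by eventually_elim (auto simp: f_def split: if_splits)
qed

text \<open>For $u = \theta/2$ one has $\psi(u) < 0$, so $\int_0^\infty e^{u \xi_s} ds$ is integrable, and
  $e^{\alpha \xi} \le e^{(\alpha - u) a} e^{u \xi}$ on paths bounded above by \<open>a\<close>.\<close>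
lemma AE_exponential_functional_finite: "AE \<omega> in M. exponential_functional \<alpha> \<xi> \<omega> < \<infinity>"
proof -
  define u where "u = \<theta> / 2"
  have u: "0 < u" "u < \<theta>" "u < \<alpha>" using theta_pos theta_less by (auto simp: u_def)
  have neg: "\<psi> u < 0" using psi_neg u by simp
  have "((\<lambda>s. exp (- (- \<psi> u) * s)) has_integral exp (- (- \<psi> u) * 0) / (- \<psi> u)) {0..}"
    by (rule has_integral_exp_minus_to_infinity) (use neg in simp)
  then have "((\<lambda>s. exp (s * \<psi> u)) has_integral 1 / (- \<psi> u)) {0..}" by (simp add: mult.commute)
  then have "(\<integral>\<^sup>+ \<omega>. exponential_functional u \<xi> \<omega> \<partial>M) = ennreal (1 / (- \<psi> u))"
    using u by (subst expectation_exponential_functional) (auto intro: nn_integral_has_integral_lebesgue')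
  then have "AE \<omega> in M. exponential_functional u \<xi> \<omega> \<noteq> \<infinity>"
    by (intro nn_integral_PInf_AE) auto
  with AE_bounded_above AE_space show ?thesis
  proof eventually_elim
    case (elim \<omega>)
    then obtain n :: nat where n: "\<And>s. s \<ge> 0 \<Longrightarrow> \<xi> s \<omega> \<le> real n" by blast
    have "exponential_functional \<alpha> \<xi> \<omega> \<le> (\<integral>\<^sup>+ s. ennreal (exp ((\<alpha> - u) * real n)) * ennreal (indicator {0..} s * exp (u * \<xi> s \<omega>)) \<partial>lborel)"
      unfolding exponential_functional_eq
    proof (rule nn_integral_mono)
      fix s :: real
      show "ennreal (indicator {0..} s * exp (\<alpha> * \<xi> s \<omega>)) \<le> ennreal (exp ((\<alpha> - u) * real n)) * ennreal (indicator {0..} s * exp (u * \<xi> s \<omega>))"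
      proof (cases "s \<ge> 0")
        case True
        have "exp (\<alpha> * \<xi> s \<omega>) = exp ((\<alpha> - u) * \<xi> s \<omega>) * exp (u * \<xi> s \<omega>)" by (simp add: exp_add[symmetric] algebra_simps)
        also have "\<dots> \<le> exp ((\<alpha> - u) * real n) * exp (u * \<xi> s \<omega>)"
          using n[OF True] u by (intro mult_right_mono) (auto intro: mult_left_mono)
        finally show ?thesis using True by (simp add: ennreal_mult[symmetric] ennreal_leI)
      qed simp
    qed
    also have "\<dots> = ennreal (exp ((\<alpha> - u) * real n)) * exponential_functional u \<xi> \<omega>"
      unfolding exponential_functional_eq
    proof (rule nn_integral_cmult)
      have "(\<lambda>s. indicator {0..} s * exp (u * \<xi> s \<omega>)) \<in> borel_measurable borel"
        by (rule right_continuous_measurable[where f="\<lambda>s. exp (u * \<xi> s \<omega>)"])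
           (intro tendsto_intros xi_right_continuous elim)
      then show "(\<lambda>s. ennreal (indicator {0..} s * exp (u * \<xi> s \<omega>))) \<in> borel_measurable lborel" by simp
    qed
    also have "\<dots> < \<infinity>" using elim by (simp add: ennreal_mult_less_top less_top)
    finally show ?case .
  qed
qed

lemma AE_drift_to_minus_infinity:
  "AE \<omega> in M. \<forall>r>0. (\<lambda>n. exp (r * \<xi> (real n) \<omega>)) \<longlonglongrightarrow> 0"
proof -
  define u where "u = \<theta> / 2"
  have u: "0 < u" "u < \<theta>" using theta_pos by (auto simp: u_def)
  have neg: "\<psi> u < 0" using psi_neg u by simp
  have [measurable]: "\<xi> (real n) \<in> borel_measurable M" for n by (intro xi_measurable) simp
  have "(\<integral>\<^sup>+ \<omega>. (\<Sum>n. ennreal (exp (u * \<xi> (real n) \<omega>))) \<partial>M) = (\<Sum>n. \<integral>\<^sup>+ \<omega>. ennreal (exp (u * \<xi> (real n) \<omega>)) \<partial>M)"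
    by (rule nn_integral_suminf) measurable
  also have "\<dots> = (\<Sum>n. ennreal (exp (\<psi> u) ^ n))"
  proof (rule suminf_cong)
    fix n
    have "(\<integral>\<^sup>+ \<omega>. ennreal (exp (u * \<xi> (real n) \<omega>)) \<partial>M) = ennreal (\<integral>\<omega>. exp (u * \<xi> (real n) \<omega>) \<partial>M)"
      by (rule nn_integral_eq_integral) (use exponential_moment[of "real n" u] u in auto)
    then show "(\<integral>\<^sup>+ \<omega>. ennreal (exp (u * \<xi> (real n) \<omega>)) \<partial>M) = ennreal (exp (\<psi> u) ^ n)"
      using exponential_moment(2)[of "real n" u] u by (simp add: exp_of_nat_mult)
  qed
  also have "\<dots> = ennreal (\<Sum>n. exp (\<psi> u) ^ n)"
    using neg by (intro suminf_ennreal2) (auto intro: summable_geometric)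
  finally have "(\<integral>\<^sup>+ \<omega>. (\<Sum>n. ennreal (exp (u * \<xi> (real n) \<omega>))) \<partial>M) \<noteq> \<infinity>" by simp
  then have "AE \<omega> in M. (\<Sum>n. ennreal (exp (u * \<xi> (real n) \<omega>))) \<noteq> \<infinity>"
    by (intro nn_integral_PInf_AE) auto
  then show ?thesis
  proof eventually_elim
    case (elim \<omega>)
    have "summable (\<lambda>n. exp (u * \<xi> (real n) \<omega>))"
      using elim by (intro summable_suminf_not_top) auto
    then have lim: "(\<lambda>n. exp (u * \<xi> (real n) \<omega>)) \<longlonglongrightarrow> 0" by (rule summable_LIMSEQ_zero)
    show ?case
    proof safe
      fix r :: real assume r: "r > 0"
      have "(\<lambda>n. exp (u * \<xi> (real n) \<omega>) powr (r / u)) \<longlonglongrightarrow> 0"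
        by (rule tendsto_zero_powrI[OF lim tendsto_const]) (use u r in auto)
      then show "(\<lambda>n. exp (r * \<xi> (real n) \<omega>)) \<longlonglongrightarrow> 0"
        using u by (simp add: powr_def)
    qed
  qed
qed

text \<open>The random variable $\Sigma_\infty$, with the irrelevant value 0 where the integral diverges.\<close>
definition total :: "'a \<Rightarrow> real" where
  "total \<omega> = enn2real (exponential_functional \<alpha> \<xi> \<omega>)"

lemma total_measurable [measurable]: "total \<in> borel_measurable M"
  unfolding total_def[abs_def] by measurable

lemma total_nonneg: "total \<omega> \<ge> 0"
  by (simp add: total_def)

lemma AE_total_pos: "AE \<omega> in M. total \<omega> > 0"
  using AE_exponential_functional_finite
  by (auto intro: exponential_functional_pos simp: total_def enn2real_positive_iff)

text \<open>The limit $T \rightarrow \infty$ in the stopped identity, for a function \<open>H\<close> bounded below the level.\<close>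
lemma laplace_below_level:
  assumes q: "q \<ge> 0" and [measurable]: "H \<in> borel_measurable borel"
    and B: "\<And>x. x \<le> a \<Longrightarrow> \<bar>H x\<bar> \<le> B"
    and lim: "AE \<omega> in M. (\<lambda>n. H (\<xi> (real (Suc n)) \<omega>)) \<longlonglongrightarrow> 1"
    and eq: "\<And>n. (\<integral>\<omega>. below_weight a \<alpha> q (real (Suc n)) \<omega> * H (\<xi> (real (Suc n)) \<omega>) \<partial>M) = h"
  shows "(\<integral>\<omega>. (if \<forall>s\<ge>0. \<xi> s \<omega> \<le> a then 1 else 0) * exp (- q * total \<omega>) \<partial>M) = h"
proof (rule LIMSEQ_unique[OF _ tendsto_const])
  have "(\<lambda>n. \<integral>\<omega>. below_weight a \<alpha> q (real (Suc n)) \<omega> * H (\<xi> (real (Suc n)) \<omega>) \<partial>M)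
     \<longlonglongrightarrow> (\<integral>\<omega>. (if \<forall>s\<ge>0. \<xi> s \<omega> \<le> a then 1 else 0) * exp (- q * total \<omega>) \<partial>M)"
  proof (rule integral_dominated_convergence[where w="\<lambda>_. B"])
    have [measurable]: "\<xi> (real (Suc n)) \<in> borel_measurable M" for n by (intro xi_measurable) simp
    have [measurable]: "below_weight a \<alpha> q (real (Suc n)) \<in> borel_measurable M" for n
      using alpha_pos by (intro below_weight_measurable) auto
    show "(\<lambda>\<omega>. below_weight a \<alpha> q (real (Suc n)) \<omega> * H (\<xi> (real (Suc n)) \<omega>)) \<in> borel_measurable M" for n
      by measurable
    show "(\<lambda>\<omega>. (if \<forall>s\<ge>0. \<xi> s \<omega> \<le> a then 1 else 0) * exp (- q * total \<omega>)) \<in> borel_measurable M"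
      by measurable
    show "AE \<omega> in M. norm (below_weight a \<alpha> q (real (Suc n)) \<omega> * H (\<xi> (real (Suc n)) \<omega>)) \<le> B" for n
      unfolding real_norm_def by (intro AE_I2 below_weight_mult_bound q B) auto
    show "AE \<omega> in M. (\<lambda>n. below_weight a \<alpha> q (real (Suc n)) \<omega> * H (\<xi> (real (Suc n)) \<omega>))
       \<longlonglongrightarrow> (if \<forall>s\<ge>0. \<xi> s \<omega> \<le> a then 1 else 0) * exp (- q * total \<omega>)"
      using lim AE_exponential_functional_finite AE_space
    proof eventually_elim
      case (elim \<omega>)
      have "(\<lambda>n. below_weight a \<alpha> q (real (Suc n)) \<omega>)
        \<longlonglongrightarrow> (if \<forall>s\<ge>0. \<xi> s \<omega> \<le> a then 1 else 0) * exp (- q * total \<omega>)"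
      proof -
        have "(\<lambda>n. below_weight a \<alpha> 0 (real (Suc n)) \<omega> * exp (- q * (LINT s:{0..<real (Suc n)}|lborel. exp (\<alpha> * \<xi> s \<omega>))))
          \<longlonglongrightarrow> (if \<forall>s\<ge>0. \<xi> s \<omega> \<le> a then 1 else 0) * exp (- q * total \<omega>)"
          unfolding total_def
          by (intro tendsto_mult below_indicator_limit tendsto_exp tendsto_const
               LIMSEQ_Suc[OF integral_tendsto_exponential_functional] elim)
        moreover have "below_weight a \<alpha> 0 (real (Suc n)) \<omega> * exp (- q * (LINT s:{0..<real (Suc n)}|lborel. exp (\<alpha> * \<xi> s \<omega>)))
            = below_weight a \<alpha> q (real (Suc n)) \<omega>" for n
          by (simp add: below_weight_def)
        ultimately show ?thesis by simp
      qed
      from tendsto_mult[OF this elim(1)] show ?case by simp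
    qed
  qed auto
  then show "(\<lambda>n. h) \<longlonglongrightarrow> (\<integral>\<omega>. (if \<forall>s\<ge>0. \<xi> s \<omega> \<le> a then 1 else 0) * exp (- q * total \<omega>) \<partial>M)"
    by (simp only: eq)
qed

lemma laplace_below_level_tendsto:
  assumes q: "q \<ge> 0"
  shows "((\<lambda>a. \<integral>\<omega>. (if \<forall>s\<ge>0. \<xi> s \<omega> \<le> a then 1 else 0) * exp (- q * total \<omega>) \<partial>M)
     \<longlongrightarrow> (\<integral>\<omega>. exp (- q * total \<omega>) \<partial>M)) at_top"
proof (rule integral_dominated_convergence_at_top[where w="\<lambda>_. 1"])
  show "\<forall>\<^sub>F a in at_top. AE \<omega> in M. norm ((if \<forall>s\<ge>0. \<xi> s \<omega> \<le> a then 1 else 0) * exp (- q * total \<omega>)) \<le> 1"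
    using q total_nonneg by (auto intro!: always_eventually AE_I2)
  show "AE \<omega> in M. ((\<lambda>a. (if \<forall>s\<ge>0. \<xi> s \<omega> \<le> a then 1 else 0) * exp (- q * total \<omega>)) \<longlongrightarrow> exp (- q * total \<omega>)) at_top"
    using AE_bounded_above
  proof eventually_elim
    case (elim \<omega>)
    then obtain n :: nat where n: "\<And>s. s \<ge> 0 \<Longrightarrow> \<xi> s \<omega> \<le> real n" by blast
    have "\<forall>\<^sub>F a in at_top. (if \<forall>s\<ge>0. \<xi> s \<omega> \<le> a then 1 else 0) * exp (- q * total \<omega>) = exp (- q * total \<omega>)"
      using eventually_ge_at_top[of "real n"]
    proof eventually_elim
      case (elim a)
      then have "\<forall>s\<ge>0. \<xi> s \<omega> \<le> a" using n order_trans by blast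
      then show ?case by simp
    qed
    then show ?case by (rule tendsto_eventually)
  qed
qed auto

end

section \<open>The power series of an exponent\<close>

text \<open>What the power series needs of the exponent. The conditions concern the points $\alpha k$ only, so
  that \<open>\<psi>\<close> itself, which is negative between 0 and \<open>\<theta>\<close>, qualifies when $\theta < \alpha$.\<close>
locale series_exponent =
  fixes \<alpha> :: real and \<phi> :: "real \<Rightarrow> real"
  assumes phi_zero: "\<phi> 0 = 0"
    and phi_pos: "\<And>k::nat. k \<ge> 1 \<Longrightarrow> \<phi> (\<alpha> * real k) > 0"
    and phi_at_top: "filterlim (\<lambda>k::nat. \<phi> (\<alpha> * real k)) at_top sequentially"
begin

abbreviation A :: "nat \<Rightarrow> real" where "A \<equiv> I_coeff \<alpha> \<phi>"

lemma coeff_0 [simp]: "A 0 = 1" by (simp add: I_coeff_def)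

lemma coeff_pos: "A n > 0"
  unfolding I_coeff_def using phi_pos by (auto intro!: prod_pos)

lemma coeff_Suc: "A (Suc n) * \<phi> (\<alpha> * real (Suc n)) = A n"
  using phi_pos[of "Suc n"] by (simp add: I_coeff_def)

lemma coeff_Suc': "A (Suc n) = A n / \<phi> (\<alpha> * real (Suc n))"
  using coeff_Suc[of n] phi_pos[of "Suc n"] by (simp add: field_simps)

lemma summable_coeff:
  fixes z :: "'b :: {real_normed_field, banach}"
  shows "summable (\<lambda>n. of_real (A n) * z ^ n)"
proof -
  have "\<forall>\<^sub>F n in sequentially. 2 * norm z + 1 \<le> \<phi> (\<alpha> * real (Suc n))"
    using filterlim_compose[OF phi_at_top filterlim_Suc] by (simp add: filterlim_at_top)
  then obtain N where N: "\<And>n. n \<ge> N \<Longrightarrow> 2 * norm z + 1 \<le> \<phi> (\<alpha> * real (Suc n))"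
    by (auto simp: eventually_sequentially)
  show ?thesis
  proof (rule summable_ratio_test[where c="1/2" and N=N])
    fix n assume "n \<ge> N"
    then have n: "2 * norm z + 1 \<le> \<phi> (\<alpha> * real (Suc n))" by (rule N)
    have pos: "\<phi> (\<alpha> * real (Suc n)) > 0" by (rule phi_pos) simp
    have "norm z / \<phi> (\<alpha> * real (Suc n)) \<le> 1 / 2" using n pos by (simp add: field_simps)
    then have "norm z / \<phi> (\<alpha> * real (Suc n)) * (A n * norm z ^ n) \<le> 1 / 2 * (A n * norm z ^ n)"
      using coeff_pos[of n] by (intro mult_right_mono) auto
    then show "norm (of_real (A (Suc n)) * z ^ Suc n) \<le> 1 / 2 * norm (of_real (A n) * z ^ n)"
      using coeff_pos[of n] pos
      by (simp add: coeff_Suc' norm_mult norm_power norm_divide mult_ac del: of_nat_Suc)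
  qed simp
qed

lemma I_series_has_field_derivative:
  fixes z :: "'b :: {real_normed_field, banach}"
  shows "\<exists>D. ((I_series \<alpha> \<phi> :: 'b \<Rightarrow> 'b) has_field_derivative D) (at z)"
  using termdiffs_strong_converges_everywhere[of "\<lambda>n. of_real (A n)" z, OF summable_coeff]
  unfolding I_series_def[abs_def] by blast

lemma I_series_isCont:
  fixes z :: "'b :: {real_normed_field, banach}"
  shows "isCont (I_series \<alpha> \<phi> :: 'b \<Rightarrow> 'b) z"
  using I_series_has_field_derivative DERIV_isCont by blast

lemma I_series_0 [simp]: "I_series \<alpha> \<phi> (0 :: 'b :: {real_normed_field, banach}) = 1"
  unfolding I_series_def by (subst powser_zero) simp

lemma I_series_real: "I_series \<alpha> \<phi> (x::real) = (\<Sum>n. A n * x ^ n)"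
  by (simp add: I_series_def)

lemma summable_real: "summable (\<lambda>n. A n * x ^ n)" for x :: real
  using summable_coeff[of x] by simp

lemma term_nonneg: "x \<ge> 0 \<Longrightarrow> 0 \<le> A n * x ^ n" for x :: real
  using coeff_pos[of n] by simp

lemma partial_sum_le:
  fixes x :: real
  assumes "x \<ge> 0"
  shows "(\<Sum>n<N. A n * x ^ n) \<le> I_series \<alpha> \<phi> x"
  unfolding I_series_real using assms
  by (intro sum_le_suminf summable_real) (auto intro: term_nonneg)

lemma partial_sum_tendsto: "(\<lambda>N. \<Sum>n<N. A n * x ^ n) \<longlonglongrightarrow> I_series \<alpha> \<phi> x" for x :: real
  unfolding I_series_real using summable_real[of x] by (simp add: summable_LIMSEQ)

lemma I_series_ge_1: "x \<ge> 0 \<Longrightarrow> 1 \<le> I_series \<alpha> \<phi> x" for x :: real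
  using partial_sum_le[of x 1] by simp

lemma I_series_gt_1: "x > 0 \<Longrightarrow> 1 < I_series \<alpha> \<phi> x" for x :: real
  using partial_sum_le[of x 2] mult_pos_pos[OF coeff_pos[of "Suc 0"], of x]
  by (simp add: numeral_2_eq_2)

lemma I_series_mono: "0 \<le> x \<Longrightarrow> x \<le> y \<Longrightarrow> I_series \<alpha> \<phi> x \<le> I_series \<alpha> \<phi> y" for x y :: real
  unfolding I_series_real using coeff_pos
  by (intro suminf_le summable_real) (auto intro!: mult_left_mono power_mono intro: less_imp_le)

lemma I_series_ge_term: "x \<ge> 0 \<Longrightarrow> A n * x ^ n \<le> I_series \<alpha> \<phi> x" for x :: real
  by (rule order_trans[OF _ partial_sum_le[of x "Suc n"]])
     (auto intro!: sum_nonneg term_nonneg)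

text \<open>With $y = q e^{\alpha x}$ this says that the truncated series solves
  $\mathcal{L} H = q e^{\alpha x} H$ up to its last term.\<close>
lemma truncated_eigenfunction:
  "(\<Sum>n<Suc N. A n * (\<phi> (\<alpha> * real n) - y) * y ^ n) = - A N * y ^ Suc N" for y :: real
proof (induction N)
  case 0
  then show ?case by (simp add: phi_zero)
next
  case (Suc N)
  have "(\<Sum>n<Suc (Suc N). A n * (\<phi> (\<alpha> * real n) - y) * y ^ n)
    = - A N * y ^ Suc N + A (Suc N) * (\<phi> (\<alpha> * real (Suc N)) - y) * y ^ Suc N"
    using Suc by (subst sum.lessThan_Suc) simp
  also have "A N = A (Suc N) * \<phi> (\<alpha> * real (Suc N))" by (simp only: coeff_Suc)
  finally show ?case by (simp add: algebra_simps)
qed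

end

section \<open>The Laplace transform of the exponential functional\<close>

context negative_drift
begin

sublocale I: series_exponent \<alpha> \<psi>
proof
  show "\<psi> 0 = 0" by simp
  show "\<psi> (\<alpha> * real k) > 0" if "k \<ge> 1" for k
  proof (rule psi_pos)
    have "\<alpha> * 1 \<le> \<alpha> * real k" using that alpha_pos by (intro mult_left_mono) auto
    then show "\<theta> < \<alpha> * real k" using theta_less by simp
  qed
  have "filterlim (\<lambda>k::nat. \<alpha> * real k) at_top sequentially"
    by (rule filterlim_tendsto_pos_mult_at_top[OF tendsto_const alpha_pos filterlim_real_sequentially])
  then show "filterlim (\<lambda>k::nat. \<psi> (\<alpha> * real k)) at_top sequentially"
    by (rule filterlim_compose[OF psi_at_top])
qed

lemma shifted_exponent_eq: "shifted_exponent \<psi> \<theta> u = \<psi> (u + \<theta>)"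
  by (simp add: shifted_exponent_def theta_root)

sublocale J: series_exponent \<alpha> "shifted_exponent \<psi> \<theta>"
proof
  show "shifted_exponent \<psi> \<theta> 0 = 0" by (simp add: shifted_exponent_def)
  show "shifted_exponent \<psi> \<theta> (\<alpha> * real k) > 0" if "k \<ge> 1" for k
    unfolding shifted_exponent_eq
    by (rule psi_pos) (use that alpha_pos in auto)
  have "filterlim (\<lambda>k::nat. \<alpha> * real k) at_top sequentially"
    by (rule filterlim_tendsto_pos_mult_at_top[OF tendsto_const alpha_pos filterlim_real_sequentially])
  then have "filterlim (\<lambda>k::nat. \<alpha> * real k + \<theta>) at_top sequentially"
    using filterlim_tendsto_add_at_top[OF tendsto_const[of \<theta>]] by (simp add: add.commute)
  then show "filterlim (\<lambda>k::nat. shifted_exponent \<psi> \<theta> (\<alpha> * real k)) at_top sequentially"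
    unfolding shifted_exponent_eq by (rule filterlim_compose[OF psi_at_top])
qed

text \<open>The first eigenfunction; it tends to 1 at $-\infty$.\<close>
definition F :: "real \<Rightarrow> real \<Rightarrow> real" where
  "F q x = I_series \<alpha> \<psi> (q * exp (\<alpha> * x))"

text \<open>The second eigenfunction; it tends to 0 at $-\infty$.\<close>
definition G :: "real \<Rightarrow> real \<Rightarrow> real" where
  "G q x = exp (\<theta> * x) * I_series \<alpha> (shifted_exponent \<psi> \<theta>) (q * exp (\<alpha> * x))"

lemma F_bounds: "q \<ge> 0 \<Longrightarrow> 1 \<le> F q x" "q \<ge> 0 \<Longrightarrow> x \<le> a \<Longrightarrow> F q x \<le> F q a"
  unfolding F_def using alpha_pos
  by (auto intro!: I.I_series_ge_1 I.I_series_mono mult_left_mono)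

lemma G_bounds: "q \<ge> 0 \<Longrightarrow> exp (\<theta> * x) \<le> G q x" "q \<ge> 0 \<Longrightarrow> x \<le> a \<Longrightarrow> G q x \<le> G q a"
proof -
  assume q: "q \<ge> 0"
  then have 1: "1 \<le> I_series \<alpha> (shifted_exponent \<psi> \<theta>) (q * exp (\<alpha> * x))" for x
    by (intro J.I_series_ge_1) auto
  show "exp (\<theta> * x) \<le> G q x"
    unfolding G_def using 1[of x] by simp
  assume "x \<le> a"
  then show "G q x \<le> G q a"
    unfolding G_def using 1[of x] alpha_pos theta_pos q
    by (intro mult_mono J.I_series_mono mult_left_mono) auto
qed

lemma G_pos: "q \<ge> 0 \<Longrightarrow> G q x > 0"
  using G_bounds(1)[of q x] exp_gt_zero[of "\<theta> * x"] by linarith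

lemma isCont_F: "isCont (F q) x"
  unfolding F_def[abs_def]
  by (rule isCont_o2[OF _ I.I_series_isCont]) (intro continuous_intros)

lemma isCont_G: "isCont (G q) x"
  unfolding G_def[abs_def]
  by (intro continuous_mult isCont_o2[OF _ J.I_series_isCont]) (intro continuous_intros)+

lemma FG_measurable [measurable]: "F q \<in> borel_measurable borel" "G q \<in> borel_measurable borel"
  by (auto intro!: borel_measurable_continuous_onI continuous_at_imp_continuous_on isCont_F isCont_G)

text \<open>The stopped identity at a finite time. It follows from \<open>dynkin\<close> for truncations of the two
  series, combined with the coefficient that makes the truncated combination vanish at \<open>a\<close>.\<close>
lemma killed_expectation:
  assumes q: "q \<ge> 0" and a: "a \<ge> 0" and T: "T > 0"
  defines "\<kappa> \<equiv> F q a / G q a"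
  shows "(\<integral>\<omega>. below_weight a \<alpha> q T \<omega> * (F q (\<xi> T \<omega>) - \<kappa> * G q (\<xi> T \<omega>)) \<partial>M) = F q 0 - \<kappa> * G q 0"
proof -
  define y where "y x = q * exp (\<alpha> * x)" for x
  define FN where "FN N x = (\<Sum>n<Suc N. I.A n * y x ^ n)" for N x
  define GN where "GN N x = exp (\<theta> * x) * (\<Sum>n<Suc N. J.A n * y x ^ n)" for N x
  define k where "k N = FN N a / GN N a" for N
  define \<delta> where "\<delta> N = I.A N * y a ^ Suc N + k N * (exp (\<theta> * a) * (J.A N * y a ^ Suc N))" for N
  have y0: "y x \<ge> 0" for x using q by (simp add: y_def)
  have ymono: "y x \<le> y a" if "x \<le> a" for x using that q alpha_pos by (simp add: y_def mult_left_mono)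
  have FN_lim: "(\<lambda>N. FN N x) \<longlonglongrightarrow> F q x" for x
    unfolding FN_def F_def y_def by (rule LIMSEQ_Suc[OF I.partial_sum_tendsto])
  have GN_lim: "(\<lambda>N. GN N x) \<longlonglongrightarrow> G q x" for x
    unfolding GN_def G_def y_def by (intro tendsto_mult tendsto_const LIMSEQ_Suc[OF J.partial_sum_tendsto])
  have FN0: "0 \<le> FN N x" "FN N x \<le> F q x" for N x
    unfolding FN_def F_def y_def[symmetric]
    using y0[of x] by (auto intro!: sum_nonneg I.term_nonneg I.partial_sum_le simp del: sum.lessThan_Suc)
  have GN1: "exp (\<theta> * x) \<le> GN N x" for N x
  proof -
    have "(\<Sum>n<1. J.A n * y x ^ n) \<le> (\<Sum>n<Suc N. J.A n * y x ^ n)"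
      using y0[of x] by (intro sum_mono2) (auto intro: J.term_nonneg)
    then have "exp (\<theta> * x) * 1 \<le> exp (\<theta> * x) * (\<Sum>n<Suc N. J.A n * y x ^ n)" by (intro mult_left_mono) simp_all
    then show ?thesis by (simp add: GN_def)
  qed
  have GN0: "GN N x > 0" for N x using GN1[of x N] exp_gt_zero[of "\<theta> * x"] by linarith
  have GNle: "GN N x \<le> G q x" for N x
    unfolding GN_def G_def y_def[symmetric]
    using y0[of x] by (intro mult_left_mono J.partial_sum_le) auto
  have k_lim: "k \<longlonglongrightarrow> \<kappa>"
    unfolding k_def[abs_def] \<kappa>_def using G_pos[OF q, of a] by (intro tendsto_divide FN_lim GN_lim) simp
  have k0: "0 \<le> k N" for N unfolding k_def using FN0[of N a] GN0[of N a] by simp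
  have kb: "k N \<le> F q a / exp (\<theta> * a)" for N
    unfolding k_def using FN0[of N a] GN1[of a N] by (intro frac_le) auto
  have step: "\<bar>(\<integral>\<omega>. below_weight a \<alpha> q T \<omega> * (FN N (\<xi> T \<omega>) - k N * GN N (\<xi> T \<omega>)) \<partial>M)
      - (FN N 0 - k N * GN N 0)\<bar> \<le> T * \<delta> N" for N
  proof -
    \<comment> \<open>The index set is the disjoint sum of those of the two truncated series.\<close>
    define S where "S = {..<Suc N} <+> {..<Suc N}"
    define c where "c = case_sum (\<lambda>n. I.A n * q ^ n) (\<lambda>n. - k N * (J.A n * q ^ n))"
    define p where "p = case_sum (\<lambda>n. \<alpha> * real n) (\<lambda>n. \<theta> + \<alpha> * real n)"
    have ye: "y x ^ n = q ^ n * exp (\<alpha> * real n * x)" for x n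
      by (simp add: y_def power_mult_distrib exp_of_nat_mult[symmetric] mult_ac)
    show ?thesis
    proof (rule dynkin[where J=S and c=c and p=p and H="\<lambda>x. FN N x - k N * GN N x", OF _ _ a q alpha_pos T])
      show "finite S" by (simp add: S_def)
      show "p i \<ge> 0" if "i \<in> S" for i using that alpha_pos theta_pos by (auto simp: p_def S_def)
      show "FN N a - k N * GN N a = 0" using GN0[of N a] by (simp add: k_def)
      show "FN N x - k N * GN N x = (\<Sum>i\<in>S. c i * exp (p i * x))" for x
        unfolding S_def FN_def GN_def
        by (subst sum.Plus) (auto simp: c_def p_def ye sum_distrib_left exp_add algebra_simps sum_negf
            simp del: sum.lessThan_Suc intro!: sum.cong)
      fix x assume x: "x \<le> a"
      have t1: "c (Inl n) * (\<psi> (p (Inl n)) - y x) * exp (p (Inl n) * x)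
          = I.A n * (\<psi> (\<alpha> * real n) - y x) * y x ^ n" for n
        by (simp add: c_def p_def ye)
      have t2: "c (Inr n) * (\<psi> (p (Inr n)) - y x) * exp (p (Inr n) * x)
          = - (k N * exp (\<theta> * x)) * (J.A n * (shifted_exponent \<psi> \<theta> (\<alpha> * real n) - y x) * y x ^ n)" for n
      proof -
        have "exp ((\<theta> + \<alpha> * real n) * x) = exp (\<theta> * x) * exp (\<alpha> * real n * x)"
          by (simp add: exp_add[symmetric] distrib_right)
        then show ?thesis by (simp add: c_def p_def ye shifted_exponent_eq add.commute)
      qed
      have "(\<Sum>i\<in>S. c i * (\<psi> (p i) - q * exp (\<alpha> * x)) * exp (p i * x))
        = (\<Sum>n<Suc N. I.A n * (\<psi> (\<alpha> * real n) - y x) * y x ^ n)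
          - k N * exp (\<theta> * x) * (\<Sum>n<Suc N. J.A n * (shifted_exponent \<psi> \<theta> (\<alpha> * real n) - y x) * y x ^ n)"
        unfolding S_def y_def[of x, symmetric]
        by (subst sum.Plus) (simp_all add: comp_def t1 t2 sum_distrib_left sum_negf del: sum.lessThan_Suc)
      also have "\<dots> = - I.A N * y x ^ Suc N + k N * (exp (\<theta> * x) * (J.A N * y x ^ Suc N))"
        unfolding I.truncated_eigenfunction J.truncated_eigenfunction by simp
      also have "\<bar>\<dots>\<bar> \<le> \<delta> N"
      proof -
        have p1: "y x ^ Suc N \<le> y a ^ Suc N" using y0 ymono[OF x] by (intro power_mono) auto
        have "I.A N * y x ^ Suc N \<le> I.A N * y a ^ Suc N"
          using p1 I.coeff_pos[of N] by (intro mult_left_mono) auto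
        moreover have "0 \<le> I.A N * y x ^ Suc N" using I.coeff_pos[of N] y0[of x] by (intro mult_nonneg_nonneg) auto
        moreover have "k N * (exp (\<theta> * x) * (J.A N * y x ^ Suc N)) \<le> k N * (exp (\<theta> * a) * (J.A N * y a ^ Suc N))"
          using p1 x theta_pos J.coeff_pos[of N] y0[of x] k0[of N]
          by (intro mult_left_mono mult_mono mult_nonneg_nonneg) auto
        moreover have "0 \<le> k N * (exp (\<theta> * x) * (J.A N * y x ^ Suc N))"
          using J.coeff_pos[of N] y0[of x] k0[of N] by (intro mult_nonneg_nonneg) auto
        ultimately show ?thesis unfolding \<delta>_def by linarith
      qed
      finally show "\<bar>\<Sum>i\<in>S. c i * (\<psi> (p i) - q * exp (\<alpha> * x)) * exp (p i * x)\<bar> \<le> \<delta> N" .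
    qed
  qed
  have d_lim: "\<delta> \<longlonglongrightarrow> 0"
  proof -
    have "(\<lambda>N. I.A N * y a ^ N * y a + k N * (exp (\<theta> * a) * (J.A N * y a ^ N * y a)))
      \<longlonglongrightarrow> 0 * y a + \<kappa> * (exp (\<theta> * a) * (0 * y a))"
      by (intro tendsto_intros k_lim summable_LIMSEQ_zero I.summable_real J.summable_real)
    then show ?thesis by (simp add: \<delta>_def[abs_def] mult_ac)
  qed
  define B where "B = F q a + F q a / exp (\<theta> * a) * G q a"
  have L: "(\<lambda>N. \<integral>\<omega>. below_weight a \<alpha> q T \<omega> * (FN N (\<xi> T \<omega>) - k N * GN N (\<xi> T \<omega>)) \<partial>M)
    \<longlonglongrightarrow> (\<integral>\<omega>. below_weight a \<alpha> q T \<omega> * (F q (\<xi> T \<omega>) - \<kappa> * G q (\<xi> T \<omega>)) \<partial>M)"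
  proof (rule integral_dominated_convergence[where w="\<lambda>_. B"])
    have [measurable]: "below_weight a \<alpha> q T \<in> borel_measurable M" "\<xi> T \<in> borel_measurable M"
      using T alpha_pos by (auto intro: below_weight_measurable xi_measurable)
    have [measurable]: "FN N \<in> borel_measurable borel" "GN N \<in> borel_measurable borel" for N
      unfolding FN_def[abs_def] GN_def[abs_def] y_def by measurable
    show "(\<lambda>\<omega>. below_weight a \<alpha> q T \<omega> * (F q (\<xi> T \<omega>) - \<kappa> * G q (\<xi> T \<omega>))) \<in> borel_measurable M"
      "(\<lambda>\<omega>. below_weight a \<alpha> q T \<omega> * (FN N (\<xi> T \<omega>) - k N * GN N (\<xi> T \<omega>))) \<in> borel_measurable M" for N
      by measurable
    show "AE \<omega> in M. (\<lambda>N. below_weight a \<alpha> q T \<omega> * (FN N (\<xi> T \<omega>) - k N * GN N (\<xi> T \<omega>)))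
      \<longlonglongrightarrow> below_weight a \<alpha> q T \<omega> * (F q (\<xi> T \<omega>) - \<kappa> * G q (\<xi> T \<omega>))"
      by (intro AE_I2 tendsto_intros FN_lim GN_lim k_lim)
    show "AE \<omega> in M. norm (below_weight a \<alpha> q T \<omega> * (FN N (\<xi> T \<omega>) - k N * GN N (\<xi> T \<omega>))) \<le> B" for N
      unfolding real_norm_def
    proof (intro AE_I2 below_weight_mult_bound[where g="\<lambda>x. FN N x - k N * GN N x"] q T)
      fix x assume x: "x \<le> a"
      have "FN N x \<le> F q a" using FN0(2)[of N x] F_bounds(2)[OF q x] by simp
      moreover have "k N * GN N x \<le> F q a / exp (\<theta> * a) * G q a"
        using kb[of N] k0[of N] GNle[of N x] G_bounds(2)[OF q x] GN0[of N x] F_bounds(1)[OF q, of a]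
        by (intro mult_mono) auto
      moreover have "0 \<le> k N * GN N x" using k0[of N] GN0[of N x] by simp
      ultimately show "\<bar>FN N x - k N * GN N x\<bar> \<le> B" using FN0(1)[of N x] unfolding B_def by linarith
    qed
  qed auto
  have "(\<lambda>N. \<bar>(\<integral>\<omega>. below_weight a \<alpha> q T \<omega> * (FN N (\<xi> T \<omega>) - k N * GN N (\<xi> T \<omega>)) \<partial>M)
      - (FN N 0 - k N * GN N 0)\<bar>) \<longlonglongrightarrow>
     \<bar>(\<integral>\<omega>. below_weight a \<alpha> q T \<omega> * (F q (\<xi> T \<omega>) - \<kappa> * G q (\<xi> T \<omega>)) \<partial>M) - (F q 0 - \<kappa> * G q 0)\<bar>"
    by (intro tendsto_intros L FN_lim GN_lim k_lim)
  moreover have "(\<lambda>N. T * \<delta> N) \<longlonglongrightarrow> T * 0" by (intro tendsto_intros d_lim)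
  ultimately have "\<bar>(\<integral>\<omega>. below_weight a \<alpha> q T \<omega> * (F q (\<xi> T \<omega>) - \<kappa> * G q (\<xi> T \<omega>)) \<partial>M) - (F q 0 - \<kappa> * G q 0)\<bar> \<le> T * 0"
    using step by (intro LIMSEQ_le) auto
  then show ?thesis by simp
qed

lemma laplace_below_level_eq:
  assumes q: "q \<ge> 0" and a: "a \<ge> 0"
  shows "(\<integral>\<omega>. (if \<forall>s\<ge>0. \<xi> s \<omega> \<le> a then 1 else 0) * exp (- q * total \<omega>) \<partial>M)
    = F q 0 - F q a / G q a * G q 0"
proof (rule laplace_below_level[OF q])
  let ?\<kappa> = "F q a / G q a"
  have \<kappa>: "?\<kappa> \<ge> 0" using F_bounds(1)[OF q, of a] G_pos[OF q, of a] by simp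
  show "(\<lambda>x. F q x - ?\<kappa> * G q x) \<in> borel_measurable borel" by measurable
  show "\<bar>F q x - ?\<kappa> * G q x\<bar> \<le> F q a + ?\<kappa> * G q a" if "x \<le> a" for x
  proof -
    have "0 \<le> ?\<kappa> * G q x" "?\<kappa> * G q x \<le> ?\<kappa> * G q a"
      using \<kappa> G_pos[OF q, of x] G_bounds(2)[OF q that] by (auto intro: mult_left_mono mult_nonneg_nonneg simp del: times_divide_eq_left)
    then show ?thesis using F_bounds(1)[OF q, of x] F_bounds(2)[OF q that] by linarith
  qed
  show "AE \<omega> in M. (\<lambda>n. F q (\<xi> (real (Suc n)) \<omega>) - ?\<kappa> * G q (\<xi> (real (Suc n)) \<omega>)) \<longlonglongrightarrow> 1"
    using AE_drift_to_minus_infinity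
  proof eventually_elim
    case (elim \<omega>)
    have e: "(\<lambda>n. exp (\<alpha> * \<xi> (real n) \<omega>)) \<longlonglongrightarrow> 0" "(\<lambda>n. exp (\<theta> * \<xi> (real n) \<omega>)) \<longlonglongrightarrow> 0"
      using elim alpha_pos theta_pos by auto
    have y: "(\<lambda>n. q * exp (\<alpha> * \<xi> (real n) \<omega>)) \<longlonglongrightarrow> 0" using tendsto_mult[OF tendsto_const e(1), of q] by simp
    have "(\<lambda>n. F q (\<xi> (real n) \<omega>) - ?\<kappa> * G q (\<xi> (real n) \<omega>))
      \<longlonglongrightarrow> I_series \<alpha> \<psi> 0 - ?\<kappa> * (0 * I_series \<alpha> (shifted_exponent \<psi> \<theta>) 0)"
      unfolding F_def[of q "\<xi> _ _"] G_def[of q "\<xi> _ _"]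
      by (intro tendsto_intros isCont_tendsto_compose[OF I.I_series_isCont y]
          isCont_tendsto_compose[OF J.I_series_isCont y] e)
    then have "(\<lambda>n. F q (\<xi> (real n) \<omega>) - ?\<kappa> * G q (\<xi> (real n) \<omega>)) \<longlonglongrightarrow> 1" by simp
    from LIMSEQ_Suc[OF this] show ?case .
  qed
  show "(\<integral>\<omega>. below_weight a \<alpha> q (real (Suc n)) \<omega> *
      (F q (\<xi> (real (Suc n)) \<omega>) - ?\<kappa> * G q (\<xi> (real (Suc n)) \<omega>)) \<partial>M) = F q 0 - ?\<kappa> * G q 0" for n
    by (rule killed_expectation[OF q a]) simp
qed

lemma series_ratio_limit:
  assumes q: "q \<ge> 0"
  shows "((\<lambda>a. F q a / G q a) \<longlongrightarrow> (F q 0 - (\<integral>\<omega>. exp (- q * total \<omega>) \<partial>M)) / G q 0) at_top"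
proof -
  let ?L = "\<lambda>a. \<integral>\<omega>. (if \<forall>s\<ge>0. \<xi> s \<omega> \<le> a then 1 else 0) * exp (- q * total \<omega>) \<partial>M"
  have "((\<lambda>a. (F q 0 - ?L a) / G q 0) \<longlongrightarrow> (F q 0 - (\<integral>\<omega>. exp (- q * total \<omega>) \<partial>M)) / G q 0) at_top"
    using G_pos[OF q, of 0] by (intro tendsto_intros laplace_below_level_tendsto q) simp
  moreover have "\<forall>\<^sub>F a in at_top. (F q 0 - ?L a) / G q 0 = F q a / G q a"
    using eventually_ge_at_top[of 0]
  proof eventually_elim
    case (elim a)
    then show ?case using G_pos[OF q, of 0] laplace_below_level_eq[OF q elim] by simp
  qed
  ultimately show ?thesis by (rule Lim_transform_eventually)
qed

text \<open>The constant $C_\theta$, as the limit of $F/G$ for $q = 1$.\<close>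
definition limit_constant :: real where
  "limit_constant = (F 1 0 - (\<integral>\<omega>. exp (- total \<omega>) \<partial>M)) / G 1 0"

lemma integrable_exp_total: "q \<ge> 0 \<Longrightarrow> integrable M (\<lambda>\<omega>. exp (- q * total \<omega>))"
  by (rule integrable_const_bound[where B=1]) (auto intro!: AE_I2 simp: total_nonneg)

lemma limit_constant_pos: "limit_constant > 0"
proof -
  have "(\<integral>\<omega>. exp (- total \<omega>) \<partial>M) \<le> (\<integral>\<omega>. 1 \<partial>M)"
    using integrable_exp_total[of 1] total_nonneg by (intro integral_mono) auto
  moreover have "F 1 0 > 1" unfolding F_def by (rule I.I_series_gt_1) simp
  ultimately show ?thesis using G_pos[of 1 0] by (simp add: limit_constant_def prob_space)
qed

lemma series_quotient_tendsto:
  "((\<lambda>x. I_series \<alpha> \<psi> (x powr \<alpha>) / (x powr \<theta> * I_series \<alpha> (shifted_exponent \<psi> \<theta>) (x powr \<alpha>)))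
     \<longlongrightarrow> limit_constant) at_top"
proof -
  have "((\<lambda>x. F 1 (ln x) / G 1 (ln x)) \<longlongrightarrow> limit_constant) at_top"
    using filterlim_compose[OF series_ratio_limit[of 1] ln_at_top] by (simp add: limit_constant_def)
  moreover have "\<forall>\<^sub>F x in at_top. F 1 (ln x) / G 1 (ln x) =
     I_series \<alpha> \<psi> (x powr \<alpha>) / (x powr \<theta> * I_series \<alpha> (shifted_exponent \<psi> \<theta>) (x powr \<alpha>))"
    using eventually_gt_at_top[of 0]
    by eventually_elim (simp add: F_def G_def powr_def)
  ultimately show ?thesis by (rule Lim_transform_eventually)
qed

text \<open>Shifting the space variable by $\ln q/\alpha$ turns the quotient for \<open>q\<close> into the one for 1, up to
  the factor $q^{\theta/\alpha}$.\<close>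
lemma laplace_transform_total:
  assumes q: "q \<ge> 0"
  shows "(\<integral>\<omega>. exp (- q * total \<omega>) \<partial>M) = N_fun \<alpha> \<psi> \<theta> limit_constant q"
proof (cases "q = 0")
  case True
  then show ?thesis by (simp add: N_fun_def prob_space)
next
  case False
  then have q0: "q > 0" using q by simp
  let ?c = "ln q / \<alpha>"
  have eq: "F q a / G q a = q powr (\<theta> / \<alpha>) * (F 1 (a + ?c) / G 1 (a + ?c))" for a
  proof -
    have 1: "1 * exp (\<alpha> * (a + ?c)) = q * exp (\<alpha> * a)"
      using alpha_pos q0 by (simp add: distrib_left exp_add)
    have 2: "exp (\<theta> * (a + ?c)) = q powr (\<theta> / \<alpha>) * exp (\<theta> * a)"
      using q0 by (simp add: distrib_left exp_add powr_def mult_ac)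
    show ?thesis unfolding F_def G_def 1 2 using q0 by simp
  qed
  have "filterlim (\<lambda>a. a + ?c) at_top at_top"
    by (subst add.commute) (rule filterlim_tendsto_add_at_top[OF tendsto_const filterlim_ident])
  from filterlim_compose[OF series_ratio_limit[of 1] this]
  have "((\<lambda>a. q powr (\<theta> / \<alpha>) * (F 1 (a + ?c) / G 1 (a + ?c))) \<longlongrightarrow> q powr (\<theta> / \<alpha>) * limit_constant) at_top"
    by (intro tendsto_mult tendsto_const) (simp add: limit_constant_def)
  then have "((\<lambda>a. F q a / G q a) \<longlongrightarrow> q powr (\<theta> / \<alpha>) * limit_constant) at_top" unfolding eq .
  with series_ratio_limit[OF q] have "(F q 0 - (\<integral>\<omega>. exp (- q * total \<omega>) \<partial>M)) / G q 0 = q powr (\<theta> / \<alpha>) * limit_constant"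
    by (intro tendsto_unique[of at_top]) auto
  then have "(\<integral>\<omega>. exp (- q * total \<omega>) \<partial>M) = F q 0 - limit_constant * q powr (\<theta> / \<alpha>) * G q 0"
    using G_pos[OF q, of 0] by (simp add: field_simps)
  then show ?thesis by (simp add: N_fun_def F_def G_def)
qed

lemma N_fun_strict_antimono: "strict_antimono_on {0..} (N_fun \<alpha> \<psi> \<theta> limit_constant :: real \<Rightarrow> real)"
proof (rule monotone_onI)
  fix p q :: real assume pq: "p \<in> {0..}" "q \<in> {0..}" "p < q"
  have "(\<integral>\<omega>. exp (- q * total \<omega>) \<partial>M) < (\<integral>\<omega>. exp (- p * total \<omega>) \<partial>M)"
  proof (rule integral_less_AE_space)
    show "integrable M (\<lambda>\<omega>. exp (- q * total \<omega>))" "integrable M (\<lambda>\<omega>. exp (- p * total \<omega>))"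
      using pq integrable_exp_total[of q] integrable_exp_total[of p] by simp_all
    show "AE \<omega> in M. exp (- q * total \<omega>) < exp (- p * total \<omega>)"
      using AE_total_pos by eventually_elim (use pq in auto)
    show "emeasure M (space M) \<noteq> 0" by (simp add: emeasure_space_1)
  qed
  then show "N_fun \<alpha> \<psi> \<theta> limit_constant q < N_fun \<alpha> \<psi> \<theta> limit_constant p"
    using pq by (simp add: laplace_transform_total[symmetric])
qed

lemma N_fun_analytic: "(N_fun \<alpha> \<psi> \<theta> c :: complex \<Rightarrow> complex) analytic_on {z. Re z > 0}"
proof -
  have op: "open {z. Re z > 0}" by (simp add: open_halfspace_Re_gt)
  have h: "(I_series \<alpha> \<psi> :: complex \<Rightarrow> complex) holomorphic_on S"
    "(I_series \<alpha> (shifted_exponent \<psi> \<theta>) :: complex \<Rightarrow> complex) holomorphic_on S" for S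
    unfolding holomorphic_on_def field_differentiable_def
    using I.I_series_has_field_derivative J.I_series_has_field_derivative
    by (meson has_field_derivative_at_within)+
  have "(\<lambda>z::complex. N_fun \<alpha> \<psi> \<theta> c z) holomorphic_on {z. Re z > 0}"
    unfolding N_fun_def
    by (intro holomorphic_intros h) (auto simp: complex_nonpos_Reals_iff)
  then show ?thesis using op by (simp add: analytic_on_open)
qed

end

section \<open>The value of the constant\<close>

context series_exponent
begin

lemma summable_bounded_mult:
  fixes z :: real
  assumes z: "z \<ge> 0" and d: "\<And>n. \<bar>d n\<bar> \<le> K"
  shows "summable (\<lambda>n. d n * (A n * z ^ n))"
proof (rule summable_comparison_test')
  show "summable (\<lambda>n. K * (A n * z ^ n))" by (intro summable_mult summable_real)
  show "norm (d n * (A n * z ^ n)) \<le> K * (A n * z ^ n)" if "n \<ge> 0" for n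
    unfolding real_norm_def abs_mult using d[of n] term_nonneg[OF z, of n] coeff_pos[of n] z
    by (intro mult_mono) (auto simp: abs_mult)
qed

lemma term_over_I_series_tendsto_0: "((\<lambda>z::real. A n * z ^ n / I_series \<alpha> \<phi> z) \<longlongrightarrow> 0) at_top"
proof (rule tendsto_sandwich[OF _ _ tendsto_const])
  show "\<forall>\<^sub>F z::real in at_top. 0 \<le> A n * z ^ n / I_series \<alpha> \<phi> z"
    using eventually_ge_at_top[of 0]
  proof eventually_elim
    case (elim z)
    then show ?case using term_nonneg[of z n] I_series_ge_1[of z] by (intro divide_nonneg_nonneg) auto
  qed
  show "\<forall>\<^sub>F z::real in at_top. A n * z ^ n / I_series \<alpha> \<phi> z \<le> A n / A (Suc n) * inverse z"
    using eventually_gt_at_top[of 0]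
  proof eventually_elim
    case (elim z)
    have "A n * z ^ n / I_series \<alpha> \<phi> z \<le> A n * z ^ n / (A (Suc n) * z ^ Suc n)"
      using elim term_nonneg[of z n] coeff_pos[of "Suc n"] I_series_ge_1[of z] I_series_ge_term[of z "Suc n"]
      by (intro divide_left_mono mult_pos_pos) auto
    also have "\<dots> = A n / A (Suc n) * inverse z" using elim coeff_pos[of "Suc n"] by (simp add: field_simps)
    finally show ?case .
  qed
  have "((\<lambda>z::real. A n / A (Suc n) * inverse z) \<longlongrightarrow> A n / A (Suc n) * 0) at_top"
    by (intro tendsto_mult tendsto_const tendsto_inverse_0_at_top filterlim_ident)
  then show "((\<lambda>z::real. A n / A (Suc n) * inverse z) \<longlongrightarrow> 0) at_top" by simp
qed

text \<open>Since every fixed term is negligible against the series, averages with the weights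
  \<open>A n * z ^ n\<close> are a regular summation method as \<open>z\<close> tends to infinity.\<close>
lemma weighted_mean_tendsto:
  assumes d: "d \<longlonglongrightarrow> c"
  shows "((\<lambda>z::real. (\<Sum>n. d n * (A n * z ^ n)) / I_series \<alpha> \<phi> z) \<longlongrightarrow> c) at_top"
proof (rule tendstoI)
  fix e :: real assume e: "e > 0"
  have "Bseq d" using d by (intro convergent_imp_Bseq) (auto simp: convergent_def)
  then obtain K where K: "\<And>n. \<bar>d n\<bar> \<le> K" by (auto simp: Bseq_def)
  obtain N where N: "\<And>n. n \<ge> N \<Longrightarrow> \<bar>d n - c\<bar> < e / 2"
    using LIMSEQ_D[OF d, of "e / 2"] e by auto
  have "((\<lambda>z::real. \<Sum>n<N. \<bar>d n - c\<bar> * (A n * z ^ n / I_series \<alpha> \<phi> z)) \<longlongrightarrow> (\<Sum>n<N. \<bar>d n - c\<bar> * 0)) at_top"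
    by (intro tendsto_sum tendsto_mult tendsto_const term_over_I_series_tendsto_0)
  then have "\<forall>\<^sub>F z::real in at_top. (\<Sum>n<N. \<bar>d n - c\<bar> * (A n * z ^ n / I_series \<alpha> \<phi> z)) < e / 2"
    using e by (intro order_tendstoD(2)) auto
  then show "\<forall>\<^sub>F z::real in at_top. dist ((\<Sum>n. d n * (A n * z ^ n)) / I_series \<alpha> \<phi> z) c < e"
    using eventually_ge_at_top[of 0]
  proof eventually_elim
    case (elim z)
    let ?I = "I_series \<alpha> \<phi> z"
    have I1: "?I \<ge> 1" using I_series_ge_1 elim by simp
    define g where "g n = (if n < N then \<bar>d n - c\<bar> * (A n * z ^ n) else 0)" for n
    have sg: "g sums (\<Sum>n<N. \<bar>d n - c\<bar> * (A n * z ^ n))"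
      unfolding g_def using sums_If_finite_set[of "{..<N}" "\<lambda>n. \<bar>d n - c\<bar> * (A n * z ^ n)"] by simp
    have db: "\<bar>d n - c\<bar> \<le> K + \<bar>c\<bar>" for n using K[of n] by linarith
    have s1: "summable (\<lambda>n. d n * (A n * z ^ n))" by (rule summable_bounded_mult[OF _ K]) (use elim in auto)
    have s2: "summable (\<lambda>n. (d n - c) * (A n * z ^ n))" by (rule summable_bounded_mult[OF _ db]) (use elim in auto)
    have s3: "summable (\<lambda>n. \<bar>d n - c\<bar> * (A n * z ^ n))"
      using elim db by (intro summable_bounded_mult[where K="K + \<bar>c\<bar>"]) auto
    have "(\<Sum>n. d n * (A n * z ^ n)) - c * ?I = (\<Sum>n. (d n - c) * (A n * z ^ n))"
      unfolding I_series_real left_diff_distrib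
      using suminf_diff[OF s1 summable_mult[OF summable_real, of c]] by (simp add: suminf_mult summable_real)
    also have "\<bar>\<dots>\<bar> \<le> (\<Sum>n. \<bar>d n - c\<bar> * (A n * z ^ n))"
    proof -
      have eq: "\<bar>(d n - c) * (A n * z ^ n)\<bar> = \<bar>d n - c\<bar> * (A n * z ^ n)" for n
        unfolding abs_mult[of "d n - c"] using term_nonneg[of z n] elim by simp
      show ?thesis using summable_rabs[of "\<lambda>n. (d n - c) * (A n * z ^ n)"] s3 unfolding eq by simp
    qed
    also have "\<dots> \<le> (\<Sum>n. g n + e / 2 * (A n * z ^ n))"
    proof (rule suminf_le[OF _ s3])
      show "\<bar>d n - c\<bar> * (A n * z ^ n) \<le> g n + e / 2 * (A n * z ^ n)" for n
      proof (cases "n < N")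
        case True
        then show ?thesis using e elim term_nonneg[of z n] by (simp add: g_def)
      next
        case False
        then have "\<bar>d n - c\<bar> * (A n * z ^ n) \<le> e / 2 * (A n * z ^ n)"
          using N[of n] term_nonneg[of z n] elim by (intro mult_right_mono) auto
        then show ?thesis using False by (simp add: g_def)
      qed
      show "summable (\<lambda>n. g n + e / 2 * (A n * z ^ n))"
        using sg by (intro summable_add summable_mult summable_real) (auto simp: sums_iff)
    qed
    also have "\<dots> = (\<Sum>n<N. \<bar>d n - c\<bar> * (A n * z ^ n)) + e / 2 * ?I"
    proof -
      have sI: "(\<lambda>n. A n * z ^ n) sums ?I" unfolding I_series_real by (rule summable_sums[OF summable_real])
      have "(\<lambda>n. g n + e / 2 * (A n * z ^ n)) sums ((\<Sum>n<N. \<bar>d n - c\<bar> * (A n * z ^ n)) + e / 2 * ?I)"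
        by (rule sums_add[OF sg sums_mult[OF sI]])
      then show ?thesis by (rule sums_unique[symmetric])
    qed
    finally have le: "\<bar>(\<Sum>n. d n * (A n * z ^ n)) - c * ?I\<bar> \<le> (\<Sum>n<N. \<bar>d n - c\<bar> * (A n * z ^ n)) + e / 2 * ?I" .
    have "\<bar>(\<Sum>n. d n * (A n * z ^ n)) / ?I - c\<bar> = \<bar>(\<Sum>n. d n * (A n * z ^ n)) - c * ?I\<bar> / ?I"
    proof -
      have "(\<Sum>n. d n * (A n * z ^ n)) / ?I - c = ((\<Sum>n. d n * (A n * z ^ n)) - c * ?I) / ?I"
        using I1 by (simp add: diff_divide_distrib)
      then show ?thesis using I1 by simp
    qed
    also have "\<dots> \<le> ((\<Sum>n<N. \<bar>d n - c\<bar> * (A n * z ^ n)) + e / 2 * ?I) / ?I"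
      using le I1 by (intro divide_right_mono) auto
    also have "\<dots> = (\<Sum>n<N. \<bar>d n - c\<bar> * (A n * z ^ n / ?I)) + e / 2"
      using I1 by (simp add: add_divide_distrib sum_divide_distrib)
    also have "\<dots> < e" using elim by simp
    finally show ?case by (simp add: dist_real_def)
  qed
qed

end

lemma powr_tangent_upper: "y \<ge> 0 \<Longrightarrow> 0 \<le> t \<Longrightarrow> t \<le> 1 \<Longrightarrow> y powr t \<le> 1 + t * (y - 1)" for y t :: real
proof (cases "y = 0 \<or> t = 0 \<or> t = 1")
  case False
  assume "y \<ge> 0" "0 \<le> t" "t \<le> 1"
  then show ?thesis using exp_mult_le_strict(1)[of t "ln y"] False by (simp add: powr_def algebra_simps)
qed auto

lemma powr_tangent_lower: "1 - t * (y - 1) \<le> y powr (- t)" if "y > 0" "t \<ge> 0" for y t :: real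
proof -
  have "1 - t * (y - 1) \<le> 1 - t * ln y"
    using ln_le_minus_one[OF that(1)] that(2) by (simp add: mult_left_mono)
  also have "\<dots> \<le> exp (- t * ln y)" using exp_ge_add_one_self[of "- t * ln y"] by simp
  finally show ?thesis using that by (simp add: powr_def)
qed

lemma prod_ratio_pochhammer:
  fixes t :: real
  assumes "t > 0"
  shows "(\<Prod>j<n. real (Suc j) / (real (Suc j) + t)) = t * fact n / pochhammer t (Suc n)"
proof (induction n)
  case 0
  then show ?case using assms by simp
next
  case (Suc n)
  show ?case
    unfolding prod.lessThan_Suc Suc pochhammer_Suc[of t "Suc n"] fact_Suc
    by (simp add: mult_ac add_ac del: of_nat_Suc pochhammer_Suc)
qed

context negative_drift
begin

text \<open>The exponent $\theta_\alpha$.\<close>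
definition \<tau> :: real where "\<tau> = \<theta> / \<alpha>"

lemma tau: "0 < \<tau>" "\<tau> < 1" "\<alpha> * \<tau> = \<theta>"
  using theta_pos theta_less alpha_pos by (auto simp: \<tau>_def)

abbreviation P :: "nat \<Rightarrow> real" where "P n \<equiv> \<psi> (\<alpha> * real n)"

text \<open>Its limit is $\lim_n \psi(\alpha n)^{-\tau} \prod_{k \le n} \psi(\alpha k + \theta)/\psi(\alpha k)$, written
  with $\psi(\alpha(n+1))$ to make the sequence monotone.\<close>
definition ratio :: "nat \<Rightarrow> real" where
  "ratio n = I.A n / J.A n * P (Suc n) powr (- \<tau>)"

lemma coeff_ratio_Suc: "I.A (Suc n) / J.A (Suc n) = I.A n / J.A n * (\<psi> (\<alpha> * real (Suc n) + \<theta>) / P (Suc n))"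
  unfolding I.coeff_Suc' J.coeff_Suc' shifted_exponent_eq by simp

text \<open>Log-concavity at $\alpha(n+1) < \alpha(n+1) + \theta < \alpha(n+2)$ shows that the logarithm \<open>r\<close> increases. At
  $\alpha(n+1) < \alpha(n+2) < \alpha(n+2) + \theta$ it shows that the same expression \<open>u\<close> with the previous value
  of \<open>\<psi>\<close> decreases; and \<open>r (Suc n)\<close> is at most \<open>u n\<close>.\<close>
lemma ratio_converges: "\<exists>c>0. ratio \<longlonglongrightarrow> c"
proof -
  define f where "f u = ln (\<psi> u)" for u
  have cc: "concave_on {\<theta><..} f"
    using concave_on_ln_exponent[OF levy_khintchine theta_pos theta_root psi_pos] by (simp add: f_def[abs_def])
  define E where "E n = ln (I.A n / J.A n)" for n
  have E_Suc: "E (Suc n) = E n + (f (\<alpha> * real (Suc n) + \<theta>) - f (\<alpha> * real (Suc n)))" for n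
  proof -
    have "\<psi> (\<alpha> * real (Suc n) + \<theta>) > 0" by (rule psi_pos) (use alpha_pos in simp)
    moreover have "P (Suc n) > 0" by (rule I.phi_pos) simp
    moreover have "I.A n / J.A n > 0" using I.coeff_pos J.coeff_pos by simp
    moreover have "ln (x * (y / z)) = ln x + (ln y - ln z)" if "x > 0" "y > 0" "z > 0" for x y z :: real
      using that by (simp add: ln_mult_pos ln_divide_pos)
    ultimately show ?thesis unfolding E_def coeff_ratio_Suc f_def by blast
  qed
  define r where "r n = E n - \<tau> * f (\<alpha> * real (Suc n))" for n
  have gt: "\<theta> < \<alpha> * real (Suc n)" for n
  proof -
    have "\<alpha> * 1 \<le> \<alpha> * real (Suc n)" using alpha_pos by (intro mult_left_mono) auto
    then show ?thesis using theta_less by linarith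
  qed
  have ratio_r: "ratio n = exp (r n)" for n
    using I.coeff_pos[of n] J.coeff_pos[of n] I.phi_pos[of "Suc n"]
    by (simp add: ratio_def r_def E_def f_def exp_diff powr_def exp_minus field_simps del: of_nat_Suc)
  have inc: "r n \<le> r (Suc n)" for n
  proof -
    have "(1 - \<tau>) * f (\<alpha> * real (Suc n)) + \<tau> * f (\<alpha> * real (Suc (Suc n)))
       \<le> f ((1 - \<tau>) *\<^sub>R (\<alpha> * real (Suc n)) + \<tau> *\<^sub>R (\<alpha> * real (Suc (Suc n))))"
    proof (rule concave_onD[OF cc])
      show "0 \<le> \<tau>" "\<tau> \<le> 1" using tau by auto
    qed (simp_all only: greaterThan_iff gt)
    also have "(1 - \<tau>) *\<^sub>R (\<alpha> * real (Suc n)) + \<tau> *\<^sub>R (\<alpha> * real (Suc (Suc n))) = \<alpha> * real (Suc n) + \<theta>"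
      using tau by (simp add: algebra_simps)
    finally show ?thesis by (simp add: r_def E_Suc algebra_simps del: of_nat_Suc)
  qed
  define u where "u n = E (Suc n) - \<tau> * f (\<alpha> * real (Suc n))" for n
  have dec: "u (Suc n) \<le> u n" for n
  proof -
    define s where "s = 1 / (1 + \<tau>)"
    have s: "0 \<le> s" "s \<le> 1" "s * (1 + \<tau>) = 1" using tau by (auto simp: s_def)
    have "(1 - s) * f (\<alpha> * real (Suc n)) + s * f (\<alpha> * real (Suc (Suc n)) + \<theta>)
       \<le> f ((1 - s) *\<^sub>R (\<alpha> * real (Suc n)) + s *\<^sub>R (\<alpha> * real (Suc (Suc n)) + \<theta>))"
    proof (rule concave_onD[OF cc])
      show "\<alpha> * real (Suc (Suc n)) + \<theta> \<in> {\<theta><..}"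
        unfolding greaterThan_iff using gt[of "Suc n"] theta_pos by linarith
    qed (simp_all only: greaterThan_iff gt s)
    also have "(1 - s) *\<^sub>R (\<alpha> * real (Suc n)) + s *\<^sub>R (\<alpha> * real (Suc (Suc n)) + \<theta>)
        = \<alpha> * real (Suc n) + \<alpha> * (s * (1 + \<tau>))"
      by (simp add: algebra_simps tau(3))
    also have "\<dots> = \<alpha> * real (Suc (Suc n))" unfolding s(3) by (simp add: algebra_simps)
    finally have "(1 - s) * f (\<alpha> * real (Suc n)) + s * f (\<alpha> * real (Suc (Suc n)) + \<theta>) \<le> f (\<alpha> * real (Suc (Suc n)))" .
    moreover have "\<tau> * x + w \<le> (1 + \<tau>) * y" if "(1 - s) * x + s * w \<le> y" for x y w
    proof -
      have "\<tau> * x + w = (1 + \<tau>) * x - s * (1 + \<tau>) * x + s * (1 + \<tau>) * w"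
        unfolding s(3) by (simp add: algebra_simps)
      also have "\<dots> = (1 + \<tau>) * ((1 - s) * x + s * w)" by (simp add: algebra_simps)
      also have "\<dots> \<le> (1 + \<tau>) * y" using that tau by (intro mult_left_mono) auto
      finally show ?thesis .
    qed
    ultimately have "\<tau> * f (\<alpha> * real (Suc n)) + f (\<alpha> * real (Suc (Suc n)) + \<theta>)
        \<le> (1 + \<tau>) * f (\<alpha> * real (Suc (Suc n)))" by blast
    then show ?thesis by (simp add: u_def E_Suc[of "Suc n"] algebra_simps del: of_nat_Suc)
  qed
  have ub: "r (Suc n) \<le> u 0" for n
  proof -
    have "u n \<le> u 0" by (rule lift_Suc_antimono_le[of u, OF dec]) simp
    moreover have "f (\<alpha> * real (Suc n)) \<le> f (\<alpha> * real (Suc (Suc n)))"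
      unfolding f_def using psi_strict_mono[OF gt[of n], of "\<alpha> * real (Suc (Suc n))"] psi_pos[OF gt[of n]] alpha_pos
      by (intro ln_mono) auto
    then have "\<tau> * f (\<alpha> * real (Suc n)) \<le> \<tau> * f (\<alpha> * real (Suc (Suc n)))"
      using tau by (intro mult_left_mono) auto
    ultimately show ?thesis by (simp add: r_def u_def del: of_nat_Suc)
  qed
  have "\<forall>n. r n \<le> u 0" by (intro allI order_trans[OF inc ub])
  with incseq_SucI[of r, OF inc] obtain L where "r \<longlonglongrightarrow> L" by (rule incseq_convergent)
  then have "ratio \<longlonglongrightarrow> exp L" unfolding ratio_r[abs_def] by (intro tendsto_intros)
  then show ?thesis by (intro exI[of _ "exp L"]) simp
qed

text \<open>With \<open>K\<close> the series whose coefficients are \<open>ratio n * J.A n\<close>, that is $a_n \psi(\alpha(n+1))^{-\tau}$,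
  the quotient splits into \<open>K z / ?J z\<close>, which tends to \<open>c\<close>, and the inverse of \<open>z powr \<tau> * K z / ?I z\<close>,
  the mean of $(z/\psi(\alpha(n+1)))^\tau$.\<close>
lemma quotient_limit_regular:
  assumes reg: "(\<lambda>n. P (Suc (Suc n)) / P (Suc n)) \<longlonglongrightarrow> 1" and c: "ratio \<longlonglongrightarrow> c"
  shows "((\<lambda>z. I_series \<alpha> \<psi> z / (z powr \<tau> * I_series \<alpha> (shifted_exponent \<psi> \<theta>) z)) \<longlongrightarrow> c) at_top"
proof -
  let ?I = "\<lambda>z::real. I_series \<alpha> \<psi> z" and ?J = "\<lambda>z::real. I_series \<alpha> (shifted_exponent \<psi> \<theta>) z"
  define K where "K z = (\<Sum>n. ratio n * (J.A n * z ^ n))" for z :: real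
  define rho where "rho n = P (Suc (Suc n)) / P (Suc n)" for n
  define W where "W z = (\<Sum>n. rho n * (I.A n * z ^ n))" for z :: real
  have KJ: "((\<lambda>z. K z / ?J z) \<longlongrightarrow> c) at_top"
    unfolding K_def by (rule J.weighted_mean_tendsto[OF c])
  have WI: "((\<lambda>z. W z / ?I z) \<longlongrightarrow> 1) at_top"
    unfolding W_def by (rule I.weighted_mean_tendsto) (use reg in \<open>simp add: rho_def[abs_def]\<close>)
  have "Bseq ratio" "Bseq rho" using c reg
    by (auto intro!: convergent_imp_Bseq simp: convergent_def rho_def[abs_def])
  then obtain Kr Kw where Kr: "\<And>n. \<bar>ratio n\<bar> \<le> Kr" and Kw: "\<And>n. \<bar>rho n\<bar> \<le> Kw"
    unfolding Bseq_def by (metis real_norm_def)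
  have Ppos: "P (Suc n) > 0" for n by (rule I.phi_pos) simp
  have termwise: "z powr \<tau> * (ratio n * (J.A n * z ^ n)) = I.A n * z ^ n * (z / P (Suc n)) powr \<tau>" if "z > 0" for z n
    using that Ppos[of n] J.coeff_pos[of n] by (simp add: ratio_def powr_divide powr_minus field_simps del: of_nat_Suc)
  have bounds: "z powr \<tau> * K z \<le> ?I z" "?I z * (1 + \<tau>) - \<tau> * (W z + P 1 / z) \<le> z powr \<tau> * K z"
    if z: "z > 0" for z
  proof -
    have sK: "(\<lambda>n. I.A n * z ^ n * (z / P (Suc n)) powr \<tau>) sums (z powr \<tau> * K z)"
      unfolding K_def using z
      by (subst termwise[symmetric, OF z]) (intro sums_mult summable_sums J.summable_bounded_mult[OF _ Kr], simp)
    have sI: "(\<lambda>n. I.A n * z ^ n) sums ?I z"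
      unfolding I.I_series_real by (intro summable_sums I.summable_real)
    \<comment> \<open>The mean of \<open>z / P (Suc n)\<close> telescopes, up to the first term.\<close>
    have shift: "I.A n * z ^ n * (z / P (Suc n)) = I.A (Suc n) * z ^ Suc n" for n
      unfolding I.coeff_Suc' using Ppos[of n] by simp
    have sI1: "(\<lambda>n. I.A n * z ^ n * (z / P (Suc n))) sums (?I z - 1)"
      unfolding shift using sI by (subst sums_Suc_iff) simp
    have upper_sums: "(\<lambda>n. (1 - \<tau>) * (I.A n * z ^ n) + \<tau> * (I.A n * z ^ n * (z / P (Suc n))))
       sums ((1 - \<tau>) * ?I z + \<tau> * (?I z - 1))"
      by (intro sums_add sums_mult sI sI1)
    have upper: "I.A n * z ^ n * (z / P (Suc n)) powr \<tau>
       \<le> (1 - \<tau>) * (I.A n * z ^ n) + \<tau> * (I.A n * z ^ n * (z / P (Suc n)))" for n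
    proof -
      have "(z / P (Suc n)) powr \<tau> \<le> 1 + \<tau> * (z / P (Suc n) - 1)"
        using z Ppos[of n] tau by (intro powr_tangent_upper) auto
      then have "I.A n * z ^ n * (z / P (Suc n)) powr \<tau> \<le> I.A n * z ^ n * (1 + \<tau> * (z / P (Suc n) - 1))"
        using z by (intro mult_left_mono I.term_nonneg) auto
      then show ?thesis by (simp add: algebra_simps)
    qed
    have "z powr \<tau> * K z \<le> (1 - \<tau>) * ?I z + \<tau> * (?I z - 1)"
      by (rule sums_le[OF upper sK upper_sums])
    then show "z powr \<tau> * K z \<le> ?I z" using tau by (simp add: algebra_simps)
    have sW: "(\<lambda>n. rho n * (I.A n * z ^ n)) sums W z"
      unfolding W_def using z by (intro summable_sums I.summable_bounded_mult[OF _ Kw]) simp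
    \<comment> \<open>The mean of the reciprocal is a mean of \<open>rho\<close>, plus the term for \<open>n = 0\<close>.\<close>
    have shift': "I.A (Suc n) * z ^ Suc n * (P (Suc (Suc n)) / z) = rho n * (I.A n * z ^ n)" for n
      unfolding I.coeff_Suc' rho_def using z by (simp del: of_nat_Suc)
    have sW1: "(\<lambda>n. I.A n * z ^ n * (P (Suc n) / z)) sums (W z + P 1 / z)"
      using sW[folded shift'] by (subst (asm) sums_Suc_iff) simp
    have lower_sums: "(\<lambda>n. (1 + \<tau>) * (I.A n * z ^ n) - \<tau> * (I.A n * z ^ n * (P (Suc n) / z)))
       sums ((1 + \<tau>) * ?I z - \<tau> * (W z + P 1 / z))"
      by (intro sums_diff sums_mult sI sW1)
    have lower: "(1 + \<tau>) * (I.A n * z ^ n) - \<tau> * (I.A n * z ^ n * (P (Suc n) / z))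
       \<le> I.A n * z ^ n * (z / P (Suc n)) powr \<tau>" for n
    proof -
      have "1 - \<tau> * (P (Suc n) / z - 1) \<le> (P (Suc n) / z) powr (- \<tau>)"
        using z Ppos[of n] tau by (intro powr_tangent_lower) auto
      also have "\<dots> = (z / P (Suc n)) powr \<tau>"
        using z Ppos[of n] by (simp add: powr_minus powr_divide del: of_nat_Suc)
      finally have "I.A n * z ^ n * (1 - \<tau> * (P (Suc n) / z - 1)) \<le> I.A n * z ^ n * (z / P (Suc n)) powr \<tau>"
        using z by (intro mult_left_mono I.term_nonneg) auto
      then show ?thesis by (simp add: algebra_simps)
    qed
    have "(1 + \<tau>) * ?I z - \<tau> * (W z + P 1 / z) \<le> z powr \<tau> * K z"
      by (rule sums_le[OF lower lower_sums sK])
    then show "?I z * (1 + \<tau>) - \<tau> * (W z + P 1 / z) \<le> z powr \<tau> * K z" by (simp add: mult.commute)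
  qed
  have KI: "((\<lambda>z. z powr \<tau> * K z / ?I z) \<longlongrightarrow> 1) at_top"
  proof (rule tendsto_sandwich[OF _ _ _ tendsto_const])
    show "\<forall>\<^sub>F z in at_top. z powr \<tau> * K z / ?I z \<le> 1"
      using eventually_gt_at_top[of 0]
    proof eventually_elim
      case (elim z)
      then show ?case using bounds(1)[OF elim] I.I_series_ge_1[of z] by simp
    qed
    show "\<forall>\<^sub>F z in at_top. (1 + \<tau>) - \<tau> * (W z / ?I z + P 1 * (inverse z * (1 / ?I z))) \<le> z powr \<tau> * K z / ?I z"
      using eventually_gt_at_top[of 0]
    proof eventually_elim
      case (elim z)
      have I1: "?I z > 0" using I.I_series_ge_1[of z] elim by simp
      have "(1 + \<tau>) - \<tau> * (W z / ?I z + P 1 * (inverse z * (1 / ?I z))) = (?I z * (1 + \<tau>) - \<tau> * (W z + P 1 / z)) / ?I z"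
        using I1 elim by (simp add: field_simps)
      also have "\<dots> \<le> z powr \<tau> * K z / ?I z" using bounds(2)[OF elim] I1 by (intro divide_right_mono) auto
      finally show ?case .
    qed
    have "((\<lambda>z. 1 / ?I z) \<longlongrightarrow> 0) at_top" using I.term_over_I_series_tendsto_0[of 0] by simp
    then have "((\<lambda>z. (1 + \<tau>) - \<tau> * (W z / ?I z + P 1 * (inverse z * (1 / ?I z)))) \<longlongrightarrow> (1 + \<tau>) - \<tau> * (1 + P 1 * (0 * 0))) at_top"
      by (intro tendsto_intros WI tendsto_inverse_0_at_top filterlim_ident)
    then show "((\<lambda>z. (1 + \<tau>) - \<tau> * (W z / ?I z + P 1 * (inverse z * (1 / ?I z)))) \<longlongrightarrow> 1) at_top" by simp
  qed
  have "((\<lambda>z. K z / ?J z / (z powr \<tau> * K z / ?I z)) \<longlongrightarrow> c / 1) at_top"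
    by (intro tendsto_divide KJ KI) simp
  moreover have "\<forall>\<^sub>F z in at_top. z powr \<tau> * K z / ?I z > 0"
    using KI by (rule order_tendstoD(1)) simp
  then have "\<forall>\<^sub>F z in at_top. K z / ?J z / (z powr \<tau> * K z / ?I z) = ?I z / (z powr \<tau> * ?J z)"
    by eventually_elim auto
  ultimately show ?thesis using Lim_transform_eventually by force
qed

text \<open>The partial products of \<open>C_value\<close> are rewritten with Euler's limits for the
  Gamma function and the Euler--Mascheroni constant, which turns them into multiples of \<open>ratio\<close>.\<close>
lemma limit_constant_regular:
  assumes \<beta>: "0 \<le> \<beta>" and l: "l > 0" and lim: "((\<lambda>u. \<psi> u / u powr (1 + \<beta>)) \<longlongrightarrow> l) at_top"
  shows "limit_constant = C_value \<alpha> \<psi> \<theta> \<beta> l"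
proof -
  obtain c where c: "c > 0" "ratio \<longlonglongrightarrow> c" using ratio_converges by blast
  define g where "g n = P (Suc n) / (\<alpha> * real (Suc n)) powr (1 + \<beta>)" for n
  have Ppos: "P (Suc n) > 0" for n by (rule I.phi_pos) simp
  have at: "filterlim (\<lambda>n. \<alpha> * real (Suc n)) at_top sequentially"
    by (intro filterlim_tendsto_pos_mult_at_top[OF tendsto_const alpha_pos] filterlim_compose[OF filterlim_real_sequentially filterlim_Suc])
  have g: "g \<longlonglongrightarrow> l" unfolding g_def[abs_def] by (rule filterlim_compose[OF lim at])
  have P_g: "P (Suc n) = g n * \<alpha> powr (1 + \<beta>) * real (Suc n) powr (1 + \<beta>)" for n
    using alpha_pos by (simp add: g_def powr_mult del: of_nat_Suc)
  have reg: "(\<lambda>n. P (Suc (Suc n)) / P (Suc n)) \<longlonglongrightarrow> 1"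
  proof -
    have r: "(\<lambda>n. real (Suc (Suc n)) / real (Suc n)) \<longlonglongrightarrow> 1" by real_asymp
    have "(\<lambda>n. g (Suc n) / g n * (real (Suc (Suc n)) / real (Suc n)) powr (1 + \<beta>)) \<longlonglongrightarrow> l / l * 1 powr (1 + \<beta>)"
      using l by (intro tendsto_mult tendsto_divide LIMSEQ_Suc[OF g] g tendsto_powr[OF r tendsto_const]) auto
    moreover have "P (Suc (Suc n)) / P (Suc n) = g (Suc n) / g n * (real (Suc (Suc n)) / real (Suc n)) powr (1 + \<beta>)" for n
      unfolding P_g using alpha_pos by (simp add: powr_divide del: of_nat_Suc)
    ultimately show ?thesis using l by simp
  qed
  have "((\<lambda>x. I_series \<alpha> \<psi> (x powr \<alpha>) / ((x powr \<alpha>) powr \<tau> * I_series \<alpha> (shifted_exponent \<psi> \<theta>) (x powr \<alpha>)))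
     \<longlongrightarrow> c) at_top"
  proof (rule filterlim_compose[OF quotient_limit_regular[OF reg c(2)]])
    show "filterlim (\<lambda>x::real. x powr \<alpha>) at_top at_top" using alpha_pos by real_asymp
  qed
  then have "((\<lambda>x. I_series \<alpha> \<psi> (x powr \<alpha>) / (x powr \<theta> * I_series \<alpha> (shifted_exponent \<psi> \<theta>) (x powr \<alpha>)))
     \<longlongrightarrow> c) at_top"
    by (simp add: powr_powr tau)
  with series_quotient_tendsto have lc: "limit_constant = c"
    by (intro tendsto_unique[of at_top]) auto
  define f where "f j = (let k = real (Suc j) in
             exp (- \<beta> * \<tau> / k) * (k * \<psi> (\<alpha> * k + \<theta>)) / ((k + \<tau>) * \<psi> (\<alpha> * k)))" for j
  define Q where "Q n = (\<Prod>j<n. f j)" for n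
  have Q_eq: "Q n = exp (- \<beta> * \<tau> * harm n) * (\<Prod>j<n. real (Suc j) / (real (Suc j) + \<tau>)) * (I.A n / J.A n)" for n
  proof (induction n)
    case 0
    then show ?case by (simp add: Q_def harm_def)
  next
    case (Suc n)
    have "Q (Suc n) = Q n * f n" by (simp add: Q_def)
    moreover have "f n = exp (- \<beta> * \<tau> / real (Suc n)) * (real (Suc n) / (real (Suc n) + \<tau>)) * (\<psi> (\<alpha> * real (Suc n) + \<theta>) / P (Suc n))"
      by (simp add: f_def Let_def del: of_nat_Suc)
    moreover have "exp (- \<beta> * \<tau> * harm (Suc n)) = exp (- \<beta> * \<tau> * harm n) * exp (- \<beta> * \<tau> / real (Suc n))"
      unfolding harm_Suc distrib_left exp_add by (simp only: divide_inverse)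
    ultimately show ?case
      unfolding Suc coeff_ratio_Suc prod.lessThan_Suc by (simp only: mult_ac)
  qed
  define p where "p = exp (- \<beta> * \<tau> * euler_mascheroni) * (\<tau> * Gamma \<tau>) * (c * (l powr \<tau> * \<alpha> powr ((1 + \<beta>) * \<tau>)))"
  have Q_lim: "Q \<longlonglongrightarrow> p"
  proof -
    have "(\<lambda>n. real (Suc n) / real n) \<longlonglongrightarrow> 1" by real_asymp
    from tendsto_powr[OF this tendsto_const, of "(1 + \<beta>) * \<tau>"]
    have "(\<lambda>n. (real (Suc n) / real n) powr ((1 + \<beta>) * \<tau>)) \<longlonglongrightarrow> 1" by simp
    then have "(\<lambda>n. exp (- \<beta> * \<tau> * (harm n - ln (of_nat n))) * (\<tau> * Gamma_series \<tau> n)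
        * (ratio n * (g n powr \<tau> * \<alpha> powr ((1 + \<beta>) * \<tau>))) * (real (Suc n) / real n) powr ((1 + \<beta>) * \<tau>)) \<longlonglongrightarrow> p * 1"
      unfolding p_def using l
      by (intro tendsto_mult tendsto_exp tendsto_const euler_mascheroni_LIMSEQ Gamma_series_LIMSEQ c(2)
           tendsto_powr[OF g tendsto_const]) auto
    moreover have "\<forall>\<^sub>F n in sequentially. exp (- \<beta> * \<tau> * (harm n - ln (of_nat n))) * (\<tau> * Gamma_series \<tau> n)
        * (ratio n * (g n powr \<tau> * \<alpha> powr ((1 + \<beta>) * \<tau>))) * (real (Suc n) / real n) powr ((1 + \<beta>) * \<tau>) = Q n"
      using eventually_gt_at_top[of 0]
    proof eventually_elim
      case (elim n)
      have n: "real n > 0" "real (Suc n) > 0" using elim by auto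
      have 1: "exp (- \<beta> * \<tau> * (harm n - ln (of_nat n))) = exp (- \<beta> * \<tau> * harm n) * real n powr (\<beta> * \<tau>)"
        using n by (simp add: powr_def exp_add[symmetric] algebra_simps)
      have 2: "\<tau> * Gamma_series \<tau> n = (\<Prod>j<n. real (Suc j) / (real (Suc j) + \<tau>)) * real n powr \<tau>"
        using n unfolding prod_ratio_pochhammer[OF tau(1)] by (simp add: Gamma_series_def powr_def)
      have gpos: "g n > 0" unfolding g_def using Ppos[of n] alpha_pos by simp
      have "P (Suc n) powr \<tau> = g n powr \<tau> * \<alpha> powr ((1 + \<beta>) * \<tau>) * real (Suc n) powr ((1 + \<beta>) * \<tau>)"
        unfolding P_g using gpos alpha_pos n by (simp add: powr_mult powr_powr del: of_nat_Suc)
      then have 3: "ratio n * (g n powr \<tau> * \<alpha> powr ((1 + \<beta>) * \<tau>)) * real (Suc n) powr ((1 + \<beta>) * \<tau>) = I.A n / J.A n"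
        unfolding ratio_def using Ppos[of n] gpos alpha_pos
        by (simp add: powr_minus field_simps del: of_nat_Suc)
      have 4: "real n powr ((1 + \<beta>) * \<tau>) = real n powr \<tau> * real n powr (\<beta> * \<tau>)"
        by (simp add: powr_add[symmetric] distrib_right)
      have 5: "(real (Suc n) / real n) powr ((1 + \<beta>) * \<tau>) = real (Suc n) powr ((1 + \<beta>) * \<tau>) / (real n powr \<tau> * real n powr (\<beta> * \<tau>))"
        unfolding 4[symmetric] using n by (simp add: powr_divide del: of_nat_Suc)
      show ?case
        unfolding Q_eq 1 2 3[symmetric] 5 using n by (simp del: of_nat_Suc)
    qed
    ultimately show ?thesis using Lim_transform_eventually by force
  qed
  have Gpos: "Gamma \<tau> > 0" using tau(1) by (rule Gamma_real_pos)
  have p0: "p > 0" unfolding p_def using c tau l alpha_pos Gpos by (intro mult_pos_pos) auto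
  have "f has_prod p"
    unfolding has_prod_def raw_has_prod_def
    using LIMSEQ_Suc[OF Q_lim] p0 by (simp add: Q_def lessThan_Suc_atMost)
  then have pf: "prodinf f = p" by (simp add: has_prod_unique[symmetric])
  have "C_value \<alpha> \<psi> \<theta> \<beta> l = \<alpha> powr (- (1 + \<beta>) * \<tau>) / Gamma (1 + \<tau>) * l powr (- \<tau>)
        * exp (euler_mascheroni * \<beta> * \<tau>) * prodinf f"
    by (simp add: C_value_def Let_def \<tau>_def f_def[abs_def])
  also have "Gamma (1 + \<tau>) = \<tau> * Gamma \<tau>"
  proof -
    have "\<tau> \<notin> \<int>\<^sub>\<le>\<^sub>0" using tau(1) nonpos_Ints_nonpos[of \<tau>] by auto
    then show ?thesis using Gamma_plus1[of \<tau>] by (simp add: add.commute)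
  qed
  also have "\<alpha> powr (- (1 + \<beta>) * \<tau>) / (\<tau> * Gamma \<tau>) * l powr (- \<tau>)
        * exp (euler_mascheroni * \<beta> * \<tau>) * prodinf f = c"
  proof -
    have e1: "\<alpha> powr (- (1 + \<beta>) * \<tau>) = inverse (\<alpha> powr ((1 + \<beta>) * \<tau>))" by (simp add: powr_minus[symmetric] algebra_simps)
    have e2: "exp (euler_mascheroni * \<beta> * \<tau>) = inverse (exp (- \<beta> * \<tau> * euler_mascheroni))"
      by (simp add: exp_minus[symmetric] mult_ac)
    have e3: "l powr (- \<tau>) = inverse (l powr \<tau>)" by (rule powr_minus)
    have cancel: "inverse A / G * inverse L * inverse E * (E * G * (c * (L * A))) = c"
      if "A > 0" "G > 0" "L > 0" "E > 0" for A G L E :: real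
      using that by (simp add: field_simps)
    show ?thesis unfolding pf p_def e1 e2 e3
    proof (rule cancel)
      show "\<tau> * Gamma \<tau> > 0" using tau(1) Gpos by (rule mult_pos_pos)
    qed (use l alpha_pos in auto)
  qed
  finally show ?thesis by (simp add: lc)
qed

end

section \<open>Conclusion\<close>

theorem theorem2p3:
  fixes M :: "'a measure" and \<xi> :: "real \<Rightarrow> 'a \<Rightarrow> real"
    and \<psi> :: "real \<Rightarrow> real" and \<alpha> \<theta> :: real
  assumes "\<alpha> > 0"
    and "\<psi> \<in> LK"
    and "spectrally_negative_levy M \<xi> \<psi>"
    and "extended_expectation M (\<xi> 1) < 0"
    and "\<theta> > 0" and "\<psi> \<theta> = 0"
    and "\<theta> < \<alpha>"
  shows "\<exists>C>0.
    (\<lambda>x::real. I_series \<alpha> \<psi> (x powr \<alpha>)) \<sim>[at_top]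
      (\<lambda>x. C * x powr \<theta> * I_series \<alpha> (shifted_exponent \<psi> \<theta>) (x powr \<alpha>))
    \<and> (\<forall>\<beta> l. \<beta> \<in> {0..1} \<longrightarrow> l > 0 \<longrightarrow> ((\<lambda>u. \<psi> u / u powr (1 + \<beta>)) \<longlongrightarrow> l) at_top
          \<longrightarrow> C = C_value \<alpha> \<psi> \<theta> \<beta> l)
    \<and> (N_fun \<alpha> \<psi> \<theta> C :: complex \<Rightarrow> complex) analytic_on {z. Re z > 0}
    \<and> strict_antimono_on {0..} (N_fun \<alpha> \<psi> \<theta> C :: real \<Rightarrow> real)
    \<and> exponential_functional \<alpha> \<xi> \<in> borel_measurable M
    \<and> (AE \<omega> in M. 0 < exponential_functional \<alpha> \<xi> \<omega> \<and> exponential_functional \<alpha> \<xi> \<omega> < \<infinity>)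
    \<and> (\<forall>q\<ge>0. (\<integral>\<omega>. exp (- q * enn2real (exponential_functional \<alpha> \<xi> \<omega>)) \<partial>M)
               = N_fun \<alpha> \<psi> \<theta> C q)"
proof -
  interpret prob_space M
    using assms(3) by (simp add: spectrally_negative_levy_def levy_process_def)
  interpret negative_drift M \<xi> \<psi> \<alpha> \<theta>
    by unfold_locales (use assms in auto)
  have eq: "(\<lambda>x::real. I_series \<alpha> \<psi> (x powr \<alpha>)) \<sim>[at_top]
      (\<lambda>x. limit_constant * x powr \<theta> * I_series \<alpha> (shifted_exponent \<psi> \<theta>) (x powr \<alpha>))"
    using asymp_equivI'_const[OF series_quotient_tendsto] limit_constant_pos by (simp add: mult.assoc)
  have AE: "AE \<omega> in M. 0 < exponential_functional \<alpha> \<xi> \<omega> \<and> exponential_functional \<alpha> \<xi> \<omega> < \<infinity>"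
    using AE_exponential_functional_finite AE_space
    by eventually_elim (auto intro: exponential_functional_pos)
  show ?thesis
  proof (intro exI[of _ limit_constant] conjI allI impI)
    fix \<beta> l :: real
    assume "\<beta> \<in> {0..1}" "l > 0" "((\<lambda>u. \<psi> u / u powr (1 + \<beta>)) \<longlongrightarrow> l) at_top"
    then show "limit_constant = C_value \<alpha> \<psi> \<theta> \<beta> l" by (intro limit_constant_regular) auto
  next
    fix q :: real assume "q \<ge> 0"
    then show "(\<integral>\<omega>. exp (- q * enn2real (exponential_functional \<alpha> \<xi> \<omega>)) \<partial>M) = N_fun \<alpha> \<psi> \<theta> limit_constant q"
      by (rule laplace_transform_total[unfolded total_def])
  qed (fact limit_constant_pos eq N_fun_analytic N_fun_strict_antimono exponential_functional_measurable AE)+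
qed

end
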